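(* Let $\mathbb{F}$ be a field and let $\mathcal{X}: X^0\subset X^1\subset\cdots\subset X^n=X$ be a finite filtered CW-complex obtained by adding one cell at a time, with cells $\sigma_0,\dots,\sigma_n$ and $X^i=\sigma_0\cup\cdots\cup\sigma_i$. Let $(\mathcal{C}(X),\partial)$ be the associated persistent chain complex of graded $\mathbb{F}[t]$-modules, with pointwise dual $(\mathcal{C}^{\dagger}(X),\partial^{\dagger})$, global dual $(\mathcal{C}^{\circ}(X),\partial^{\circ})$, and pointwise dual of the global dual $(\mathcal{C}^{\circ\dagger}(X),\partial^{\circ\dagger})$, as defined in the context. Then there are isomorphisms of graded $\mathbb{F}[t]$-modules: 1. $H_\bullet(\mathcal{C}(X),\partial)\cong$ the persistent absolute homology of $\mathcal{X}$; 2. $H^\bullet(\mathcal{C}^{\dagger}(X),\partial^{\dagger})\cong$ the persistent absolute cohomology of $\mathcal{X}$; 3. $H^\bullet(\mathcal{C}^{\circ}(X),\partial^{\circ})\cong$ the persistent relative cohomology of $\mathcal{X}$; 4. $H_\bullet(\mathcal{C}^{\circ\dagger}(X),\partial^{\circ\dagger})\cong$ the persistent relative homology of $\mathcal{X}$.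
   Context: All homology and cohomology is taken with coefficients in $\mathbb{F}$; $H_\bullet$ and $H^\bullet$ denote the direct sum of (co)homology over all dimensions. For an endomorphism $\partial$ with $\partial^2=0$, its (co)homology is $\ker(\partial)/\operatorname{im}(\partial)$. Chain complex. Let $C^i=\langle\sigma_0,\dots,\sigma_i\rangle$ be the $\mathbb{F}$-vector space of cellular chains of $X^i$ (all dimensions together). The cellular boundary is $\partial\sigma_j=\sum_{i<j}\lambda_{ij}\sigma_i$ with $\lambda_{ij}\in\mathbb{F}$. Put $X^i=\varnothing$, $C^i=0$ for $i<0$ and $X^i=X$, $C^i=C^n$ for $i\ge n$. Then $\mathcal{C}(X)=\bigoplus_{i\in\mathbb{Z}}C^i$ is a graded $\mathbb{F}[t]$-module ($t$ in degree $1$), where $t$ acts by the structure maps $C^i\to C^{i+1}$ induced by the inclusions $X^i\subseteq X^{i+1}$. It is free on the $n+1$ generators $\sigma_0,\dots,\sigma_n$, with $\sigma_i$ in degree $i$, and $\partial:\mathcal{C}(X)\to\mathcal{C}(X)$ is the homomorphism of graded modules acting as the cellular boundary on each $C^i$. Duals. For a graded $\mathbb{F}[t]$-module $M=\bigoplus_m M^m$: - the pointwise dual $M^\dagger=\operatorname{Hom}_{\mathbb{F}}(M,\mathbb{F})$ is the graded $\mathbb{F}[t]$-module whose degree-$m$ part is the space of linear maps $M^{-m}\to\mathbb{F}$, with $(t\phi)(x)=\phi(tx)$; - the global dual $M^\circ=\operatorname{Hom}_{\mathbb{F}[t]}(M,\mathbb{F}[t])$ is the graded $\mathbb{F}[t]$-module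 whose degree-$m$ part is the space of graded module homomorphisms $M\to\mathbb{F}[t]$ of degree $m$ (sending $M^k$ into $\mathbb{F}[t]^{k+m}$), with $(t\psi)(x)=t\,\psi(x)$. Both are contravariant functors. The maps $\partial^\dagger(\phi)=\phi\circ\partial$ on $\mathcal{C}^\dagger(X)$ and $\partial^\circ(\psi)=\psi\circ\partial$ on $\mathcal{C}^\circ(X)$ are the induced boundary maps. $\mathcal{C}^{\circ\dagger}(X)=(\mathcal{C}^\circ(X))^\dagger$, with $\partial^{\circ\dagger}(\phi)=\phi\circ\partial^\circ$. Persistence modules as graded $\mathbb{F}[t]$-modules. In each case $t$ acts by the maps induced by inclusions of spaces or of pairs: - persistent absolute homology: $H_\bullet(X^0)\to H_\bullet(X^1)\to\cdots\to H_\bullet(X^n)$, with degree-$m$ part $H_\bullet(X^m)$; - persistent absolute cohomology: $H^\bullet(X^0)\leftarrow H^\bullet(X^1)\leftarrow\cdots\leftarrow H^\bullet(X^n)$, with degree-$m$ part $H^\bullet(X^{-m})$; - persistent relative homology: $H_\bullet(X)\to H_\bullet(X,X^0)\to\cdots\to H_\bullet(X,X^{n-1})$, with degree-$m$ part $H_\bullet(X,X^{m-1})$; - persistent relative cohomology: $H^\bullet(X)\leftarrow H^\bullet(X,X^0)\leftarrow\cdots\leftarrow H^\bullet(X,X^{n-1})$, with degree-$m$ part $H^\bullet(X,X^{-m-1})$. Here $m$ ranges over $\mathbb{Z}$, with $X^i=\varnothing$ for $i<0$ and $X^i=X$ for $i\ge n$. *)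

theory Defs
  imports
    "HOL-Homology.Homology_Groups"
    "HOL-Algebra.AbelCoset"
    "HOL-Algebra.Module"
    "HOL-Computational_Algebra.Polynomial"
begin

section \<open>Vector spaces over a field type\<close>

text \<open>The (commutative) ring with carrier a whole type; it is used for the field and for
  its ring of polynomials. A vector space is a \<open>module\<close> record over it. The multiplicative
  fields of such a record have no meaning and are left undefined.\<close>

definition type_ring :: "'r::comm_ring_1 ring" where
  "type_ring = \<lparr>carrier = UNIV, monoid.mult = (*), one = 1, ring.zero = 0, add = (+)\<rparr>"

definition vspace ::
    "'v set \<Rightarrow> 'v \<Rightarrow> ('v \<Rightarrow> 'v \<Rightarrow> 'v) \<Rightarrow> ('f \<Rightarrow> 'v \<Rightarrow> 'v) \<Rightarrow> ('f, 'v) module" where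
  "vspace S z pl sc = \<lparr>carrier = S, monoid.mult = undefined, one = undefined,
     ring.zero = z, add = pl, module.smult = sc\<rparr>"

definition linear_on :: "('f, 'v) module \<Rightarrow> ('f, 'w) module \<Rightarrow> ('v \<Rightarrow> 'w) \<Rightarrow> bool" where
  "linear_on V W f \<longleftrightarrow> f \<in> carrier V \<rightarrow> carrier W
     \<and> (\<forall>x\<in>carrier V. \<forall>y\<in>carrier V. f (x \<oplus>\<^bsub>V\<^esub> y) = f x \<oplus>\<^bsub>W\<^esub> f y)
     \<and> (\<forall>a. \<forall>x\<in>carrier V. f (a \<odot>\<^bsub>V\<^esub> x) = a \<odot>\<^bsub>W\<^esub> f x)"

definition base_field :: "('f::field, 'f) module" where
  "base_field = vspace UNIV 0 (+) (*)"

text \<open>Maps defined on a carrier are represented by functions vanishing outside it.\<close>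

definition on_carrier :: "('f, 'v) module \<Rightarrow> ('v \<Rightarrow> 'w::zero) \<Rightarrow> 'v \<Rightarrow> 'w" where
  "on_carrier V f = (\<lambda>x. if x \<in> carrier V then f x else 0)"

definition dual_space :: "('f::field, 'v) module \<Rightarrow> ('f, 'v \<Rightarrow> 'f) module" where
  "dual_space V =
     vspace {\<phi>. linear_on V base_field \<phi> \<and> (\<forall>x. x \<notin> carrier V \<longrightarrow> \<phi> x = 0)}
       (\<lambda>x. 0) (\<lambda>\<phi> \<psi> x. \<phi> x + \<psi> x) (\<lambda>a \<phi> x. a * \<phi> x)"

definition direct_sum :: "('i \<Rightarrow> ('f, 'v) module) \<Rightarrow> ('f, 'i \<Rightarrow> 'v) module" where
  "direct_sum V =
     vspace {x. (\<forall>i. x i \<in> carrier (V i)) \<and> finite {i. x i \<noteq> \<zero>\<^bsub>V i\<^esub>}}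
       (\<lambda>i. \<zero>\<^bsub>V i\<^esub>) (\<lambda>x y i. x i \<oplus>\<^bsub>V i\<^esub> y i) (\<lambda>a x i. a \<odot>\<^bsub>V i\<^esub> x i)"

text \<open>The quotient \<open>Z / B\<close> of subspaces \<open>B \<subseteq> Z\<close> of \<open>V\<close>, with cosets as elements, and the map
  into a quotient by \<open>B\<close> induced by a map \<open>f\<close> on representatives. The union in \<open>induced\<close>
  is over the representatives of one coset, so that all its members coincide.\<close>

definition induced :: "('f, 'w) module \<Rightarrow> 'w set \<Rightarrow> ('v \<Rightarrow> 'w) \<Rightarrow> 'v set \<Rightarrow> 'w set" where
  "induced V B f A = (\<Union>x\<in>A. B +>\<^bsub>V\<^esub> f x)"

definition quotient_space :: "('f, 'v) module \<Rightarrow> 'v set \<Rightarrow> 'v set \<Rightarrow> ('f, 'v set) module" where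
  "quotient_space V Z B =
     vspace ((\<lambda>z. B +>\<^bsub>V\<^esub> z) ` Z) B (\<lambda>A A'. A <+>\<^bsub>V\<^esub> A')
       (\<lambda>a. induced V B (\<lambda>x. a \<odot>\<^bsub>V\<^esub> x))"


section \<open>Graded modules over the polynomial ring\<close>

text \<open>A graded module over \<open>F[t]\<close> (\<open>t\<close> in degree 1) is given by its homogeneous parts and the
  action of \<open>t\<close>: \<open>tact M m\<close> maps the part of degree \<open>m\<close> to that of degree \<open>m + 1\<close>.
  The module itself is \<open>total M\<close>.\<close>

record ('f, 'v) gmod =
  part :: "int \<Rightarrow> ('f, 'v) module"
  tact :: "int \<Rightarrow> 'v \<Rightarrow> 'v"

definition graded_module :: "('f::field, 'v) gmod \<Rightarrow> bool" where
  "graded_module M \<longleftrightarrow> (\<forall>m. Module.module type_ring (part M m)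
     \<and> linear_on (part M m) (part M (m + 1)) (tact M m))"

fun tpow :: "('f, 'v) gmod \<Rightarrow> nat \<Rightarrow> int \<Rightarrow> 'v \<Rightarrow> 'v" where
  "tpow M 0 m x = x"
| "tpow M (Suc k) m x = tact M (m + int k) (tpow M k m x)"

definition total :: "('f::field, 'v) gmod \<Rightarrow> ('f poly, int \<Rightarrow> 'v) module" where
  "total M = vspace (carrier (direct_sum (part M)))
     (ring.zero (direct_sum (part M))) (add (direct_sum (part M)))
     (\<lambda>p x m. \<Oplus>\<^bsub>part M m\<^esub>k\<in>{..Polynomial.degree p}.
        Polynomial.coeff p k \<odot>\<^bsub>part M m\<^esub> tpow M k (m - int k) (x (m - int k)))"

definition homogeneous :: "('f::field, 'v) gmod \<Rightarrow> int \<Rightarrow> (int \<Rightarrow> 'v) set" where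
  "homogeneous M m = {x \<in> carrier (total M). \<forall>k. k \<noteq> m \<longrightarrow> x k = \<zero>\<^bsub>part M k\<^esub>}"

definition gmod_iso :: "('f::field, 'v) gmod \<Rightarrow> ('f, 'w) gmod \<Rightarrow> bool" (infix \<open>\<cong>\<^sub>g\<^sub>r\<close> 50) where
  "M \<cong>\<^sub>g\<^sub>r N \<longleftrightarrow> graded_module M \<and> graded_module N \<and>
     (\<exists>f. linear_on (total M) (total N) f \<and> bij_betw f (carrier (total M)) (carrier (total N))
        \<and> (\<forall>m. f ` homogeneous M m = homogeneous N m))"

text \<open>The polynomial ring as a graded module over itself; its parts of negative degree are zero.\<close>

definition poly_gmod :: "('f::field, 'f poly) gmod" where
  "poly_gmod = \<lparr>
     part = (\<lambda>m. vspace {p. \<forall>i. Polynomial.coeff p i \<noteq> 0 \<longrightarrow> int i = m} 0 (+) Polynomial.smult),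
     tact = (\<lambda>m p. [:0, 1:] * p)\<rparr>"

definition pdual :: "('f::field, 'v) gmod \<Rightarrow> ('f, 'v \<Rightarrow> 'f) gmod" where
  "pdual M = \<lparr>
     part = (\<lambda>m. dual_space (part M (- m))),
     tact = (\<lambda>m \<phi>. on_carrier (part M (- (m + 1))) (\<lambda>x. \<phi> (tact M (- (m + 1)) x)))\<rparr>"

definition gdual :: "('f::field, 'v) gmod \<Rightarrow> ('f, int \<Rightarrow> 'v \<Rightarrow> 'f poly) gmod" where
  "gdual M = \<lparr>
     part = (\<lambda>m. vspace
       {\<psi>. \<forall>k. linear_on (part M k) (part poly_gmod (k + m)) (\<psi> k)
          \<and> (\<forall>x\<in>carrier (part M k). \<psi> (k + 1) (tact M k x) = tact poly_gmod (k + m) (\<psi> k x))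
          \<and> (\<forall>x. x \<notin> carrier (part M k) \<longrightarrow> \<psi> k x = 0)}
       (\<lambda>k x. 0) (\<lambda>\<psi> \<psi>' k x. \<psi> k x + \<psi>' k x) (\<lambda>a \<psi> k x. Polynomial.smult a (\<psi> k x))),
     tact = (\<lambda>m \<psi> k x. [:0, 1:] * \<psi> k x)\<rparr>"

text \<open>An endomorphism of degree 0 is given by its components \<open>D m\<close> on the homogeneous parts.\<close>

definition pdual_map ::
    "('f::field, 'v) gmod \<Rightarrow> (int \<Rightarrow> 'v \<Rightarrow> 'v) \<Rightarrow> int \<Rightarrow> ('v \<Rightarrow> 'f) \<Rightarrow> 'v \<Rightarrow> 'f" where
  "pdual_map M D m \<phi> = on_carrier (part M (- m)) (\<lambda>x. \<phi> (D (- m) x))"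

definition gdual_map ::
    "('f::field, 'v) gmod \<Rightarrow> (int \<Rightarrow> 'v \<Rightarrow> 'v) \<Rightarrow> int
      \<Rightarrow> (int \<Rightarrow> 'v \<Rightarrow> 'f poly) \<Rightarrow> int \<Rightarrow> 'v \<Rightarrow> 'f poly" where
  "gdual_map M D m \<psi> = (\<lambda>k. on_carrier (part M k) (\<lambda>x. \<psi> k (D k x)))"

definition complex_homology ::
    "('f::field, 'v) gmod \<Rightarrow> (int \<Rightarrow> 'v \<Rightarrow> 'v) \<Rightarrow> ('f, 'v set) gmod" where
  "complex_homology M D = (let im = (\<lambda>m. D m ` carrier (part M m)) in \<lparr>
     part = (\<lambda>m. quotient_space (part M m)
               {x \<in> carrier (part M m). D m x = \<zero>\<^bsub>part M m\<^esub>} (im m)),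
     tact = (\<lambda>m. induced (part M (m + 1)) (im (m + 1)) (tact M m))\<rparr>)"


section \<open>Singular homology and cohomology with coefficients in a field\<close>

text \<open>This follows the integral theory of \<^theory>\<open>HOL-Homology.Simplices\<close>, with the same
  singular simplices and faces. As there, \<open>S\<close> in a pair \<open>(X, S)\<close> need not be contained in
  the space \<open>X\<close>; only its intersection with the space matters.\<close>

type_synonym ('a, 'f) fchain = "((nat \<Rightarrow> real) \<Rightarrow> 'a) \<Rightarrow>\<^sub>0 'f"

definition scale_chain :: "'f::field \<Rightarrow> ('s \<Rightarrow>\<^sub>0 'f) \<Rightarrow> ('s \<Rightarrow>\<^sub>0 'f)" where
  "scale_chain a c = Poly_Mapping.map ((*) a) c"

definition lin_extend :: "('s \<Rightarrow> ('u \<Rightarrow>\<^sub>0 'f)) \<Rightarrow> ('s \<Rightarrow>\<^sub>0 'f::field) \<Rightarrow> ('u \<Rightarrow>\<^sub>0 'f)" where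
  "lin_extend g c = (\<Sum>s\<in>Poly_Mapping.keys c. scale_chain (Poly_Mapping.lookup c s) (g s))"

definition fchains :: "nat \<Rightarrow> 'a topology \<Rightarrow> ('f::field, ('a, 'f) fchain) module" where
  "fchains p X =
     vspace {c. Poly_Mapping.keys c \<subseteq> singular_simplex_set p X} 0 (+) scale_chain"

definition fboundary :: "nat \<Rightarrow> ('a, 'f::field) fchain \<Rightarrow> ('a, 'f) fchain" where
  "fboundary p c = (if p = 0 then 0 else
     lin_extend (\<lambda>s. \<Sum>k\<le>p. Poly_Mapping.single (singular_face p k s) ((-1) ^ k)) c)"

definition fchain_map :: "nat \<Rightarrow> ('b \<Rightarrow> 'a) \<Rightarrow> ('b, 'f::field) fchain \<Rightarrow> ('a, 'f) fchain" where
  "fchain_map p g = lin_extend (\<lambda>s. Poly_Mapping.single (simplex_map p g s) 1)"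

definition relcycles :: "nat \<Rightarrow> 'a topology \<Rightarrow> 'a set \<Rightarrow> ('a, 'f::field) fchain set" where
  "relcycles p X S = {c \<in> carrier (fchains p X).
     fboundary p c \<in> carrier (fchains (p - 1) (subtopology X S))}"

definition relboundaries :: "nat \<Rightarrow> 'a topology \<Rightarrow> 'a set \<Rightarrow> ('a, 'f::field) fchain set" where
  "relboundaries p X S = {fboundary (Suc p) e + a |e a.
     e \<in> carrier (fchains (Suc p) X) \<and> a \<in> carrier (fchains p (subtopology X S))}"

definition singular_homology ::
    "nat \<Rightarrow> 'a topology \<Rightarrow> 'a set \<Rightarrow> ('f::field, ('a, 'f) fchain set) module" where
  "singular_homology p X S = quotient_space (fchains p X) (relcycles p X S) (relboundaries p X S)"

definition total_homology ::
    "'a topology \<Rightarrow> 'a set \<Rightarrow> ('f::field, nat \<Rightarrow> ('a, 'f) fchain set) module" where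
  "total_homology X S = direct_sum (\<lambda>p. singular_homology p X S)"

text \<open>The map into the homology of \<open>(X, S)\<close> induced by the inclusion of a smaller pair.\<close>

definition homology_inclusion :: "'a topology \<Rightarrow> 'a set
    \<Rightarrow> (nat \<Rightarrow> ('a, 'f::field) fchain set) \<Rightarrow> nat \<Rightarrow> ('a, 'f) fchain set" where
  "homology_inclusion X S x = (\<lambda>p. induced (fchains p X) (relboundaries p X S) (\<lambda>c. c) (x p))"

type_synonym ('a, 'f) fcochain = "('a, 'f) fchain \<Rightarrow> 'f"

definition relcochains :: "nat \<Rightarrow> 'a topology \<Rightarrow> 'a set \<Rightarrow> ('a, 'f::field) fcochain set" where
  "relcochains p X S = {\<phi> \<in> carrier (dual_space (fchains p X)).
     \<forall>c\<in>carrier (fchains p (subtopology X S)). \<phi> c = 0}"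

definition coboundary ::
    "nat \<Rightarrow> 'a topology \<Rightarrow> ('a, 'f::field) fcochain \<Rightarrow> ('a, 'f) fcochain" where
  "coboundary p X \<phi> = on_carrier (fchains (Suc p) X) (\<lambda>c. \<phi> (fboundary (Suc p) c))"

definition relcocycles :: "nat \<Rightarrow> 'a topology \<Rightarrow> 'a set \<Rightarrow> ('a, 'f::field) fcochain set" where
  "relcocycles p X S = {\<phi> \<in> relcochains p X S. coboundary p X \<phi> = (\<lambda>c. 0)}"

definition relcoboundaries ::
    "nat \<Rightarrow> 'a topology \<Rightarrow> 'a set \<Rightarrow> ('a, 'f::field) fcochain set" where
  "relcoboundaries p X S =
     (case p of 0 \<Rightarrow> {\<lambda>c. 0} | Suc q \<Rightarrow> coboundary q X ` relcochains q X S)"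

definition singular_cohomology ::
    "nat \<Rightarrow> 'a topology \<Rightarrow> 'a set \<Rightarrow> ('f::field, ('a, 'f) fcochain set) module" where
  "singular_cohomology p X S =
     quotient_space (dual_space (fchains p X)) (relcocycles p X S) (relcoboundaries p X S)"

definition total_cohomology ::
    "'a topology \<Rightarrow> 'a set \<Rightarrow> ('f::field, nat \<Rightarrow> ('a, 'f) fcochain set) module" where
  "total_cohomology X S = direct_sum (\<lambda>p. singular_cohomology p X S)"

text \<open>The map into the cohomology of \<open>(X, S)\<close> induced by its inclusion into a larger pair.\<close>

definition cohomology_restriction :: "'a topology \<Rightarrow> 'a set
    \<Rightarrow> (nat \<Rightarrow> ('a, 'f::field) fcochain set) \<Rightarrow> nat \<Rightarrow> ('a, 'f) fcochain set" where
  "cohomology_restriction X S x =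
     (\<lambda>p. induced (dual_space (fchains p X)) (relcoboundaries p X S) (on_carrier (fchains p X)) (x p))"


section \<open>Filtered CW-complexes\<close>

definition disc :: "nat \<Rightarrow> (nat \<Rightarrow> real) topology" where
  "disc k = subtopology (Euclidean_space k) {x. (\<Sum>i<k. (x i)\<^sup>2) \<le> 1}"

definition open_disc :: "nat \<Rightarrow> (nat \<Rightarrow> real) set" where
  "open_disc k = {x \<in> topspace (disc k). (\<Sum>i<k. (x i)\<^sup>2) < 1}"

text \<open>The boundary sphere is empty for \<open>k = 0\<close>.\<close>

definition disc_sphere :: "nat \<Rightarrow> (nat \<Rightarrow> real) set" where
  "disc_sphere k = {x \<in> topspace (disc k). (\<Sum>i<k. (x i)\<^sup>2) = 1}"

text \<open>The data of a CW-complex with cells numbered \<open>0, \<dots>, last_cell\<close>, each with its dimension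
  and characteristic map.\<close>

record 'a cw_data =
  cw_space :: "'a topology"
  last_cell :: nat
  cell_dim :: "nat \<Rightarrow> nat"
  char_map :: "nat \<Rightarrow> (nat \<Rightarrow> real) \<Rightarrow> 'a"

definition cell :: "'a cw_data \<Rightarrow> nat \<Rightarrow> 'a set" where
  "cell K j = char_map K j ` open_disc (cell_dim K j)"

text \<open>In the last condition, \<open>cell_dim K i < cell_dim K j\<close> is the CW condition on attaching maps,
  and \<open>i < j\<close> says that every stage of the filtration is a subcomplex. Since there are finitely
  many cells, the closure-finiteness and weak topology conditions hold automatically.\<close>

definition filtered_cw_complex :: "'a cw_data \<Rightarrow> bool" where
  "filtered_cw_complex K \<longleftrightarrow>
     Hausdorff_space (cw_space K)
   \<and> topspace (cw_space K) = (\<Union>j\<le>last_cell K. cell K j)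
   \<and> disjoint_family_on (cell K) {..last_cell K}
   \<and> (\<forall>j\<le>last_cell K.
        continuous_map (disc (cell_dim K j)) (cw_space K) (char_map K j)
      \<and> homeomorphic_map (subtopology (disc (cell_dim K j)) (open_disc (cell_dim K j)))
          (subtopology (cw_space K) (cell K j)) (char_map K j)
      \<and> char_map K j ` disc_sphere (cell_dim K j)
          \<subseteq> (\<Union>i\<in>{i. i < j \<and> cell_dim K i < cell_dim K j}. cell K i))"

definition stage_set :: "'a cw_data \<Rightarrow> int \<Rightarrow> 'a set" where
  "stage_set K m = (\<Union>j\<in>{j. j \<le> last_cell K \<and> int j \<le> m}. cell K j)"

definition stage :: "'a cw_data \<Rightarrow> int \<Rightarrow> 'a topology" where
  "stage K m = subtopology (cw_space K) (stage_set K m)"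

definition persistent_homology ::
    "'a cw_data \<Rightarrow> ('f::field, nat \<Rightarrow> ('a, 'f) fchain set) gmod" where
  "persistent_homology K = \<lparr>
     part = (\<lambda>m. total_homology (stage K m) {}),
     tact = (\<lambda>m. homology_inclusion (stage K (m + 1)) {})\<rparr>"

definition persistent_cohomology ::
    "'a cw_data \<Rightarrow> ('f::field, nat \<Rightarrow> ('a, 'f) fcochain set) gmod" where
  "persistent_cohomology K = \<lparr>
     part = (\<lambda>m. total_cohomology (stage K (- m)) {}),
     tact = (\<lambda>m. cohomology_restriction (stage K (- (m + 1))) {})\<rparr>"

definition persistent_rel_homology ::
    "'a cw_data \<Rightarrow> ('f::field, nat \<Rightarrow> ('a, 'f) fchain set) gmod" where
  "persistent_rel_homology K = \<lparr>
     part = (\<lambda>m. total_homology (cw_space K) (stage_set K (m - 1))),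
     tact = (\<lambda>m. homology_inclusion (cw_space K) (stage_set K ((m + 1) - 1)))\<rparr>"

definition persistent_rel_cohomology ::
    "'a cw_data \<Rightarrow> ('f::field, nat \<Rightarrow> ('a, 'f) fcochain set) gmod" where
  "persistent_rel_cohomology K = \<lparr>
     part = (\<lambda>m. total_cohomology (cw_space K) (stage_set K (- m - 1))),
     tact = (\<lambda>m. cohomology_restriction (cw_space K) (stage_set K (- (m + 1) - 1)))\<rparr>"


section \<open>The persistent cellular chain complex\<close>

text \<open>The cellular chains of dimension \<open>k\<close> are the homology of the \<open>k\<close>-skeleton relative to the
  \<open>(k-1)\<close>-skeleton, with basis the images of a generator of the homology of the \<open>k\<close>-disc relative
  to its boundary. The generators are chosen once and for all, as the relative cycles \<open>\<iota> k\<close>.\<close>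

definition disc_generators :: "(nat \<Rightarrow> (nat \<Rightarrow> real, 'f::field) fchain) \<Rightarrow> bool" where
  "disc_generators \<iota> \<longleftrightarrow> (\<forall>k. \<iota> k \<in> relcycles k (disc k) (disc_sphere k)
     \<and> (\<forall>z\<in>relcycles k (disc k) (disc_sphere k).
          \<exists>a. z - scale_chain a (\<iota> k) \<in> relboundaries k (disc k) (disc_sphere k)))"

definition cell_chain ::
    "'a cw_data \<Rightarrow> (nat \<Rightarrow> (nat \<Rightarrow> real, 'f::field) fchain) \<Rightarrow> nat \<Rightarrow> ('a, 'f) fchain" where
  "cell_chain K \<iota> j = fchain_map (cell_dim K j) (char_map K j) (\<iota> (cell_dim K j))"

text \<open>The union of the cells of dimension less than \<open>k\<close>, i.e. the \<open>(k-1)\<close>-skeleton.\<close>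

definition skeleton_below :: "'a cw_data \<Rightarrow> nat \<Rightarrow> 'a set" where
  "skeleton_below K k = (\<Union>j\<in>{j. j \<le> last_cell K \<and> cell_dim K j < k}. cell K j)"

text \<open>For a cell \<open>j\<close> of dimension \<open>k > 0\<close>, the cellular boundary is the image of the class of the
  cell under the connecting map to the homology of the \<open>(k-1)\<close>-skeleton followed by the passage to
  homology relative to the \<open>(k-2)\<close>-skeleton; \<open>cellular_coeff K \<iota> i j\<close> is the coefficient of
  cell \<open>i\<close> in the boundary of cell \<open>j\<close>.\<close>

definition cellular_coeff ::
    "'a cw_data \<Rightarrow> (nat \<Rightarrow> (nat \<Rightarrow> real, 'f::field) fchain) \<Rightarrow> nat \<Rightarrow> nat \<Rightarrow> 'f" where
  "cellular_coeff K \<iota> i j = (THE l.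
      (\<forall>i. l i \<noteq> 0 \<longrightarrow> i < j \<and> Suc (cell_dim K i) = cell_dim K j)
    \<and> (cell_dim K j > 0 \<longrightarrow>
        fboundary (cell_dim K j) (cell_chain K \<iota> j)
          - (\<Sum>i | i < j \<and> Suc (cell_dim K i) = cell_dim K j. scale_chain (l i) (cell_chain K \<iota> i))
        \<in> relboundaries (cell_dim K j - 1)
            (subtopology (cw_space K) (skeleton_below K (cell_dim K j)))
            (skeleton_below K (cell_dim K j - 1)))) i"

text \<open>A cellular chain is the function assigning to each cell its coefficient.\<close>

definition cell_complex :: "'a cw_data \<Rightarrow> ('f::field, nat \<Rightarrow> 'f) gmod" where
  "cell_complex K = \<lparr>
     part = (\<lambda>m. vspace {c. \<forall>j. c j \<noteq> 0 \<longrightarrow> j \<le> last_cell K \<and> int j \<le> m}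
               (\<lambda>j. 0) (\<lambda>c c' j. c j + c' j) (\<lambda>a c j. a * c j)),
     tact = (\<lambda>m c. c)\<rparr>"

definition cell_boundary ::
    "'a cw_data \<Rightarrow> (nat \<Rightarrow> (nat \<Rightarrow> real, 'f::field) fchain)
      \<Rightarrow> int \<Rightarrow> (nat \<Rightarrow> 'f) \<Rightarrow> nat \<Rightarrow> 'f" where
  "cell_boundary K \<iota> m c = (\<lambda>i. \<Sum>j\<le>last_cell K. cellular_coeff K \<iota> i j * c j)"

end

theory Submission
  imports Defs "HOL-Analysis.Abstract_Topological_Spaces"
begin

text \<open>Let \<open>e j\<close> be the singular chain of the cell \<open>j\<close>, the image of the generator of the disc
  under the characteristic map. The boundary of \<open>e j\<close> is in general only homologous, relative to
  a smaller skeleton, to the combination of the \<open>e i\<close> with the cellular coefficients. The key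
  point is that the \<open>e j\<close> can be corrected to chains \<open>s j\<close> with
  \<open>\<partial> (s j) = (\<Sum>i. coeff i j \<cdot> s i)\<close> on the nose (\<open>adapted_exists\<close>): the boundary of \<open>e j\<close> is a
  cycle in the subcomplex of the earlier cells of smaller dimension, by induction it is there
  homologous to a combination of the \<open>s i\<close>, and a chain that realises this homology is
  subtracted from \<open>e j\<close>. So \<open>\<sigma> j \<mapsto> s j\<close> is a chain map from cellular to singular chains. It is
  compatible with all subcomplexes at once, which is what makes every comparison below natural
  in the filtration degree.

  For closed subcomplexes \<open>A \<subseteq> L\<close>, given by sets of cells, this map identifies the homology of
  the combinatorial complex on the cells of \<open>L - A\<close> with the singular homology of the pair
  (\<open>cellular_homology\<close>). The proof removes the last cell of \<open>L - A\<close>, which is the five lemma by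
  hand, and rests on the homology of a single cell attachment: by excision it is that of a disc
  relative to its sphere (\<open>relcycle_from_disc\<close>, \<open>relboundary_from_disc\<close>). The latter is
  concentrated in one dimension (\<open>disc_homology_vanishes\<close>, \<open>disc_homology_nontrivial\<close>), and the
  same attachment result shows this by induction, because a sphere arises from its lower
  hemisphere by attaching the upper one.

  Singular homology with coefficients in a field is reached from the integral theory through
  operators that are given on singular simplices by integral chains. Such an operator extends
  linearly over any field, and an identity of operators need only be checked on simplices.
  Homotopy invariance and excision are therefore derived from a natural prism operator and from
  iterated subdivision, and not from statements about single integral cycles.

  Over a field a linear functional extends from any subspace. So a relative cocycle is a
  functional that vanishes on relative boundaries, a relative coboundary one that vanishes on
  relative cycles, and the transposed matrix computes relative cohomology
  (\<open>cellular_coboundary\<close>, \<open>cellular_cocycle\<close>).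

  Finally, all four complexes have coordinates indexed by cells, in which \<open>t\<close> is the restriction
  to the cells that are present in the next degree. The part of degree \<open>m\<close> of \<open>\<C>\<close> has the cells
  \<open>j \<le> m\<close>. A homomorphism \<open>\<C> \<rightarrow> F[t]\<close> of degree \<open>m\<close> sends \<open>\<sigma> j\<close> to a multiple of \<open>t\<^sup>j\<^sup>+\<^sup>m\<close>, which
  leaves the cells \<open>j \<ge> - m\<close>. The pointwise dual replaces \<open>m\<close> by \<open>- m\<close>. The cells \<open>j \<le> m\<close> form
  \<open>X\<^sup>m\<close> and the cells \<open>j \<ge> m\<close> form the pair \<open>(X, X\<^sup>m\<^sup>-\<^sup>1)\<close>; this is why the pointwise dual gives
  absolute and the global dual gives relative invariants. The boundary acts by the matrix of
  cellular coefficients on \<open>\<C>\<close> and on the double dual, and by its transpose on the two single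
  duals, so that \<open>persistent_homology_iso\<close> covers the first and the last isomorphism and
  \<open>persistent_cohomology_iso\<close> the other two.\<close>

section \<open>Chains with coefficients in a field\<close>

lemma lookup_scale_chain [simp]: "Poly_Mapping.lookup (scale_chain a c) s = a * Poly_Mapping.lookup c s"
  by (auto simp: scale_chain_def Poly_Mapping.map.rep_eq when_def)

interpretation fch: vector_space "scale_chain :: 'f::field \<Rightarrow> ('s \<Rightarrow>\<^sub>0 'f) \<Rightarrow> _"
  by unfold_locales (auto intro!: poly_mapping_eqI simp: lookup_add algebra_simps)

lemma keys_scale_chain_subset: "Poly_Mapping.keys (scale_chain a c) \<subseteq> Poly_Mapping.keys c"
  by (auto simp: in_keys_iff)

lemma scale_chain_single: "scale_chain a (Poly_Mapping.single s b) = Poly_Mapping.single s (a * b)"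
  by (auto intro!: poly_mapping_eqI simp: lookup_single when_def)

lemma chain_decomposition:
  assumes "finite A" "Poly_Mapping.keys c \<subseteq> A"
  shows "c = (\<Sum>s\<in>A. scale_chain (Poly_Mapping.lookup c s) (Poly_Mapping.single s 1))"
proof (rule poly_mapping_eqI)
  fix k
  have "(\<Sum>s\<in>A. Poly_Mapping.lookup c s * (1 when s = k)) = (\<Sum>s\<in>A. if s = k then Poly_Mapping.lookup c k else 0)"
    by (rule sum.cong) (auto simp: when_def)
  also have "\<dots> = Poly_Mapping.lookup c k"
    using assms by (auto simp: in_keys_iff)
  finally show "Poly_Mapping.lookup c k = Poly_Mapping.lookup (\<Sum>s\<in>A. scale_chain (Poly_Mapping.lookup c s) (Poly_Mapping.single s 1)) k"
    by (simp add: lookup_sum lookup_single)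
qed

abbreviation chain_linear :: "(('s \<Rightarrow>\<^sub>0 'f::field) \<Rightarrow> ('u \<Rightarrow>\<^sub>0 'f)) \<Rightarrow> bool" where
  "chain_linear \<equiv> Vector_Spaces.linear scale_chain scale_chain"

lemma chain_linearI:
  assumes "\<And>x y. T (x + y) = T x + T y" "\<And>a x. T (scale_chain a x) = scale_chain a (T x)"
  shows "chain_linear T"
  unfolding Vector_Spaces.linear_def module_hom_def module_hom_axioms_def
  by (auto intro: fch.vector_space_axioms fch.module_axioms assms)

lemma chain_linear_add: "chain_linear T \<Longrightarrow> T (x + y) = T x + T y"
  and chain_linear_scale: "chain_linear T \<Longrightarrow> T (scale_chain a x) = scale_chain a (T x)"
  and chain_linear_diff: "chain_linear T \<Longrightarrow> T (x - y) = T x - T y"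
  and chain_linear_zero: "chain_linear T \<Longrightarrow> T 0 = 0"
  and chain_linear_neg: "chain_linear T \<Longrightarrow> T (- x) = - T x"
  and chain_linear_sum: "chain_linear T \<Longrightarrow> T (sum g A) = (\<Sum>i\<in>A. T (g i))"
  unfolding Vector_Spaces.linear_def
  by (auto simp: module_hom.add module_hom.scale module_hom.diff module_hom.zero module_hom.neg module_hom.sum)

lemma chain_linear_compose: "chain_linear T \<Longrightarrow> chain_linear U \<Longrightarrow> chain_linear (\<lambda>x. T (U x))"
  by (rule chain_linearI) (simp_all add: chain_linear_add chain_linear_scale)

lemma chain_linear_plus: "chain_linear T \<Longrightarrow> chain_linear U \<Longrightarrow> chain_linear (\<lambda>x. T x + U x)"
  by (rule chain_linearI) (simp_all add: chain_linear_add chain_linear_scale algebra_simps fch.scale_right_distrib)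

lemma chain_linear_minus: "chain_linear T \<Longrightarrow> chain_linear U \<Longrightarrow> chain_linear (\<lambda>x. T x - U x)"
  by (rule chain_linearI) (simp_all add: chain_linear_add chain_linear_scale algebra_simps fch.scale_right_diff_distrib)

lemma chain_linear_id: "chain_linear (\<lambda>x. x)"
  by (rule chain_linearI) simp_all

lemma chain_linear_eq_on:
  assumes "chain_linear T" "chain_linear U"
    "\<And>s. s \<in> Poly_Mapping.keys c \<Longrightarrow> T (Poly_Mapping.single s 1) = U (Poly_Mapping.single s 1)"
  shows "T c = U c"
proof -
  have c: "c = (\<Sum>s\<in>Poly_Mapping.keys c. scale_chain (Poly_Mapping.lookup c s) (Poly_Mapping.single s 1))"
    by (rule chain_decomposition) auto
  have "T (\<Sum>s\<in>Poly_Mapping.keys c. scale_chain (Poly_Mapping.lookup c s) (Poly_Mapping.single s 1))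
      = U (\<Sum>s\<in>Poly_Mapping.keys c. scale_chain (Poly_Mapping.lookup c s) (Poly_Mapping.single s 1))"
    using assms by (simp add: chain_linear_sum chain_linear_scale)
  then show ?thesis
    using c by simp
qed

lemma lin_extend_superset:
  assumes "finite A" "Poly_Mapping.keys c \<subseteq> A"
  shows "lin_extend g c = (\<Sum>s\<in>A. scale_chain (Poly_Mapping.lookup c s) (g s))"
  unfolding lin_extend_def
  by (rule sum.mono_neutral_left) (use assms in \<open>auto simp: in_keys_iff\<close>)

lemma chain_linear_lin_extend:
  fixes g :: "'s \<Rightarrow> ('u \<Rightarrow>\<^sub>0 'f::field)"
  shows "chain_linear (lin_extend g)"
proof (rule chain_linearI)
  fix x y :: "'s \<Rightarrow>\<^sub>0 'f"
  let ?A = "Poly_Mapping.keys x \<union> Poly_Mapping.keys y"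
  have "lin_extend g (x + y) = (\<Sum>s\<in>?A. scale_chain (Poly_Mapping.lookup (x + y) s) (g s))"
    by (rule lin_extend_superset) (auto simp: keys_add)
  also have "\<dots> = (\<Sum>s\<in>?A. scale_chain (Poly_Mapping.lookup x s) (g s)) + (\<Sum>s\<in>?A. scale_chain (Poly_Mapping.lookup y s) (g s))"
    by (simp add: lookup_add fch.scale_left_distrib sum.distrib)
  finally show "lin_extend g (x + y) = lin_extend g x + lin_extend g y"
    by (simp add: lin_extend_superset[of ?A])
next
  fix a and x :: "'s \<Rightarrow>\<^sub>0 'f"
  show "lin_extend g (scale_chain a x) = scale_chain a (lin_extend g x)"
    using lin_extend_superset[of "Poly_Mapping.keys x" "scale_chain a x" g] keys_scale_chain_subset[of a x]
    by (simp add: lin_extend_def fch.scale_sum_right)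
qed

lemma lin_extend_single: "lin_extend g (Poly_Mapping.single s a) = scale_chain a (g s)"
  using lin_extend_superset[of "{s}" "Poly_Mapping.single s a" g] by (simp split: if_splits)

lemma keys_lin_extend_subset:
  "Poly_Mapping.keys (lin_extend g c) \<subseteq> (\<Union>s\<in>Poly_Mapping.keys c. Poly_Mapping.keys (g s))"
  unfolding lin_extend_def
  by (rule order.trans[OF keys_sum]) (use keys_scale_chain_subset in fastforce)

definition reduce :: "('s \<Rightarrow>\<^sub>0 int) \<Rightarrow> ('s \<Rightarrow>\<^sub>0 'f::field)" where
  "reduce c = Poly_Mapping.map of_int c"

lemma lookup_reduce: "Poly_Mapping.lookup (reduce c) s = of_int (Poly_Mapping.lookup c s)"
  by (auto simp: reduce_def Poly_Mapping.map.rep_eq when_def)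

lemma reduce_zero [simp]: "reduce 0 = 0"
  and reduce_add: "reduce (c + d) = reduce c + reduce d"
  and reduce_diff: "reduce (c - d) = reduce c - reduce d"
  by (auto intro!: poly_mapping_eqI simp: lookup_reduce lookup_add lookup_minus)

lemma reduce_sum: "reduce (sum f A) = (\<Sum>i\<in>A. reduce (f i))"
  by (induction A rule: infinite_finite_induct) (auto simp: reduce_add)

lemma reduce_frag_of [simp]: "reduce (frag_of s) = Poly_Mapping.single s 1"
  by (auto intro!: poly_mapping_eqI simp: lookup_reduce lookup_single when_def)

lemma reduce_frag_cmul: "reduce (frag_cmul k c) = scale_chain (of_int k) (reduce c)"
  by (auto intro!: poly_mapping_eqI simp: lookup_reduce)

lemma keys_reduce_subset: "Poly_Mapping.keys (reduce c) \<subseteq> Poly_Mapping.keys c"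
  by (auto simp: in_keys_iff lookup_reduce)

text \<open>An operator that is defined over the integers is transported to \<open>F\<close>-chains through its
  values on simplices. This turns composition, sums and differences of additive operators into
  those of their base changes, and two operators that agree on the simplices of a chain have
  base changes that agree on the chain. Every identity between natural operators thereby passes
  from the integers to \<open>F\<close>.\<close>

definition base_change :: "(('s \<Rightarrow>\<^sub>0 int) \<Rightarrow> ('u \<Rightarrow>\<^sub>0 int)) \<Rightarrow> ('s \<Rightarrow>\<^sub>0 'f::field) \<Rightarrow> ('u \<Rightarrow>\<^sub>0 'f)" where
  "base_change T = lin_extend (\<lambda>s. reduce (T (frag_of s)))"

lemma chain_linear_base_change [simp]: "chain_linear (base_change T)"
  by (simp add: base_change_def chain_linear_lin_extend)

lemma base_change_single: "base_change T (Poly_Mapping.single s 1) = reduce (T (frag_of s))"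
  by (simp add: base_change_def lin_extend_single)

lemma base_change_cong:
  assumes "\<And>s. s \<in> Poly_Mapping.keys c \<Longrightarrow> T (frag_of s) = U (frag_of s)"
  shows "base_change T c = base_change U c"
  by (rule chain_linear_eq_on) (auto simp: base_change_single assms)

lemma base_change_reduce:
  assumes "T 0 = 0" "\<And>a b. T (a - b) = T a - T b"
  shows "base_change T (reduce c) = reduce (T c)"
  using subset_UNIV
proof (induction c rule: frag_induction)
  case (one x)
  then show ?case by (simp add: base_change_single)
qed (auto simp: assms reduce_diff chain_linear_diff chain_linear_zero)

lemma base_change_comp:
  assumes "T 0 = 0" "\<And>a b. T (a - b) = T a - T b"
  shows "base_change T (base_change U c) = base_change (\<lambda>x. T (U x)) c"
  by (rule chain_linear_eq_on[OF chain_linear_compose])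
     (auto simp: base_change_single base_change_reduce[of T, OF assms])

lemma base_change_add: "base_change (\<lambda>x. T x + U x) c = base_change T c + base_change U c"
  by (rule chain_linear_eq_on[OF _ chain_linear_plus]) (auto simp: base_change_single reduce_add)

lemma base_change_minus: "base_change (\<lambda>x. T x - U x) c = base_change T c - base_change U c"
  by (rule chain_linear_eq_on[OF _ chain_linear_minus]) (auto simp: base_change_single reduce_diff)

lemma base_change_id: "base_change (\<lambda>x. x) c = c"
  by (rule chain_linear_eq_on) (auto simp: base_change_single chain_linear_id)

lemma base_change_0: "base_change (\<lambda>x. 0) c = 0"
  by (simp add: base_change_def lin_extend_def)

lemma keys_base_change_subset:
  "Poly_Mapping.keys (base_change T c) \<subseteq> (\<Union>s\<in>Poly_Mapping.keys c. Poly_Mapping.keys (T (frag_of s)))"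
  unfolding base_change_def
  by (rule order.trans[OF keys_lin_extend_subset]) (use keys_reduce_subset in fastforce)

abbreviation chains :: "nat \<Rightarrow> 'a topology \<Rightarrow> ('a, 'f::field) fchain set" where
  "chains p X \<equiv> carrier (fchains p X)"

lemma chains_iff: "c \<in> chains p X \<longleftrightarrow> Poly_Mapping.keys c \<subseteq> singular_simplex_set p X"
  by (simp add: fchains_def vspace_def)

lemma chains_keys: "c \<in> chains p X \<Longrightarrow> s \<in> Poly_Mapping.keys c \<Longrightarrow> singular_chain p X (frag_of s)"
  by (auto simp: chains_iff singular_chain_of)

lemma subspace_chains: "fch.subspace (chains p X)"
  by (rule fch.subspaceI) (use keys_add keys_scale_chain_subset in \<open>fastforce simp: chains_iff\<close>)+

lemmas chains_zero [simp] = fch.subspace_0[OF subspace_chains]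
  and chains_add = fch.subspace_add[OF subspace_chains]
  and chains_diff = fch.subspace_diff[OF subspace_chains]
  and chains_scale = fch.subspace_scale[OF subspace_chains]
  and chains_sum = fch.subspace_sum[OF subspace_chains]
  and chains_neg = fch.subspace_neg[OF subspace_chains]

lemma chains_mono: "c \<in> chains p (subtopology X S) \<Longrightarrow> S \<subseteq> T \<Longrightarrow> c \<in> chains p (subtopology X T)"
  using singular_simplex_mono by (fastforce simp: chains_iff)

lemma chains_subtopology: "c \<in> chains p (subtopology X S) \<Longrightarrow> c \<in> chains p X"
  by (fastforce simp: chains_iff singular_simplex_subtopology)

lemma chains_subtopology_Int:
  "c \<in> chains p (subtopology X S) \<Longrightarrow> c \<in> chains p (subtopology X T) \<Longrightarrow> c \<in> chains p (subtopology X (S \<inter> T))"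
  by (fastforce simp: chains_iff singular_simplex_subtopology)

lemma base_change_chains:
  assumes "\<And>s. singular_simplex p X s \<Longrightarrow> singular_chain q Y (T (frag_of s))" "c \<in> chains p X"
  shows "base_change T c \<in> chains q Y"
  using assms keys_base_change_subset[of T c] by (fastforce simp: chains_iff singular_chain_def)

lemma fboundary_base_change: "fboundary p = base_change (chain_boundary p)"
proof (cases "p = 0")
  case True
  then have b: "chain_boundary p = (\<lambda>x. 0)" by (auto simp: chain_boundary_def)
  show ?thesis unfolding b using True by (simp add: fboundary_def base_change_0 fun_eq_iff)
next
  case False
  then show ?thesis
    unfolding fboundary_def base_change_def
    by (auto intro!: arg_cong[where f="\<lambda>g. lin_extend g _"]
        simp: chain_boundary_of reduce_sum reduce_frag_cmul scale_chain_single)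
qed

lemma fchain_map_base_change: "fchain_map p g = base_change (chain_map p g)"
  by (simp add: fchain_map_def base_change_def)

lemma chain_linear_fboundary [simp]: "chain_linear (fboundary p)"
  by (simp add: fboundary_base_change)

lemma chain_linear_fchain_map [simp]: "chain_linear (fchain_map p g)"
  by (simp add: fchain_map_base_change)

lemmas fboundary_add = chain_linear_add[OF chain_linear_fboundary]
  and fboundary_diff = chain_linear_diff[OF chain_linear_fboundary]
  and fboundary_scale = chain_linear_scale[OF chain_linear_fboundary]
  and fboundary_sum = chain_linear_sum[OF chain_linear_fboundary]
  and fboundary_zero [simp] = chain_linear_zero[OF chain_linear_fboundary]
  and fchain_map_add = chain_linear_add[OF chain_linear_fchain_map]
  and fchain_map_diff = chain_linear_diff[OF chain_linear_fchain_map]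
  and fchain_map_scale = chain_linear_scale[OF chain_linear_fchain_map]

lemma fboundary_0 [simp]: "fboundary 0 c = 0"
  by (simp add: fboundary_def)

lemma fboundary_chains: "c \<in> chains p X \<Longrightarrow> fboundary p c \<in> chains (p - 1) X"
  unfolding fboundary_base_change
  by (rule base_change_chains) (simp_all add: singular_chain_boundary singular_chain_of)

lemma fboundary_fboundary:
  assumes "c \<in> chains p X" shows "fboundary (p - 1) (fboundary p c) = 0"
proof -
  have "base_change (chain_boundary (p - 1)) (base_change (chain_boundary p) c)
      = base_change (\<lambda>x. chain_boundary (p - 1) (chain_boundary p x)) c"
    by (rule base_change_comp) (auto simp: chain_boundary_diff)
  also have "\<dots> = base_change (\<lambda>x. 0) c"
    by (rule base_change_cong)
       (use chain_boundary_boundary chains_keys[OF assms] in fastforce)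
  finally show ?thesis by (simp add: fboundary_base_change base_change_0)
qed

lemma fchain_map_chains:
  "c \<in> chains p X \<Longrightarrow> continuous_map X Y g \<Longrightarrow> fchain_map p g c \<in> chains p Y"
  unfolding fchain_map_base_change
  by (rule base_change_chains) (auto simp: singular_chain_of singular_simplex_simplex_map)

lemma fboundary_fchain_map:
  assumes "c \<in> chains p X"
  shows "fboundary p (fchain_map p g c) = fchain_map (p - 1) g (fboundary p c)"
proof -
  have "fboundary p (fchain_map p g c) = base_change (\<lambda>x. chain_boundary p (chain_map p g x)) c"
    unfolding fboundary_base_change fchain_map_base_change
    by (rule base_change_comp) (auto simp: chain_boundary_diff)
  also have "\<dots> = base_change (\<lambda>x. chain_map (p - 1) g (chain_boundary p x)) c"
    by (rule base_change_cong)
       (use chain_boundary_chain_map chains_keys[OF assms] in fastforce)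
  also have "\<dots> = fchain_map (p - 1) g (fboundary p c)"
    unfolding fboundary_base_change fchain_map_base_change
    by (rule base_change_comp[symmetric]) (auto simp: chain_map_diff)
  finally show ?thesis .
qed

lemma fchain_map_compose:
  "fchain_map p (\<lambda>x. h (g x)) c = fchain_map p h (fchain_map p g c)"
proof -
  have "fchain_map p h (fchain_map p g c) = base_change (\<lambda>x. chain_map p h (chain_map p g x)) c"
    unfolding fchain_map_base_change by (rule base_change_comp) (auto simp: chain_map_diff)
  also have "\<dots> = base_change (chain_map p (h \<circ> g)) c"
    unfolding chain_map_compose by (simp add: comp_def)
  finally show ?thesis by (simp add: fchain_map_base_change comp_def)
qed

lemma fchain_map_eq:
  assumes "c \<in> chains p X" "\<And>x. x \<in> topspace X \<Longrightarrow> f x = g x"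
  shows "fchain_map p f c = fchain_map p g c"
  unfolding fchain_map_base_change
proof (rule base_change_cong)
  fix s assume "s \<in> Poly_Mapping.keys c"
  then have "singular_simplex p X s" using assms(1) by (auto simp: chains_iff)
  from simplex_map_eq[OF this assms(2)] show "chain_map p f (frag_of s) = chain_map p g (frag_of s)"
    by simp
qed

lemma fchain_map_ident:
  assumes "c \<in> chains p X" "\<And>x. x \<in> topspace X \<Longrightarrow> f x = x"
  shows "fchain_map p f c = c"
proof -
  have "fchain_map p f c = base_change (\<lambda>x. x) c"
    unfolding fchain_map_base_change
  proof (rule base_change_cong)
    fix s assume "s \<in> Poly_Mapping.keys c"
    then have "singular_simplex p X s" using assms(1) by (auto simp: chains_iff)
    from simplex_map_id_gen[OF this assms(2)] show "chain_map p f (frag_of s) = frag_of s"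
      by simp
  qed
  then show ?thesis by (simp add: base_change_id)
qed

section \<open>Relative cycles and boundaries\<close>

lemma relcycles_iff: "c \<in> relcycles p X S \<longleftrightarrow> c \<in> chains p X \<and> fboundary p c \<in> chains (p - 1) (subtopology X S)"
  by (simp add: relcycles_def)

lemma relboundaries_iff: "c \<in> relboundaries p X S \<longleftrightarrow>
   (\<exists>e a. e \<in> chains (Suc p) X \<and> a \<in> chains p (subtopology X S) \<and> c = fboundary (Suc p) e + a)"
  by (auto simp: relboundaries_def)

lemma relboundariesI:
  "e \<in> chains (Suc p) X \<Longrightarrow> c - fboundary (Suc p) e \<in> chains p (subtopology X S) \<Longrightarrow> c \<in> relboundaries p X S"
  unfolding relboundaries_iff by (metis add.commute diff_add_cancel)

lemma subspace_relcycles: "fch.subspace (relcycles p X S)"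
  by (rule fch.subspaceI)
     (auto simp: relcycles_iff fboundary_add fboundary_scale chains_add chains_scale)

lemma subspace_relboundaries:
  fixes X :: "'a topology"
  shows "fch.subspace (relboundaries p X S :: ('a, 'b::field) fchain set)"
proof (rule fch.subspaceI)
  show "0 \<in> relboundaries p X S"
    unfolding relboundaries_iff by (intro exI[of _ 0]) simp
next
  fix x y :: "('a, 'b) fchain" assume "x \<in> relboundaries p X S" "y \<in> relboundaries p X S"
  then obtain e a e' a' where "e \<in> chains (Suc p) X" "a \<in> chains p (subtopology X S)" "x = fboundary (Suc p) e + a"
    "e' \<in> chains (Suc p) X" "a' \<in> chains p (subtopology X S)" "y = fboundary (Suc p) e' + a'"
    unfolding relboundaries_iff by blast
  then show "x + y \<in> relboundaries p X S"
    unfolding relboundaries_iff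
    by (intro exI[of _ "e + e'"] exI[of _ "a + a'"]) (auto simp: fboundary_add chains_add)
next
  fix k :: 'b and x :: "('a, 'b) fchain" assume "x \<in> relboundaries p X S"
  then obtain e a where "e \<in> chains (Suc p) X" "a \<in> chains p (subtopology X S)" "x = fboundary (Suc p) e + a"
    unfolding relboundaries_iff by blast
  then show "scale_chain k x \<in> relboundaries p X S"
    unfolding relboundaries_iff
    by (intro exI[of _ "scale_chain k e"] exI[of _ "scale_chain k a"])
       (auto simp: fboundary_scale chains_scale fch.scale_right_distrib)
qed

lemmas relcycles_diff = fch.subspace_diff[OF subspace_relcycles]
  and relcycles_scale = fch.subspace_scale[OF subspace_relcycles]
  and relboundaries_add = fch.subspace_add[OF subspace_relboundaries]
  and relboundaries_diff = fch.subspace_diff[OF subspace_relboundaries]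
  and relboundaries_scale = fch.subspace_scale[OF subspace_relboundaries]
  and relboundaries_sum = fch.subspace_sum[OF subspace_relboundaries]
  and relboundaries_zero [simp] = fch.subspace_0[OF subspace_relboundaries]

lemma chains_imp_relboundaries: "a \<in> chains p (subtopology X S) \<Longrightarrow> a \<in> relboundaries p X S"
  by (rule relboundariesI[of 0]) auto

lemma fboundary_imp_relboundaries: "e \<in> chains (Suc p) X \<Longrightarrow> fboundary (Suc p) e \<in> relboundaries p X S"
  by (rule relboundariesI[of e]) auto

lemma relboundaries_subset_relcycles: "relboundaries p X S \<subseteq> relcycles p X S"
proof
  fix c assume "c \<in> relboundaries p X S"
  then obtain e a where ea: "e \<in> chains (Suc p) X" "a \<in> chains p (subtopology X S)" "c = fboundary (Suc p) e + a"
    unfolding relboundaries_iff by blast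
  then show "c \<in> relcycles p X S"
    using fboundary_chains[OF ea(1)] fboundary_fboundary[OF ea(1)] fboundary_chains[OF ea(2)]
    by (auto simp: relcycles_iff fboundary_add intro!: chains_add dest: chains_subtopology)
qed

lemma relboundaries_mono:
  assumes "c \<in> relboundaries p (subtopology X U) S" "U \<subseteq> V" "S \<subseteq> T"
  shows "c \<in> relboundaries p (subtopology X V) T"
proof -
  obtain e a where ea: "e \<in> chains (Suc p) (subtopology X U)" "a \<in> chains p (subtopology (subtopology X U) S)" "c = fboundary (Suc p) e + a"
    using assms unfolding relboundaries_iff by blast
  then show ?thesis
    unfolding relboundaries_iff using assms(2,3)
    by (intro exI[of _ e] exI[of _ a]) (auto simp: subtopology_subtopology intro: chains_mono)
qed

lemma relcycles_mono:
  assumes "c \<in> relcycles p (subtopology X U) S" "U \<subseteq> V" "S \<subseteq> T"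
  shows "c \<in> relcycles p (subtopology X V) T"
  using assms by (auto simp: relcycles_iff subtopology_subtopology intro: chains_mono)

lemma continuous_map_pair:
  assumes "continuous_map X Y g" "g \<in> topspace X \<inter> S \<rightarrow> T"
  shows "continuous_map (subtopology X S) (subtopology Y T) g"
  using assms by (auto simp: continuous_map_in_subtopology continuous_map_from_subtopology)

lemma relcycles_fchain_map:
  assumes "c \<in> relcycles p X S" "continuous_map X Y g" "g \<in> topspace X \<inter> S \<rightarrow> T"
  shows "fchain_map p g c \<in> relcycles p Y T"
  using assms continuous_map_pair[OF assms(2,3)]
  by (auto simp: relcycles_iff fboundary_fchain_map intro: fchain_map_chains)

lemma relboundaries_fchain_map:
  assumes "c \<in> relboundaries p X S" "continuous_map X Y g" "g \<in> topspace X \<inter> S \<rightarrow> T"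
  shows "fchain_map p g c \<in> relboundaries p Y T"
proof -
  obtain e a where ea: "e \<in> chains (Suc p) X" "a \<in> chains p (subtopology X S)" "c = fboundary (Suc p) e + a"
    using assms unfolding relboundaries_iff by blast
  then show ?thesis
    unfolding relboundaries_iff using assms(2) continuous_map_pair[OF assms(2,3)]
    by (intro exI[of _ "fchain_map (Suc p) g e"] exI[of _ "fchain_map p g a"])
       (auto simp: fboundary_fchain_map fchain_map_add intro: fchain_map_chains)
qed

section \<open>Homotopy invariance\<close>

lemma prod_top_of_set: "prod_topology (top_of_set A) (top_of_set B) = top_of_set (A \<times> B)"
  by (metis prod_topology_euclidean subtopology_Times)

text \<open>A convex set contracts to any of its points by straight lines, so a cycle is homologous to
  its image in a one-point space, where cycles of positive dimension bound.\<close>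

lemma convex_cycle_boundary:
  assumes Q: "\<And>x y t. x \<in> Q \<Longrightarrow> y \<in> Q \<Longrightarrow> 0 \<le> t \<Longrightarrow> t \<le> (1::real) \<Longrightarrow> (\<lambda>i::nat. (1 - t) * x i + t * y i) \<in> Q"
    and c: "singular_chain p (subtopology (powertop_real UNIV) Q) c" "chain_boundary p c = 0" and p: "1 \<le> p"
  shows "\<exists>e. singular_chain (Suc p) (subtopology (powertop_real UNIV) Q) e \<and> chain_boundary (Suc p) e = c"
proof (cases "Q = {}")
  case True
  with c have "c = 0" by (simp add: singular_chain_empty)
  then show ?thesis by (intro exI[of _ 0]) auto
next
  case False
  then obtain a where a: "a \<in> Q" by blast
  let ?X = "subtopology (powertop_real UNIV) Q :: (nat \<Rightarrow> real) topology"
  have cyc: "singular_relcycle p ?X {} c"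
    using c by (simp add: singular_cycle)
  have "continuous_on ({0..1} \<times> Q) (\<lambda>z i. (1 - fst z) * snd z i + fst z * a i)"
    by (intro continuous_on_coordinatewise_then_product continuous_intros
        continuous_on_compose2[OF continuous_on_product_coordinates continuous_on_snd[OF continuous_on_id]]) auto
  then have "continuous_map (prod_topology (top_of_set {0..1::real}) ?X) ?X (\<lambda>z i. (1 - fst z) * snd z i + fst z * a i)"
    using Q a by (auto simp: euclidean_product_topology prod_top_of_set continuous_map_in_subtopology)
  then have hom: "homotopic_with (\<lambda>h. h \<in> {} \<rightarrow> {}) ?X ?X id (\<lambda>x. a)"
    unfolding homotopic_with_def
    by (intro exI[of _ "\<lambda>z i. (1 - fst z) * snd z i + fst z * a i"]) (simp add: id_def)
  have 1: "homologous_rel p ?X {} (chain_map p id c) (chain_map p (\<lambda>x. a) c)"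
    by (rule homotopic_imp_homologous_rel_chain_maps[OF hom cyc])
  have cyc': "singular_relcycle p (subtopology ?X {a}) {} (chain_map p (\<lambda>x. a) c)"
    by (rule singular_relcycle_chain_map[OF cyc]) (use a in auto)
  have "topspace (subtopology ?X {a}) = {a}" using a by simp
  from singular_boundary_eq_cycle_singleton[OF this p] cyc'
  have "singular_relboundary p (subtopology ?X {a}) {} (chain_map p (\<lambda>x. a) c)"
    by (rule iffD2)
  then have "singular_relboundary p (subtopology ?X UNIV) {} (chain_map p (\<lambda>x. a) c)"
    by (rule singular_boundary_mono[OF subset_UNIV])
  then have "singular_relboundary p ?X {} (chain_map p (\<lambda>x. a) c)" by simp
  with 1 have "singular_relboundary p ?X {} (chain_map p id c)"
    unfolding homologous_rel_def
    using singular_relboundary_add[of p ?X "{}" "chain_map p id c - chain_map p (\<lambda>x. a) c" "chain_map p (\<lambda>x. a) c"]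
    by simp
  moreover have "chain_map p id c = c" using c chain_map_ident by blast
  ultimately show ?thesis by (auto simp: singular_boundary)
qed

text \<open>The prism \<open>[0, 1] \<times> \<Delta>\<^sup>q\<close> is placed in \<open>\<real>\<^sup>\<nat>\<close> with the interval as coordinate 0 and the
  simplex in the shifted coordinates, so that singular simplices and chains of the prism are
  again chains of functions from \<open>nat \<Rightarrow> real\<close>.\<close>

definition prism_space :: "nat \<Rightarrow> (nat \<Rightarrow> real) topology" where
  "prism_space q = subtopology (powertop_real UNIV) {z. z 0 \<in> {0..1} \<and> z \<circ> Suc \<in> standard_simplex q}"

definition prism_map :: "(real \<times> 'b \<Rightarrow> 'a) \<Rightarrow> ((nat \<Rightarrow> real) \<Rightarrow> 'b) \<Rightarrow> (nat \<Rightarrow> real) \<Rightarrow> 'a" where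
  "prism_map H \<sigma> z = H (z 0, \<sigma> (z \<circ> Suc))"

text \<open>The operator pushes one fixed chain \<open>e\<close> of the prism forward along every \<open>H \<circ> (id \<times> \<sigma>)\<close>.
  It is natural in the homotopy and in the simplices because \<open>e\<close> does not depend on them.\<close>

definition prism_op :: "(nat \<Rightarrow> real) chain \<Rightarrow> (real \<times> 'b \<Rightarrow> 'a) \<Rightarrow> nat \<Rightarrow> 'b chain \<Rightarrow> 'a chain" where
  "prism_op e H q = frag_extend (\<lambda>\<sigma>. chain_map (Suc q) (prism_map H \<sigma>) e)"

definition identity_simplex :: "nat \<Rightarrow> (nat \<Rightarrow> real) chain" where
  "identity_simplex q = frag_of (restrict id (standard_simplex q))"

definition cons_coord :: "real \<times> (nat \<Rightarrow> real) \<Rightarrow> nat \<Rightarrow> real" where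
  "cons_coord z = case_nat (fst z) (snd z)"

lemma prism_op_zero [simp]: "prism_op e H q 0 = 0"
  and prism_op_diff: "prism_op e H q (a - b) = prism_op e H q a - prism_op e H q b"
  by (simp_all add: prism_op_def frag_extend_diff)

lemma continuous_map_prism_map:
  assumes H: "continuous_map (prod_topology (top_of_set {0..1}) S) U H" and s: "singular_simplex q S \<sigma>"
  shows "continuous_map (prism_space q) U (prism_map H \<sigma>)"
proof -
  have 0: "continuous_map (prism_space q) (top_of_set {0..1}) (\<lambda>z. z 0)"
    unfolding continuous_map_in_subtopology prism_space_def
    by (auto intro: continuous_map_product_projection continuous_map_from_subtopology)
  have "continuous_map (powertop_real UNIV) (powertop_real UNIV) (\<lambda>x j. x (Suc j))"
    by (auto intro: continuous_map_product_projection)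
  then have "continuous_map (prism_space q) (subtopology (powertop_real UNIV) (standard_simplex q)) (\<lambda>z. z \<circ> Suc)"
    unfolding prism_space_def comp_def
    by (auto simp: continuous_map_in_subtopology continuous_map_from_subtopology)
  moreover have "continuous_map (subtopology (powertop_real UNIV) (standard_simplex q)) S \<sigma>"
    using s by (simp add: singular_simplex_def)
  ultimately have "continuous_map (prism_space q) S (\<lambda>z. \<sigma> (z \<circ> Suc))"
    using continuous_map_compose[unfolded comp_def] by blast
  with 0 have "continuous_map (prism_space q) (prod_topology (top_of_set {0..1}) S) (\<lambda>z. (z 0, \<sigma> (z \<circ> Suc)))"
    by (simp add: continuous_map_pairwise o_def)
  from continuous_map_compose[OF this H] show ?thesis
    by (simp add: prism_map_def[abs_def] comp_def)
qed

lemma singular_chain_prism_op: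
  assumes "continuous_map (prod_topology (top_of_set {0..1}) S) U H" "singular_chain (Suc q) (prism_space q) e"
    "singular_chain q S c"
  shows "singular_chain (Suc q) U (prism_op e H q c)"
  unfolding prism_op_def
proof (rule singular_chain_extend)
  fix \<sigma> assume "\<sigma> \<in> Poly_Mapping.keys c"
  then have "singular_simplex q S \<sigma>" using assms(3) by (auto simp: singular_chain_def)
  then show "singular_chain (Suc q) U (chain_map (Suc q) (prism_map H \<sigma>) e)"
    using singular_chain_chain_map[OF assms(2)] continuous_map_prism_map[OF assms(1)] by blast
qed

lemma chain_map_prism_op:
  "chain_map (Suc q) G (prism_op e H q c) = prism_op e (\<lambda>z. G (H z)) q c"
  using subset_UNIV
proof (induction c rule: frag_induction)
  case (one \<sigma>)
  have "prism_map (\<lambda>z. G (H z)) \<sigma> = G \<circ> prism_map H \<sigma>"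
    by (auto simp: prism_map_def)
  then show ?case by (simp add: prism_op_def chain_map_compose)
qed (auto simp: prism_op_diff chain_map_diff)

lemma prism_op_chain_map:
  assumes e: "singular_chain (Suc q) (prism_space q) e"
  shows "prism_op e H q (chain_map q \<tau> c) = prism_op e (\<lambda>z. H (fst z, \<tau> (snd z))) q c"
  using subset_UNIV
proof (induction c rule: frag_induction)
  case (one \<sigma>)
  have "chain_map (Suc q) (prism_map H (simplex_map q \<tau> \<sigma>)) e
      = chain_map (Suc q) (prism_map (\<lambda>z. H (fst z, \<tau> (snd z))) \<sigma>) e"
    by (rule chain_map_eq[OF e]) (simp add: prism_map_def simplex_map_def prism_space_def)
  then show ?case by (simp add: prism_op_def)
qed (auto simp: prism_op_diff chain_map_diff)

lemma singular_chain_identity_simplex: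
  "singular_chain q (subtopology (powertop_real UNIV) (standard_simplex q)) (identity_simplex q)"
  unfolding identity_simplex_def singular_chain_of
  by (rule simplicial_imp_singular_simplex) simp

lemma continuous_map_cons_coord:
  "continuous_map (prod_topology (top_of_set {0..1}) (subtopology (powertop_real UNIV) (standard_simplex q)))
     (prism_space q) cons_coord"
proof -
  have c: "continuous_on ({0..1} \<times> standard_simplex q) (\<lambda>z. cons_coord z i)" for i
  proof (cases i)
    case 0
    then show ?thesis by (auto simp: cons_coord_def intro!: continuous_intros)
  next
    case (Suc j)
    then show ?thesis
      by (auto simp: cons_coord_def intro!: continuous_intros
        continuous_on_compose2[OF continuous_on_product_coordinates continuous_on_snd[OF continuous_on_id]])
  qed
  have "continuous_on ({0..1} \<times> standard_simplex q) cons_coord"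
    by (rule continuous_on_coordinatewise_then_product) (rule c)
  moreover have "cons_coord (t, x) \<circ> Suc = x" for t x by (auto simp: cons_coord_def)
  ultimately show ?thesis
    unfolding prism_space_def euclidean_product_topology prod_top_of_set continuous_map_in_subtopology
    by (auto simp: cons_coord_def)
qed

text \<open>The universal case of the homotopy formula: \<open>e\<close> is a chain of the prism over \<open>\<Delta>\<^sup>q\<close> whose
  boundary is the top minus the bottom minus the sides, and the sides are filled by the chain
  \<open>e0\<close> one dimension lower. In dimension 0 there are no sides and \<open>e0\<close> is arbitrary.\<close>

definition prism_chain :: "nat \<Rightarrow> (nat \<Rightarrow> real) chain \<Rightarrow> (nat \<Rightarrow> real) chain \<Rightarrow> bool" where
  "prism_chain q e e0 \<longleftrightarrow> singular_chain (Suc q) (prism_space q) e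
     \<and> (0 < q \<longrightarrow> singular_chain q (prism_space (q - 1)) e0)
     \<and> chain_boundary (Suc q) e = chain_map q (\<lambda>x. cons_coord (1, x)) (identity_simplex q)
         - chain_map q (\<lambda>x. cons_coord (0, x)) (identity_simplex q)
         - prism_op e0 cons_coord (q - 1) (chain_boundary q (identity_simplex q))"

text \<open>By naturality the homotopy formula for any simplex is the image of the universal one under
  \<open>H \<circ> (id \<times> \<sigma>)\<close>.\<close>

lemma chain_boundary_prism_op:
  assumes e: "prism_chain q e e0" and c: "singular_chain q S c"
  shows "chain_boundary (Suc q) (prism_op e H q c)
    = chain_map q (\<lambda>x. H (1, x)) c - chain_map q (\<lambda>x. H (0, x)) c - prism_op e0 H (q - 1) (chain_boundary q c)"
  using c unfolding singular_chain_def
proof (induction c rule: frag_induction)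
  case (one \<sigma>)
  then have \<sigma>: "singular_simplex q S \<sigma>" by simp
  let ?A = "prism_map H \<sigma>"
  have id: "chain_map q \<sigma> (identity_simplex q) = frag_of \<sigma>"
    unfolding identity_simplex_def by (rule singular_simplex_chain_map_id[OF \<sigma>])
  have end_map: "chain_map q ?A (chain_map q (\<lambda>x. cons_coord (t, x)) (identity_simplex q))
      = chain_map q (\<lambda>x. H (t, x)) (frag_of \<sigma>)" for t
  proof -
    have "?A \<circ> (\<lambda>x. cons_coord (t, x)) = (\<lambda>x. H (t, x)) \<circ> \<sigma>"
      by (auto simp: prism_map_def cons_coord_def comp_def)
    then have "chain_map q ?A (chain_map q (\<lambda>x. cons_coord (t, x)) (identity_simplex q))
        = chain_map q ((\<lambda>x. H (t, x)) \<circ> \<sigma>) (identity_simplex q)"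
      by (metis chain_map_compose comp_apply)
    also have "\<dots> = chain_map q (\<lambda>x. H (t, x)) (frag_of \<sigma>)"
      unfolding chain_map_compose comp_apply id ..
    finally show ?thesis .
  qed
  have side: "chain_map q ?A (prism_op e0 cons_coord (q - 1) (chain_boundary q (identity_simplex q)))
     = prism_op e0 H (q - 1) (chain_boundary q (frag_of \<sigma>))"
  proof (cases "q = 0")
    case True
    then show ?thesis by (simp add: chain_boundary_def)
  next
    case False
    then have q: "Suc (q - 1) = q" by simp
    have e0: "singular_chain (Suc (q - 1)) (prism_space (q - 1)) e0"
      using e False by (simp add: prism_chain_def)
    have A: "(\<lambda>z. ?A (cons_coord z)) = (\<lambda>z. H (fst z, \<sigma> (snd z)))"
      by (auto simp: prism_map_def cons_coord_def comp_def)
    have "chain_map q ?A (prism_op e0 cons_coord (q - 1) (chain_boundary q (identity_simplex q)))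
       = prism_op e0 (\<lambda>z. H (fst z, \<sigma> (snd z))) (q - 1) (chain_boundary q (identity_simplex q))"
      using chain_map_prism_op[of "q - 1" ?A e0 cons_coord] unfolding q A .
    also have "\<dots> = prism_op e0 H (q - 1) (chain_map (q - 1) \<sigma> (chain_boundary q (identity_simplex q)))"
      by (rule prism_op_chain_map[OF e0, symmetric])
    also have "chain_map (q - 1) \<sigma> (chain_boundary q (identity_simplex q)) = chain_boundary q (frag_of \<sigma>)"
      using chain_boundary_chain_map[OF singular_chain_identity_simplex, of q \<sigma>] by (simp add: id)
    finally show ?thesis .
  qed
  have "chain_boundary (Suc q) (prism_op e H q (frag_of \<sigma>)) = chain_map q ?A (chain_boundary (Suc q) e)"
    using chain_boundary_chain_map[of "Suc q" "prism_space q" e ?A] e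
    by (simp add: prism_op_def prism_chain_def)
  then show ?case
    using e by (simp only: prism_chain_def chain_map_diff end_map side)
qed (auto simp: prism_op_diff chain_map_diff chain_boundary_diff)

lemma prism_space_convex:
  assumes "x \<in> {z. z 0 \<in> {0..1} \<and> z \<circ> Suc \<in> standard_simplex q}" "y \<in> {z. z 0 \<in> {0..1} \<and> z \<circ> Suc \<in> standard_simplex q}"
    "0 \<le> t" "t \<le> (1::real)"
  shows "(\<lambda>i. (1 - t) * x i + t * y i) \<in> {z. z 0 \<in> {0..1} \<and> z \<circ> Suc \<in> standard_simplex q}"
proof -
  have "(1 - t) * x 0 + t * y 0 \<le> 1"
    using convex_bound_le[of "x 0" 1 "y 0" "1 - t" t] assms by simp
  moreover have "(\<lambda>i. (1 - t) * (x \<circ> Suc) i + t * (y \<circ> Suc) i) \<in> standard_simplex q"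
    by (rule convex_standard_simplex) (use assms in \<open>auto simp del: o_apply\<close>)
  ultimately show ?thesis using assms by (simp add: comp_def)
qed

text \<open>Acyclic models: once the chain for dimension \<open>q\<close> is known, the prescribed boundary of the
  next one is a cycle by the homotopy formula in dimension \<open>q\<close>, and it bounds since the prism is
  convex. Each choice enters the condition on the next one, hence the dependent choice.\<close>

lemma prism_chains_exist: "\<exists>E. \<forall>q. prism_chain q (E q) (E (q - 1))"
proof -
  let ?D = "\<lambda>q. subtopology (powertop_real UNIV) (standard_simplex q) :: (nat \<Rightarrow> real) topology"
  have cont: "continuous_map (?D q) (prism_space q) (\<lambda>x. cons_coord (t, x))" if "t \<in> {0..1}" for q t
    using continuous_map_compose[OF _ continuous_map_cons_coord, where X = "?D q" and f = "\<lambda>x. (t, x)"] that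
    by (auto simp: continuous_map_pairwise comp_def continuous_map_in_subtopology)
  have "\<exists>E. \<forall>q. (\<exists>e0. prism_chain q (E q) e0) \<and> prism_chain (Suc q) (E (Suc q)) (E q)"
  proof (rule dependent_nat_choice)
    \<comment> \<open>In dimension 0 the convexity argument does not apply, since a single point does not
      bound; the two ends of the interval are homologous because the end maps are homotopic.\<close>
    have "homotopic_with (\<lambda>h. h \<in> {} \<rightarrow> {}) (?D 0) (prism_space 0) (\<lambda>x. cons_coord (1, x)) (\<lambda>x. cons_coord (0, x))"
      by (rule homotopic_with_symD) (use continuous_map_cons_coord in \<open>auto simp: homotopic_with_def\<close>)
    from homotopic_imp_homologous_rel_chain_maps[OF this, of 0 "identity_simplex 0"]
    obtain e where "singular_chain 1 (prism_space 0) e"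
      "chain_boundary 1 e = chain_map 0 (\<lambda>x. cons_coord (1, x)) (identity_simplex 0)
         - chain_map 0 (\<lambda>x. cons_coord (0, x)) (identity_simplex 0)"
      using singular_chain_identity_simplex[of 0]
      by (auto simp: singular_cycle homologous_rel_def singular_boundary chain_boundary_def)
    then show "\<exists>e e0. prism_chain 0 e e0"
      by (auto simp: prism_chain_def chain_boundary_def)
  next
    fix e n assume "\<exists>e0. prism_chain n e e0"
    then obtain e0 where e: "prism_chain n e e0" ..
    let ?i = "identity_simplex (Suc n)"
    let ?w = "chain_map (Suc n) (\<lambda>x. cons_coord (1, x)) ?i - chain_map (Suc n) (\<lambda>x. cons_coord (0, x)) ?i
         - prism_op e cons_coord n (chain_boundary (Suc n) ?i)"
    have bi: "singular_chain n (?D (Suc n)) (chain_boundary (Suc n) ?i)"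
      using singular_chain_boundary[OF singular_chain_identity_simplex, of "Suc n"] by simp
    have w: "singular_chain (Suc n) (prism_space (Suc n)) ?w"
      using e by (intro singular_chain_diff singular_chain_chain_map[OF singular_chain_identity_simplex] cont
          singular_chain_prism_op[OF continuous_map_cons_coord _ bi]) (auto simp: prism_chain_def)
    have bbi: "chain_boundary n (chain_boundary (Suc n) ?i) = 0"
      using chain_boundary_boundary[OF singular_chain_identity_simplex, of "Suc n"] by simp
    have cb: "chain_boundary (Suc n) (chain_map (Suc n) g ?i) = chain_map n g (chain_boundary (Suc n) ?i)"
      for g :: "(nat \<Rightarrow> real) \<Rightarrow> nat \<Rightarrow> real"
      using chain_boundary_chain_map[OF singular_chain_identity_simplex, of "Suc n" g] by simp
    have "chain_boundary (Suc n) ?w = 0"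
      by (simp add: chain_boundary_diff chain_boundary_prism_op[OF e bi] bbi cb)
    then have "\<exists>e'. singular_chain (Suc (Suc n)) (prism_space (Suc n)) e' \<and> chain_boundary (Suc (Suc n)) e' = ?w"
      using w unfolding prism_space_def
      by (intro convex_cycle_boundary prism_space_convex) auto
    then obtain e' where "singular_chain (Suc (Suc n)) (prism_space (Suc n)) e'" "chain_boundary (Suc (Suc n)) e' = ?w"
      by blast
    then have "prism_chain (Suc n) e' e"
      using e by (simp add: prism_chain_def)
    then show "\<exists>e'. (\<exists>e0. prism_chain (Suc n) e' e0) \<and> prism_chain (Suc n) e' e"
      by blast
  qed
  then obtain E where E: "\<forall>q. (\<exists>e0. prism_chain q (E q) e0) \<and> prism_chain (Suc q) (E (Suc q)) (E q)" ..
  have "prism_chain q (E q) (E (q - 1))" for q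
  proof (cases q)
    case 0
    obtain e0 where "prism_chain 0 (E 0) e0" using E by blast
    moreover have "chain_boundary 0 (identity_simplex 0) = 0" by (simp add: chain_boundary_def)
    ultimately show ?thesis using 0 by (simp add: prism_chain_def)
  next
    case (Suc n)
    with E show ?thesis by simp
  qed
  then show ?thesis by blast
qed

text \<open>For a relative cycle \<open>c\<close>, the prism over \<open>\<partial> c\<close> lies in the subspace \<open>T\<close>, so the homotopy
  formula shows that the prism over \<open>c\<close> realises the homology.\<close>

theorem homotopic_relcycles_homologous:
  assumes h: "continuous_map (prod_topology (top_of_set {0..1::real}) X) Y h"
    and hT: "\<And>t x. 0 \<le> t \<Longrightarrow> t \<le> 1 \<Longrightarrow> x \<in> topspace X \<Longrightarrow> x \<in> S \<Longrightarrow> h (t, x) \<in> T"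
    and c: "c \<in> relcycles p X S"
  shows "fchain_map p (\<lambda>x. h (1, x)) c - fchain_map p (\<lambda>x. h (0, x)) c \<in> relboundaries p Y T"
proof -
  obtain E where E: "\<And>q. prism_chain q (E q) (E (q - 1))"
    using prism_chains_exist by blast
  have Ec: "singular_chain (Suc q) (prism_space q) (E q)" for q
    using E by (simp add: prism_chain_def)
  let ?P = "\<lambda>q. prism_op (E q) h q"
  have cX: "c \<in> chains p X" and cS: "fboundary p c \<in> chains (p - 1) (subtopology X S)"
    using c by (auto simp: relcycles_iff)
  have hS: "continuous_map (prod_topology (top_of_set {0..1::real}) (subtopology X S)) (subtopology Y T) h"
  proof -
    have "prod_topology (top_of_set {0..1::real}) (subtopology X S)
        = subtopology (prod_topology (top_of_set {0..1::real}) X) (UNIV \<times> S)"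
      by (metis subtopology_Times subtopology_UNIV)
    then show ?thesis
      using h hT by (auto simp: continuous_map_in_subtopology intro: continuous_map_from_subtopology)
  qed
  have P: "base_change (?P p) c \<in> chains (Suc p) Y"
    by (rule base_change_chains[OF _ cX]) (simp add: singular_chain_prism_op[OF h Ec] singular_chain_of)
  have P': "base_change (?P (p - 1)) (fboundary p c) \<in> chains p (subtopology Y T)"
  proof (cases "p = 0")
    case True
    then show ?thesis by (simp add: chain_linear_zero)
  next
    case False
    have "base_change (?P (p - 1)) (fboundary p c) \<in> chains (Suc (p - 1)) (subtopology Y T)"
      by (rule base_change_chains[OF _ cS]) (rule singular_chain_prism_op[OF hS Ec], simp add: singular_chain_of)
    with False show ?thesis by simp
  qed
  have "fboundary (Suc p) (base_change (?P p) c) = base_change (\<lambda>x. chain_boundary (Suc p) (?P p x)) c"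
    unfolding fboundary_base_change by (rule base_change_comp) (auto simp: chain_boundary_diff)
  also have "\<dots> = base_change (\<lambda>x. chain_map p (\<lambda>x. h (1, x)) x - chain_map p (\<lambda>x. h (0, x)) x - ?P (p - 1) (chain_boundary p x)) c"
    by (rule base_change_cong) (rule chain_boundary_prism_op[OF E chains_keys[OF cX]])
  also have "\<dots> = fchain_map p (\<lambda>x. h (1, x)) c - fchain_map p (\<lambda>x. h (0, x)) c - base_change (?P (p - 1)) (fboundary p c)"
    using base_change_comp[of "?P (p - 1)" "chain_boundary p" c]
    by (simp add: base_change_minus fchain_map_base_change fboundary_base_change prism_op_diff)
  finally have eq: "fchain_map p (\<lambda>x. h (1, x)) c - fchain_map p (\<lambda>x. h (0, x)) c - fboundary (Suc p) (base_change (?P p) c)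
      = base_change (?P (p - 1)) (fboundary p c)" by simp
  show ?thesis
    by (rule relboundariesI[OF P]) (simp only: eq P')
qed

section \<open>Subdivision and excision\<close>

abbreviation iterated_subdivision :: "nat \<Rightarrow> nat \<Rightarrow> 'a chain \<Rightarrow> 'a chain" where
  "iterated_subdivision n p \<equiv> singular_subdivision p ^^ n"

definition fsubdivision :: "nat \<Rightarrow> nat \<Rightarrow> ('a, 'f::field) fchain \<Rightarrow> ('a, 'f) fchain" where
  "fsubdivision n p = base_change (iterated_subdivision n p)"

lemma singular_chain_iterated_subdivision:
  "singular_chain p X c \<Longrightarrow> singular_chain p X (iterated_subdivision n p c)"
  by (induction n) (auto simp: singular_chain_singular_subdivision)

lemma chain_boundary_iterated_subdivision:
  "singular_chain p X c \<Longrightarrow> chain_boundary p (iterated_subdivision n p c) = iterated_subdivision n (p - 1) (chain_boundary p c)"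
  by (induction n)
     (auto simp: chain_boundary_singular_subdivision[OF singular_chain_iterated_subdivision])

lemma chain_linear_fsubdivision [simp]: "chain_linear (fsubdivision n p)"
  by (simp add: fsubdivision_def)

lemma fsubdivision_chains: "c \<in> chains p X \<Longrightarrow> fsubdivision n p c \<in> chains p X"
  unfolding fsubdivision_def
  by (rule base_change_chains) (simp_all add: singular_chain_iterated_subdivision singular_chain_of)

lemma fboundary_fsubdivision:
  assumes c: "c \<in> chains p X"
  shows "fboundary p (fsubdivision n p c) = fsubdivision n (p - 1) (fboundary p c)"
proof -
  have "fboundary p (fsubdivision n p c) = base_change (\<lambda>x. chain_boundary p (iterated_subdivision n p x)) c"
    unfolding fboundary_base_change fsubdivision_def by (rule base_change_comp) (auto simp: chain_boundary_diff)
  also have "\<dots> = base_change (\<lambda>x. iterated_subdivision n (p - 1) (chain_boundary p x)) c"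
    by (rule base_change_cong) (rule chain_boundary_iterated_subdivision[OF chains_keys[OF c]])
  also have "\<dots> = fsubdivision n (p - 1) (fboundary p c)"
    unfolding fboundary_base_change fsubdivision_def
    by (rule base_change_comp[symmetric]) (auto simp: singular_subdivision_power_diff)
  finally show ?thesis .
qed

text \<open>The chain homotopy between iterated subdivision and the identity is natural, so it maps
  chains of the subspace to chains of the subspace and has a base change to \<open>F\<close>.\<close>

lemma fsubdivision_homologous:
  assumes c: "c \<in> relcycles p X S"
  shows "fsubdivision n p c - c \<in> relboundaries p X S"
proof -
  obtain h :: "nat \<Rightarrow> 'a chain \<Rightarrow> 'a chain" where h: "\<And>p. h p 0 = 0" "\<And>p c1 c2. h p (c1-c2) = h p c1 - h p c2"
    "\<And>p X c. singular_chain p X c \<Longrightarrow> singular_chain (Suc p) X (h p c)"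
    "\<And>p X c. singular_chain p X c \<Longrightarrow> chain_boundary (Suc p) (h p c) + h (p - Suc 0) (chain_boundary p c)
                   = iterated_subdivision n p c - c"
    using chain_homotopic_iterated_singular_subdivision[of n] by blast
  have cX: "c \<in> chains p X" and cS: "fboundary p c \<in> chains (p - 1) (subtopology X S)"
    using c by (auto simp: relcycles_iff)
  have P: "base_change (h p) c \<in> chains (Suc p) X"
    by (rule base_change_chains[OF _ cX]) (simp add: h singular_chain_of)
  have P': "base_change (h (p - 1)) (fboundary p c) \<in> chains p (subtopology X S)"
  proof (cases "p = 0")
    case True
    then show ?thesis by (simp add: chain_linear_zero)
  next
    case False
    have "base_change (h (p - 1)) (fboundary p c) \<in> chains (Suc (p - 1)) (subtopology X S)"
      by (rule base_change_chains[OF _ cS]) (rule h(3), simp add: singular_chain_of)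
    with False show ?thesis by simp
  qed
  have "fboundary (Suc p) (base_change (h p) c) + base_change (h (p - 1)) (fboundary p c)
      = base_change (\<lambda>x. chain_boundary (Suc p) (h p x) + h (p - 1) (chain_boundary p x)) c"
    unfolding fboundary_base_change base_change_add
    by (subst (1 2) base_change_comp) (auto simp: chain_boundary_diff h(1,2))
  also have "\<dots> = base_change (\<lambda>x. iterated_subdivision n p x - x) c"
    by (rule base_change_cong) (use h(4)[OF chains_keys[OF cX]] in simp)
  also have "\<dots> = fsubdivision n p c - c"
    by (simp add: base_change_minus base_change_id fsubdivision_def)
  finally have eq: "fsubdivision n p c - c - fboundary (Suc p) (base_change (h p) c) = base_change (h (p - 1)) (fboundary p c)"
    by (metis add_diff_cancel_left')
  show ?thesis
    by (rule relboundariesI[OF P]) (simp only: eq P')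
qed

lemma chains_split:
  assumes "Poly_Mapping.keys c \<subseteq> singular_simplex_set p X \<union> singular_simplex_set p Y"
  obtains a b where "a \<in> chains p X" "b \<in> chains p Y" "c = a + b"
proof -
  let ?f = "\<lambda>s. scale_chain (Poly_Mapping.lookup c s) (Poly_Mapping.single s 1)"
  let ?A = "Poly_Mapping.keys c \<inter> singular_simplex_set p X" and ?B = "Poly_Mapping.keys c - singular_simplex_set p X"
  have s: "Poly_Mapping.single s 1 \<in> chains p Z" if "singular_simplex p Z s" for s and Z :: "'a topology"
    using that by (simp add: chains_iff)
  have "c = sum ?f (Poly_Mapping.keys c)"
    by (rule chain_decomposition) auto
  also have "\<dots> = sum ?f ?A + sum ?f ?B"
    by (rule sum.Int_Diff) simp
  finally have "c = sum ?f ?A + sum ?f ?B" .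
  moreover have "sum ?f ?A \<in> chains p X"
    by (intro chains_sum chains_scale s) auto
  moreover have "sum ?f ?B \<in> chains p Y"
    by (intro chains_sum chains_scale s) (use assms in auto)
  ultimately show ?thesis using that by blast
qed

text \<open>The interior of \<open>T\<close> and the complement of the closure of \<open>U\<close> cover \<open>X\<close>, so the pieces of a
  fine enough subdivision of each simplex are small of one of the two kinds. A chain has
  finitely many simplices, and the maximum of their numbers of subdivisions serves for all.\<close>

lemma excised_fchain_exists:
  assumes UT: "X closure_of U \<subseteq> X interior_of T" and c: "c \<in> chains p X"
  obtains n a b where "a \<in> chains p (subtopology X (topspace X - U))" "b \<in> chains p (subtopology X T)"
    "fsubdivision n p c = a + b"
proof -
  define Q where "Q \<equiv> \<lambda>f. \<exists>V \<in> {X interior_of T, topspace X - X closure_of U}. f \<in> standard_simplex p \<rightarrow> V"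
  have "\<exists>n. \<forall>m\<ge>n. \<forall>f. f \<in> Poly_Mapping.keys (iterated_subdivision m p (frag_of s)) \<longrightarrow> Q f"
    if "s \<in> Poly_Mapping.keys c" for s
  proof -
    have ks: "singular_chain p X (frag_of s)" using chains_keys[OF c that] .
    obtain n where n: "\<And>m f. \<lbrakk>n \<le> m; f \<in> Poly_Mapping.keys (iterated_subdivision m p (frag_of s))\<rbrakk> \<Longrightarrow> Q f"
      unfolding Q_def
      apply (rule sufficient_iterated_singular_subdivision_exists
          [of "{X interior_of T, topspace X - X closure_of U}" X p "frag_of s"])
      using UT ks by (auto intro: openin_diff)
    then show ?thesis by blast
  qed
  then obtain N where N: "\<And>s m f. s \<in> Poly_Mapping.keys c \<Longrightarrow> m \<ge> N s \<Longrightarrow> f \<in> Poly_Mapping.keys (iterated_subdivision m p (frag_of s)) \<Longrightarrow> Q f"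
    by metis
  define n where "n = Max (insert 0 (N ` Poly_Mapping.keys c))"
  have nN: "N s \<le> n" if "s \<in> Poly_Mapping.keys c" for s
    unfolding n_def by (rule Max_ge) (use that in auto)
  have Qn: "Q f" if "f \<in> Poly_Mapping.keys (fsubdivision n p c)" for f
    using that keys_base_change_subset[of "iterated_subdivision n p" c] N[OF _ nN]
    unfolding fsubdivision_def by blast
  have sim: "singular_simplex p X f" if "f \<in> Poly_Mapping.keys (fsubdivision n p c)" for f
    using that fsubdivision_chains[OF c, of n] by (auto simp: chains_iff)
  have UcU: "topspace X - X closure_of U \<subseteq> topspace X - U"
    using closure_of_subset_Int[of X U] by blast
  have "Poly_Mapping.keys (fsubdivision n p c) \<subseteq>
     singular_simplex_set p (subtopology X (topspace X - U)) \<union> singular_simplex_set p (subtopology X T)"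
  proof
    fix f assume f: "f \<in> Poly_Mapping.keys (fsubdivision n p c)"
    then show "f \<in> singular_simplex_set p (subtopology X (topspace X - U)) \<union> singular_simplex_set p (subtopology X T)"
      using sim[OF f] Qn[OF f] UcU interior_of_subset[of X T]
      by (fastforce simp: Q_def singular_simplex_subtopology)
  qed
  then show ?thesis
    using chains_split that by metis
qed

text \<open>Surjectivity of excision on homology: of the two parts of a subdivided cycle, the one in
  \<open>T\<close> is zero in the homology relative to \<open>T\<close>.\<close>

lemma excised_relcycle:
  assumes UT: "X closure_of U \<subseteq> X interior_of T" and c: "c \<in> relcycles p X T"
  obtains c' where "c' \<in> relcycles p (subtopology X (topspace X - U)) (T - U)" "c - c' \<in> relboundaries p X T"
proof -
  have cX: "c \<in> chains p X" and cT: "fboundary p c \<in> chains (p - 1) (subtopology X T)"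
    using c by (auto simp: relcycles_iff)
  obtain n a b where ab: "a \<in> chains p (subtopology X (topspace X - U))" "b \<in> chains p (subtopology X T)"
    "fsubdivision n p c = a + b"
    using excised_fchain_exists[OF UT cX] .
  have "fboundary p a = fsubdivision n (p - 1) (fboundary p c) - fboundary p b"
    using fboundary_fsubdivision[OF cX, of n] ab(3) by (simp add: fboundary_add eq_diff_eq)
  then have "fboundary p a \<in> chains (p - 1) (subtopology X T)"
    using fsubdivision_chains[OF cT] fboundary_chains[OF ab(2)] by (simp add: chains_diff)
  moreover have "fboundary p a \<in> chains (p - 1) (subtopology X (topspace X - U))"
    using fboundary_chains[OF ab(1)] .
  ultimately have "fboundary p a \<in> chains (p - 1) (subtopology X ((topspace X - U) \<inter> (T - U)))"
    using chains_subtopology_Int chains_mono by (metis (no_types, lifting) Diff_Int_distrib2 Diff_subset Int_Diff Int_lower2 inf.idem inf_commute le_inf_iff)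
  then have 1: "a \<in> relcycles p (subtopology X (topspace X - U)) (T - U)"
    using ab(1) by (simp add: relcycles_iff subtopology_subtopology)
  have "c - a = b - (fsubdivision n p c - c)"
    using ab(3) by simp
  moreover have "b - (fsubdivision n p c - c) \<in> relboundaries p X T"
    by (intro relboundaries_diff chains_imp_relboundaries ab fsubdivision_homologous c)
  ultimately have "c - a \<in> relboundaries p X T" by (simp only:)
  with 1 show ?thesis using that by blast
qed

text \<open>Injectivity of excision: the chain that bounds \<open>c\<close> in the large pair is subdivided and
  split, and its part outside \<open>U\<close> bounds a subdivision of \<open>c\<close> up to a chain that lies both
  outside \<open>U\<close> and in \<open>T\<close>.\<close>

lemma excised_relboundary:
  assumes UT: "X closure_of U \<subseteq> X interior_of T" and c: "c \<in> relcycles p (subtopology X (topspace X - U)) (T - U)"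
    and cb: "c \<in> relboundaries p X T"
  shows "c \<in> relboundaries p (subtopology X (topspace X - U)) (T - U)"
proof -
  let ?Y = "subtopology X (topspace X - U)"
  obtain e a where ea: "e \<in> chains (Suc p) X" "a \<in> chains p (subtopology X T)" "c = fboundary (Suc p) e + a"
    using cb unfolding relboundaries_iff by blast
  obtain n e1 e2 where e12: "e1 \<in> chains (Suc p) ?Y" "e2 \<in> chains (Suc p) (subtopology X T)"
    "fsubdivision n (Suc p) e = e1 + e2"
    using excised_fchain_exists[OF UT ea(1)] .
  let ?d = "fsubdivision n p c - fboundary (Suc p) e1"
  have "fsubdivision n p c = fboundary (Suc p) (fsubdivision n (Suc p) e) + fsubdivision n p a"
    using fboundary_fsubdivision[OF ea(1), of n] by (simp add: ea(3) chain_linear_add)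
  then have d: "?d = fboundary (Suc p) e2 + fsubdivision n p a"
    using e12(3) by (simp add: fboundary_add)
  have "?d \<in> chains p (subtopology X T)"
    unfolding d using fboundary_chains[OF e12(2)] fsubdivision_chains[OF ea(2)] by (simp add: chains_add)
  moreover have "?d \<in> chains p ?Y"
    using c fboundary_chains[OF e12(1)] by (auto simp: relcycles_iff intro: chains_diff fsubdivision_chains)
  ultimately have "?d \<in> chains p (subtopology X ((topspace X - U) \<inter> (T - U)))"
    using chains_subtopology_Int chains_mono by (metis (no_types, lifting) Diff_Int_distrib2 Diff_subset Int_Diff Int_lower2 inf.idem inf_commute le_inf_iff)
  then have d': "?d \<in> chains p (subtopology ?Y (T - U))"
    by (simp add: subtopology_subtopology)
  have "c = ?d + fboundary (Suc p) e1 - (fsubdivision n p c - c)" by simp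
  moreover have "?d + fboundary (Suc p) e1 - (fsubdivision n p c - c) \<in> relboundaries p ?Y (T - U)"
    by (intro relboundaries_diff relboundaries_add fsubdivision_homologous c
        chains_imp_relboundaries d' fboundary_imp_relboundaries e12)
  ultimately show ?thesis by simp
qed

section \<open>Discs and spheres\<close>

definition sqnorm :: "nat \<Rightarrow> (nat \<Rightarrow> real) \<Rightarrow> real" where
  "sqnorm k x = (\<Sum>i<k. (x i)\<^sup>2)"

definition disc_set :: "nat \<Rightarrow> (nat \<Rightarrow> real) set" where
  "disc_set k = {x. (\<forall>i\<ge>k. x i = 0) \<and> sqnorm k x \<le> 1}"

lemma sqnorm_nonneg [simp]: "0 \<le> sqnorm k x"
  by (simp add: sqnorm_def sum_nonneg)

lemma sqnorm_scale: "sqnorm k (\<lambda>i. r * x i) = r\<^sup>2 * sqnorm k x"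
  by (simp add: sqnorm_def power_mult_distrib sum_distrib_left)

lemma continuous_on_sqnorm [continuous_intros]:
  "continuous_on S f \<Longrightarrow> continuous_on S (\<lambda>x. sqnorm k (f x))"
  unfolding sqnorm_def
  by (intro continuous_on_sum continuous_on_power) (erule continuous_on_product_then_coordinatewise)

lemma disc_top_of_set: "disc k = top_of_set (disc_set k)"
  by (simp add: disc_def Euclidean_space_def subtopology_subtopology euclidean_product_topology
      disc_set_def sqnorm_def Collect_conj_eq)

lemma topspace_disc [simp]: "topspace (disc k) = disc_set k"
  by (simp add: disc_top_of_set)

lemma open_disc_eq: "open_disc k = {x \<in> disc_set k. sqnorm k x < 1}"
  by (simp add: open_disc_def sqnorm_def)

lemma disc_sphere_eq: "disc_sphere k = {x \<in> disc_set k. sqnorm k x = 1}"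
  by (simp add: disc_sphere_def sqnorm_def)

lemma disc_set_Un: "disc_set k = open_disc k \<union> disc_sphere k"
  and open_disc_Int_sphere: "open_disc k \<inter> disc_sphere k = {}"
  by (auto simp: open_disc_eq disc_sphere_eq disc_set_def)

lemma closed_Collect_sqnorm:
  "closed {x. sqnorm k x \<le> r}" "closed {x. r \<le> sqnorm k x}" "open {x. r < sqnorm k x}"
  by (intro closed_Collect_le open_Collect_less continuous_intros)+

lemma compact_space_disc: "compact_space (disc k)"
proof -
  have "closed {x::nat \<Rightarrow> real. x i = 0}" for i
    by (intro closed_Collect_eq continuous_intros continuous_on_product_coordinates)
  then have "closed (\<Inter>i\<in>{k..}. {x::nat \<Rightarrow> real. x i = 0})" by blast
  moreover have "disc_set k = (\<Inter>i\<in>{k..}. {x. x i = 0}) \<inter> {x. sqnorm k x \<le> 1}"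
    by (auto simp: disc_set_def)
  ultimately have cl: "closed (disc_set k)"
    using closed_Collect_sqnorm by auto
  have "compactin (powertop_real UNIV) (disc_set k)"
  proof (rule closed_compactin)
    show "compactin (powertop_real UNIV) (PiE UNIV (\<lambda>i. {-1..1}))"
      by (simp add: compactin_PiE)
    show "closedin (powertop_real UNIV) (disc_set k)"
      using cl by (simp add: euclidean_product_topology)
    show "disc_set k \<subseteq> PiE UNIV (\<lambda>i. {-1..1})"
    proof
      fix x assume x: "x \<in> disc_set k"
      have "x i \<in> {-1..1}" for i
      proof (cases "i < k")
        case True
        then have "(x i)\<^sup>2 \<le> sqnorm k x"
          unfolding sqnorm_def by (intro member_le_sum) auto
        then have "(x i)\<^sup>2 \<le> 1" using x by (simp add: disc_set_def)
        then show ?thesis by (simp add: abs_square_le_1 abs_le_iff)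
      next
        case False
        then show ?thesis using x by (simp add: disc_set_def)
      qed
      then show "x \<in> PiE UNIV (\<lambda>i. {-1..1})" by auto
    qed
  qed
  then show ?thesis
    by (simp add: disc_top_of_set compact_space_subtopology euclidean_product_topology)
qed

lemma Hausdorff_space_disc: "Hausdorff_space (disc k)"
  by (simp add: disc_top_of_set Hausdorff_space_subtopology)

section \<open>Radial expansion of a disc\<close>

definition outer_disc :: "nat \<Rightarrow> (nat \<Rightarrow> real) set" where
  "outer_disc k = {x \<in> disc_set k. 1/4 \<le> sqnorm k x}"

text \<open>At time \<open>t\<close> the disc is stretched by the factor \<open>1 + t\<close>, and points that would leave it
  are stopped on the sphere, which is fixed throughout. At time 1 the factor is 2, so everything
  of norm at least 1/2, that is of squared norm at least 1/4, has reached the sphere. Unlike a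
  retraction of the punctured disc, this is defined at the centre, so it also deforms any space
  to which the disc is attached.\<close>

definition expand :: "nat \<Rightarrow> real \<times> (nat \<Rightarrow> real) \<Rightarrow> nat \<Rightarrow> real" where
  "expand k z = (\<lambda>i. (1 + fst z) / max 1 ((1 + fst z) * sqrt (sqnorm k (snd z))) * snd z i)"

lemma sqnorm_expand:
  assumes "0 \<le> t"
  shows "sqnorm k (expand k (t, x)) = (if (1 + t) * sqrt (sqnorm k x) \<le> 1 then (1 + t)\<^sup>2 * sqnorm k x else 1)"
proof -
  let ?s = "sqrt (sqnorm k x)"
  have e: "sqnorm k (expand k (t, x)) = ((1 + t) / max 1 ((1 + t) * ?s))\<^sup>2 * sqnorm k x"
    unfolding expand_def fst_conv snd_conv by (rule sqnorm_scale)
  show ?thesis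
  proof (cases "(1 + t) * ?s \<le> 1")
    case True
    then show ?thesis unfolding e by (simp add: max_def)
  next
    case False
    then have s: "?s > 0" using assms
      by (metis add_nonneg_nonneg less_eq_real_def linorder_not_le mult_nonneg_nonneg mult_zero_right real_sqrt_ge_zero sqnorm_nonneg zero_le_one)
    have "sqnorm k x = ?s\<^sup>2" by simp
    then have "sqnorm k (expand k (t, x)) = ((1 + t) / ((1 + t) * ?s) * ?s)\<^sup>2"
      unfolding e using False by (simp add: max_def power_mult_distrib)
    also have "\<dots> = 1" using s assms by simp
    finally show ?thesis using False by simp
  qed
qed

lemma expand_in_disc: "0 \<le> t \<Longrightarrow> x \<in> disc_set k \<Longrightarrow> expand k (t, x) \<in> disc_set k"
proof -
  assume t: "0 \<le> t" and x: "x \<in> disc_set k"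
  have "sqnorm k (expand k (t, x)) \<le> 1"
  proof (cases "(1 + t) * sqrt (sqnorm k x) \<le> 1")
    case True
    have "(1 + t)\<^sup>2 * sqnorm k x = ((1 + t) * sqrt (sqnorm k x))\<^sup>2"
      by (simp add: power_mult_distrib)
    also have "\<dots> \<le> 1" using True t by (intro power_le_one) auto
    finally show ?thesis using True t by (simp add: sqnorm_expand)
  qed (use t in \<open>simp add: sqnorm_expand\<close>)
  with x show ?thesis by (auto simp: disc_set_def expand_def)
qed

lemma expand_outer_1: "x \<in> outer_disc k \<Longrightarrow> expand k (1, x) \<in> disc_sphere k"
proof -
  assume x: "x \<in> outer_disc k"
  then have s: "1/2 \<le> sqrt (sqnorm k x)"
    by (intro real_le_rsqrt) (auto simp: outer_disc_def power2_eq_square)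
  have "4 * sqnorm k x = 1" if "2 * sqrt (sqnorm k x) \<le> 1"
  proof -
    have "sqrt (sqnorm k x) = 1/2" using s that by simp
    then have "(sqrt (sqnorm k x))\<^sup>2 = (1/2)\<^sup>2" by (rule arg_cong)
    then show ?thesis by (simp add: power2_eq_square)
  qed
  then show ?thesis
    using x expand_in_disc[of 1 x k] by (auto simp: outer_disc_def disc_sphere_eq sqnorm_expand power2_eq_square)
qed

lemma expand_0: "x \<in> disc_set k \<Longrightarrow> expand k (0, x) = x"
  by (auto simp: expand_def disc_set_def max_def fun_eq_iff)

lemma expand_sphere: "0 \<le> t \<Longrightarrow> x \<in> disc_sphere k \<Longrightarrow> expand k (t, x) = x"
  by (auto simp: expand_def disc_sphere_eq max_def fun_eq_iff)

lemma continuous_on_expand: "continuous_on ({0..1} \<times> disc_set k) (expand k)"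
  unfolding expand_def
  by (intro continuous_on_coordinatewise_then_product continuous_intros
      continuous_on_product_then_coordinatewise[OF continuous_on_snd]) (auto simp: max_def)

lemma continuous_map_expand: "continuous_map (prod_topology (top_of_set {0..1}) (disc k)) (disc k) (expand k)"
  unfolding disc_top_of_set prod_top_of_set continuous_map_in_subtopology
  using continuous_on_expand expand_in_disc by auto

lemma closedin_disc_sphere: "closedin (disc k) (disc_sphere k)"
proof -
  have "disc_sphere k = disc_set k \<inter> ({x. sqnorm k x \<le> 1} \<inter> {x. 1 \<le> sqnorm k x})"
    by (auto simp: disc_sphere_eq)
  then show ?thesis
    unfolding disc_top_of_set using closed_Collect_sqnorm by (metis closed_Int closedin_closed_Int)
qed

section \<open>Attaching one cell\<close>

locale cell_attachment =
  fixes X :: "'a topology" and A :: "'a set" and k :: nat and \<Phi> :: "(nat \<Rightarrow> real) \<Rightarrow> 'a"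
  assumes Hausdorff: "Hausdorff_space X" and compactA: "compactin X A"
    and cont: "continuous_map (disc k) X \<Phi>"
    and sphere: "\<Phi> ` disc_sphere k \<subseteq> A"
    and inj: "inj_on \<Phi> (open_disc k)" and disj: "\<Phi> ` open_disc k \<inter> A = {}"
    and cover: "topspace X = A \<union> \<Phi> ` open_disc k"
begin

definition "collar = A \<union> \<Phi> ` outer_disc k"

lemma closedA: "closedin X A"
  using Hausdorff compactA by (rule compactin_imp_closedin)

lemma closed_map: "closed_map (disc k) X \<Phi>"
  by (rule continuous_imp_closed_map_gen[OF compact_space_disc Hausdorff_imp_kc_space[OF Hausdorff] cont])

lemma interior: "topspace X - A = \<Phi> ` open_disc k"
  using cover disj by auto

text \<open>The restriction of a closed map to a full preimage is closed, and a bijective closed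
  continuous map is a homeomorphism; \<open>\<Phi>\<close> itself is closed since it goes from a compact to a
  Hausdorff space.\<close>

lemma homeo_interior:
  "homeomorphic_map (subtopology (disc k) (disc_set k - disc_sphere k)) (subtopology X (topspace X - A)) \<Phi>"
proof (rule bijective_closed_imp_homeomorphic_map)
  have pre: "{x \<in> topspace (disc k). \<Phi> x \<in> topspace X - A} = disc_set k - disc_sphere k"
    using sphere disj cover by (auto simp: disc_set_Un)
  show "closed_map (subtopology (disc k) (disc_set k - disc_sphere k)) (subtopology X (topspace X - A)) \<Phi>"
    by (rule closed_map_restriction[OF closed_map pre])
  show "continuous_map (subtopology (disc k) (disc_set k - disc_sphere k)) (subtopology X (topspace X - A)) \<Phi>"
    using cont pre by (auto simp: continuous_map_in_subtopology continuous_map_from_subtopology)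
  have o: "topspace (subtopology (disc k) (disc_set k - disc_sphere k)) = open_disc k"
    using open_disc_Int_sphere by (auto simp: disc_set_Un)
  show "\<Phi> ` topspace (subtopology (disc k) (disc_set k - disc_sphere k)) = topspace (subtopology X (topspace X - A))"
    unfolding o using interior by auto
  show "inj_on \<Phi> (topspace (subtopology (disc k) (disc_set k - disc_sphere k)))"
    unfolding o by (rule inj)
qed

text \<open>The radial expansion fixes the sphere, so it descends along \<open>\<Phi>\<close> and extends by the
  identity of \<open>A\<close>. It is continuous on \<open>A\<close> and on the closed cell, both closed, where on the
  closed cell the map \<open>id \<times> \<Phi>\<close> from the compact space \<open>[0, 1] \<times> D\<^sup>k\<close> is a quotient map.\<close>

lemma expansion_exists:
  obtains h where "continuous_map (prod_topology (top_of_set {0..1::real}) X) X h"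
    "\<And>t y. y \<in> A \<Longrightarrow> h (t, y) = y"
    "\<And>t x. 0 \<le> t \<Longrightarrow> x \<in> disc_set k \<Longrightarrow> h (t, \<Phi> x) = \<Phi> (expand k (t, x))"
proof
  define h where "h = (\<lambda>(t::real, y). if y \<in> A then y else \<Phi> (expand k (t, inv_into (open_disc k) \<Phi> y)))"
  show hA: "h (t, y) = y" if "y \<in> A" for t y
    using that by (simp add: h_def)
  show h\<Phi>: "h (t, \<Phi> x) = \<Phi> (expand k (t, x))" if t: "0 \<le> t" and x: "x \<in> disc_set k" for t x
  proof (cases "x \<in> open_disc k")
    case True
    then have "\<Phi> x \<notin> A" using disj by blast
    with True show ?thesis by (simp add: h_def inv_into_f_f[OF inj])
  next
    case False
    then have s: "x \<in> disc_sphere k" using x by (simp add: disc_set_Un)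
    then have "\<Phi> x \<in> A" using sphere by blast
    then show ?thesis using expand_sphere[OF t s] by (simp add: hA)
  qed
  let ?I = "top_of_set {0..1::real}"
  let ?P = "prod_topology ?I X"
  let ?T = "\<lambda>b. {0..1::real} \<times> (if b then A else \<Phi> ` disc_set k)"
  have c\<Phi>: "closedin X (\<Phi> ` disc_set k)"
    using closed_map closedin_topspace[of "disc k"] by (simp add: closed_map_def)
  show "continuous_map ?P X h"
  proof (rule pasting_lemma_closed[where I = "UNIV :: bool set" and T = ?T and f = "\<lambda>b. h"])
    fix b :: bool
    have "closedin ?I {0..1::real}" by simp
    then show "closedin ?P (?T b)"
      using closedA c\<Phi> by (simp add: closedin_prod_Times_iff)
    show "continuous_map (subtopology ?P (?T b)) X h"
    proof (cases b)
      case True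
      have "continuous_map (subtopology ?P (?T b)) X snd"
        by (intro continuous_map_from_subtopology continuous_map_snd)
      then show ?thesis
        by (rule continuous_map_eq) (use True in \<open>auto simp: hA\<close>)
    next
      case False
      let ?q = "\<lambda>z. (fst z, \<Phi> (snd z))"
      have cq: "continuous_map (prod_topology ?I (disc k)) ?P ?q"
        using continuous_map_fst[of ?I "disc k"] continuous_map_compose[OF continuous_map_snd cont, of ?I]
        by (simp add: continuous_map_pairwise comp_def)
      have im: "?q ` topspace (prod_topology ?I (disc k)) = {0..1} \<times> \<Phi> ` disc_set k"
        by force
      have sub: "\<Phi> ` disc_set k \<subseteq> topspace X"
        using c\<Phi> closedin_subset by blast
      have cl: "closed_map (prod_topology ?I (disc k)) ?P ?q"
      proof (rule continuous_imp_closed_map_gen[OF _ _ cq])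
        show "compact_space (prod_topology ?I (disc k))"
          by (simp add: compact_space_prod_topology compact_space_disc compact_space_subtopology)
        show "kc_space ?P"
          by (rule Hausdorff_imp_kc_space)
             (simp add: Hausdorff_space_prod_topology Hausdorff Hausdorff_space_subtopology)
      qed
      have quo: "quotient_map (prod_topology ?I (disc k)) (subtopology ?P ({0..1} \<times> \<Phi> ` disc_set k)) ?q"
      proof (rule continuous_closed_imp_quotient_map)
        show "continuous_map (prod_topology ?I (disc k)) (subtopology ?P ({0..1} \<times> \<Phi> ` disc_set k)) ?q"
          using cq im by (auto simp: continuous_map_in_subtopology)
        show "closed_map (prod_topology ?I (disc k)) (subtopology ?P ({0..1} \<times> \<Phi> ` disc_set k)) ?q"
          by (rule closed_map_into_subtopology[OF cl]) (use im in auto)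
        show "?q ` topspace (prod_topology ?I (disc k)) = topspace (subtopology ?P ({0..1} \<times> \<Phi> ` disc_set k))"
          unfolding im using sub by auto
      qed
      have "continuous_map (prod_topology ?I (disc k)) X (h \<circ> ?q)"
        by (rule continuous_map_eq[OF continuous_map_compose[OF continuous_map_expand cont]])
           (auto simp: h\<Phi>)
      from continuous_compose_quotient_map[OF quo this] show ?thesis
        using False by simp
    qed
  next
    fix z assume "z \<in> topspace ?P"
    then show "\<exists>j. j \<in> UNIV \<and> z \<in> ?T j \<and> h z = h z"
    proof (cases "snd z \<in> A")
      case True
      then show ?thesis using \<open>z \<in> topspace ?P\<close> by (intro exI[of _ True]) (cases z, auto)
    next
      case False
      then show ?thesis using \<open>z \<in> topspace ?P\<close> cover
        by (intro exI[of _ False]) (cases z, auto simp: disc_set_Un)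
    qed
  qed auto
qed

text \<open>The image of the closed disc of radius 1/2 is closed and disjoint from \<open>A\<close>; its complement
  is an open neighbourhood of \<open>A\<close> in the collar. So \<open>A\<close> can be excised from the pair of the
  space and its collar.\<close>

lemma collar_excision: "X closure_of A \<subseteq> X interior_of collar"
proof -
  let ?C = "{x \<in> disc_set k. sqnorm k x \<le> 1/4}"
  have "closedin (disc k) ?C"
    using closed_Collect_sqnorm(1)[of k "1/4"]
    by (auto simp: disc_top_of_set closedin_closed Collect_conj_eq)
  then have "closedin X (\<Phi> ` ?C)"
    using closed_map by (simp add: closed_map_def)
  then have o: "openin X (topspace X - \<Phi> ` ?C)" by blast
  have "?C \<subseteq> open_disc k" by (auto simp: open_disc_eq)
  then have "A \<subseteq> topspace X - \<Phi> ` ?C"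
    using disj cover by blast
  moreover have "topspace X - \<Phi> ` ?C \<subseteq> collar"
    unfolding cover collar_def outer_disc_def open_disc_eq by fastforce
  ultimately have "A \<subseteq> X interior_of collar"
    using interior_of_maximal[OF _ o] by blast
  then show ?thesis using closedA by (simp add: closure_of_closedin)
qed

lemma disc_excision: "disc k closure_of disc_sphere k \<subseteq> disc k interior_of outer_disc k"
proof -
  have "openin (disc k) {x \<in> disc_set k. 1/4 < sqnorm k x}"
    using closed_Collect_sqnorm(3)[of "1/4" k] by (auto simp: disc_top_of_set openin_open Collect_conj_eq)
  then have "{x \<in> disc_set k. 1/4 < sqnorm k x} \<subseteq> disc k interior_of outer_disc k"
    by (rule interior_of_maximal[rotated]) (auto simp: outer_disc_def)
  then show ?thesis
    unfolding closure_of_closedin[OF closedin_disc_sphere] by (auto simp: disc_sphere_eq)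
qed

lemma interior_inverse:
  obtains \<psi> where "continuous_map (subtopology X (topspace X - A)) (subtopology (disc k) (disc_set k - disc_sphere k)) \<psi>"
    "\<And>x. x \<in> open_disc k \<Longrightarrow> \<psi> (\<Phi> x) = x" "\<And>y. y \<in> topspace X - A \<Longrightarrow> \<Phi> (\<psi> y) = y"
proof -
  obtain \<psi> where \<psi>: "homeomorphic_maps (subtopology (disc k) (disc_set k - disc_sphere k)) (subtopology X (topspace X - A)) \<Phi> \<psi>"
    using homeo_interior unfolding homeomorphic_map_maps by blast
  have o: "disc_set k - disc_sphere k = open_disc k"
    using open_disc_Int_sphere by (auto simp: disc_set_Un)
  show ?thesis
    by (rule that[of \<psi>]) (use \<psi> o in \<open>auto simp: homeomorphic_maps_def disc_set_Un\<close>)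
qed

lemma continuous_map_interior:
  "continuous_map (subtopology (disc k) (disc_set k - disc_sphere k)) (subtopology X (topspace X - A)) \<Phi>"
  using homeo_interior by (rule homeomorphic_imp_continuous_map)

lemma interior_pair: "\<Phi> \<in> topspace (subtopology (disc k) (disc_set k - disc_sphere k)) \<inter> (outer_disc k - disc_sphere k) \<rightarrow> collar - A"
  using disj by (auto simp: collar_def outer_disc_def disc_set_Un)

text \<open>Surjectivity of the map from the homology of the disc relative to its sphere. A relative
  cycle is pushed off \<open>A\<close> by excision relative to the collar, where it can be lifted to the
  disc. The lift is a cycle relative to the outer part of the disc only; expanding it makes it a
  cycle relative to the sphere, and the expansion of the space shows that this does not change
  the class of its image.\<close>

theorem relcycle_from_disc:
  assumes z: "z \<in> relcycles p X A"
  obtains w where "w \<in> relcycles p (disc k) (disc_sphere k)" "z - fchain_map p \<Phi> w \<in> relboundaries p X A"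
proof -
  obtain h where h: "continuous_map (prod_topology (top_of_set {0..1::real}) X) X h"
    "\<And>t y. y \<in> A \<Longrightarrow> h (t, y) = y"
    "\<And>t x. 0 \<le> t \<Longrightarrow> x \<in> disc_set k \<Longrightarrow> h (t, \<Phi> x) = \<Phi> (expand k (t, x))"
    using expansion_exists by blast
  obtain \<psi> where \<psi>: "continuous_map (subtopology X (topspace X - A)) (subtopology (disc k) (disc_set k - disc_sphere k)) \<psi>"
    "\<And>x. x \<in> open_disc k \<Longrightarrow> \<psi> (\<Phi> x) = x" "\<And>y. y \<in> topspace X - A \<Longrightarrow> \<Phi> (\<psi> y) = y"
    using interior_inverse by blast
  let ?r = "\<lambda>y. h (1, y)" and ?e = "\<lambda>x. expand k (1, x)"
  have contr: "continuous_map X X ?r"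
    using continuous_map_compose[OF _ h(1), where X = X and f = "\<lambda>y. (1, y)"] by (simp add: continuous_map_pairwise comp_def)
  have conte: "continuous_map (disc k) (disc k) ?e"
    using continuous_map_compose[OF _ continuous_map_expand, where X = "disc k" and f = "\<lambda>y. (1, y)"]
    by (simp add: continuous_map_pairwise comp_def del: topspace_disc)
  have r_collar: "?r \<in> topspace X \<inter> collar \<rightarrow> A"
    using h(2,3) expand_outer_1 sphere by (auto simp: collar_def outer_disc_def)
  have A_collar: "A \<subseteq> collar" by (auto simp: collar_def)
  have "z \<in> relcycles p X collar"
    using relcycles_mono[of z p X UNIV A UNIV collar] z A_collar by simp
  then obtain z' where z': "z' \<in> relcycles p (subtopology X (topspace X - A)) (collar - A)" "z - z' \<in> relboundaries p X collar"
    using excised_relcycle[OF collar_excision] by blast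
  define w' where "w' = fchain_map p \<psi> z'"
  have \<psi>_pair: "\<psi> \<in> topspace (subtopology X (topspace X - A)) \<inter> (collar - A) \<rightarrow> outer_disc k"
  proof
    fix y assume "y \<in> topspace (subtopology X (topspace X - A)) \<inter> (collar - A)"
    then obtain x where x: "x \<in> outer_disc k" "y = \<Phi> x" "y \<notin> A" by (auto simp: collar_def)
    then have "x \<in> open_disc k" using sphere by (auto simp: outer_disc_def disc_set_Un)
    with x show "\<psi> y \<in> outer_disc k" by (simp add: \<psi>(2))
  qed
  have w': "w' \<in> relcycles p (disc k) (outer_disc k)"
    unfolding w'_def
    by (rule relcycles_fchain_map[OF z'(1) _ \<psi>_pair]) (use \<psi>(1) in \<open>auto simp: continuous_map_in_subtopology\<close>)
  have \<Phi>w': "fchain_map p \<Phi> w' = z'"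
    unfolding w'_def fchain_map_compose[symmetric]
    by (rule fchain_map_ident[of _ _ "subtopology X (topspace X - A)"]) (use z' \<psi>(3) in \<open>auto simp: relcycles_iff\<close>)
  define w where "w = fchain_map p ?e w'"
  have w: "w \<in> relcycles p (disc k) (disc_sphere k)"
    unfolding w_def by (rule relcycles_fchain_map[OF w' conte]) (auto intro: expand_outer_1)
  have rz: "fchain_map p ?r z' = fchain_map p \<Phi> w"
  proof -
    have "fchain_map p ?r z' = fchain_map p (\<lambda>x. ?r (\<Phi> x)) w'"
      using \<Phi>w' fchain_map_compose[of p ?r \<Phi> w'] by simp
    also have "\<dots> = fchain_map p (\<lambda>x. \<Phi> (?e x)) w'"
      by (rule fchain_map_eq[of _ _ "disc k"]) (use w' h(3) in \<open>auto simp: relcycles_iff\<close>)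
    also have "\<dots> = fchain_map p \<Phi> w"
      unfolding w_def by (rule fchain_map_compose[of p \<Phi> ?e w'])
    finally show ?thesis .
  qed
  have 1: "fchain_map p ?r (z - z') \<in> relboundaries p X A"
    by (rule relboundaries_fchain_map[OF z'(2) contr r_collar])
  have "fchain_map p (\<lambda>x. h (1, x)) z - fchain_map p (\<lambda>x. h (0, x)) z \<in> relboundaries p X A"
    by (rule homotopic_relcycles_homologous[OF h(1) _ z]) (simp add: h(2))
  moreover have "fchain_map p (\<lambda>x. h (0, x)) z = z"
  proof (rule fchain_map_ident[of _ _ X])
    fix y assume "y \<in> topspace X"
    then show "h (0, y) = y" unfolding cover using h(2) h(3)[of 0] expand_0 by (auto simp: disc_set_Un)
  qed (use z in \<open>auto simp: relcycles_iff\<close>)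
  ultimately have 2: "fchain_map p ?r z - z \<in> relboundaries p X A" by simp
  have "z - fchain_map p \<Phi> w = fchain_map p ?r (z - z') - (fchain_map p ?r z - z)"
    by (simp add: fchain_map_diff rz)
  also have "\<dots> \<in> relboundaries p X A"
    using 1 2 by (rule relboundaries_diff)
  finally show ?thesis using that w by blast
qed

text \<open>Injectivity, by the same route: after excising the sphere from the disc and \<open>A\<close> from the
  space, the two pairs are homeomorphic, so the class vanishes relative to the outer part of the
  disc, and the expansion brings this back to the sphere.\<close>

theorem relboundary_from_disc:
  assumes w: "w \<in> relcycles p (disc k) (disc_sphere k)" and b: "fchain_map p \<Phi> w \<in> relboundaries p X A"
  shows "w \<in> relboundaries p (disc k) (disc_sphere k)"
proof -
  obtain \<psi> where \<psi>: "continuous_map (subtopology X (topspace X - A)) (subtopology (disc k) (disc_set k - disc_sphere k)) \<psi>"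
    "\<And>x. x \<in> open_disc k \<Longrightarrow> \<psi> (\<Phi> x) = x" "\<And>y. y \<in> topspace X - A \<Longrightarrow> \<Phi> (\<psi> y) = y"
    using interior_inverse by blast
  let ?e = "\<lambda>x. expand k (1, x)"
  have conte: "continuous_map (disc k) (disc k) ?e"
    using continuous_map_compose[OF _ continuous_map_expand, where X = "disc k" and f = "\<lambda>y. (1, y)"]
    by (simp add: continuous_map_pairwise comp_def del: topspace_disc)
  have so: "disc_sphere k \<subseteq> outer_disc k" by (auto simp: disc_sphere_eq outer_disc_def)
  have "w \<in> relcycles p (disc k) (outer_disc k)"
    using relcycles_mono[of w p "disc k" UNIV "disc_sphere k" UNIV "outer_disc k"] w so by simp
  then obtain w' where w': "w' \<in> relcycles p (subtopology (disc k) (topspace (disc k) - disc_sphere k)) (outer_disc k - disc_sphere k)"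
    "w - w' \<in> relboundaries p (disc k) (outer_disc k)"
    using excised_relcycle[OF disc_excision] by blast
  have \<Phi>w': "fchain_map p \<Phi> w' \<in> relcycles p (subtopology X (topspace X - A)) (collar - A)"
    using relcycles_fchain_map[OF w'(1)[simplified] continuous_map_interior interior_pair] .
  have b1: "fchain_map p \<Phi> (w - w') \<in> relboundaries p X collar"
    by (rule relboundaries_fchain_map[OF w'(2) cont]) (auto simp: collar_def)
  have b2: "fchain_map p \<Phi> w \<in> relboundaries p X collar"
    using relboundaries_mono[of _ p X UNIV A UNIV collar] b by (simp add: collar_def)
  have "fchain_map p \<Phi> w' = fchain_map p \<Phi> w - fchain_map p \<Phi> (w - w')"
    by (simp add: fchain_map_diff)
  then have "fchain_map p \<Phi> w' \<in> relboundaries p X collar"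
    using relboundaries_diff[OF b2 b1] by simp
  then have b3: "fchain_map p \<Phi> w' \<in> relboundaries p (subtopology X (topspace X - A)) (collar - A)"
    by (rule excised_relboundary[OF collar_excision \<Phi>w'])
  have \<psi>_pair: "\<psi> \<in> topspace (subtopology X (topspace X - A)) \<inter> (collar - A) \<rightarrow> outer_disc k"
  proof
    fix y assume "y \<in> topspace (subtopology X (topspace X - A)) \<inter> (collar - A)"
    then obtain x where x: "x \<in> outer_disc k" "y = \<Phi> x" "y \<notin> A" by (auto simp: collar_def)
    then have "x \<in> open_disc k" using sphere by (auto simp: outer_disc_def disc_set_Un)
    with x show "\<psi> y \<in> outer_disc k" by (simp add: \<psi>(2))
  qed
  have "fchain_map p \<psi> (fchain_map p \<Phi> w') \<in> relboundaries p (disc k) (outer_disc k)"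
    by (rule relboundaries_fchain_map[OF b3 _ \<psi>_pair]) (use \<psi>(1) in \<open>auto simp: continuous_map_in_subtopology\<close>)
  moreover have "fchain_map p \<psi> (fchain_map p \<Phi> w') = w'"
    unfolding fchain_map_compose[symmetric]
    by (rule fchain_map_ident[of _ _ "subtopology (disc k) (topspace (disc k) - disc_sphere k)"])
       (use w' \<psi>(2) in \<open>auto simp: relcycles_iff disc_set_Un\<close>)
  ultimately have w'b: "w' \<in> relboundaries p (disc k) (outer_disc k)" by simp
  have "w \<in> relboundaries p (disc k) (outer_disc k)"
    using relboundaries_add[OF w'(2) w'b] by simp
  then have 1: "fchain_map p ?e w \<in> relboundaries p (disc k) (disc_sphere k)"
    by (rule relboundaries_fchain_map[OF _ conte]) (auto intro: expand_outer_1)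
  have "fchain_map p ?e w - fchain_map p (\<lambda>x. expand k (0, x)) w \<in> relboundaries p (disc k) (disc_sphere k)"
    by (rule homotopic_relcycles_homologous[OF continuous_map_expand _ w]) (simp add: expand_sphere)
  moreover have "fchain_map p (\<lambda>x. expand k (0, x)) w = w"
    by (rule fchain_map_ident[of _ _ "disc k"]) (use w in \<open>auto simp: relcycles_iff expand_0\<close>)
  ultimately have 2: "fchain_map p ?e w - w \<in> relboundaries p (disc k) (disc_sphere k)" by simp
  have "w = fchain_map p ?e w - (fchain_map p ?e w - w)" by simp
  then show ?thesis using relboundaries_diff[OF 1 2] by simp
qed

end


section \<open>The homology of a disc relative to its sphere\<close>

lemma sqnorm_Suc: "sqnorm (Suc k) x = sqnorm k x + (x k)\<^sup>2"
  by (simp add: sqnorm_def)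

lemma sqnorm_upd [simp]: "sqnorm k (x(k := r)) = sqnorm k x"
  by (simp add: sqnorm_def)

definition lower_hemisphere :: "nat \<Rightarrow> (nat \<Rightarrow> real) set" where
  "lower_hemisphere k = {x \<in> disc_sphere (Suc k). x k \<le> 0}"

definition upper_chart :: "nat \<Rightarrow> (nat \<Rightarrow> real) \<Rightarrow> nat \<Rightarrow> real" where
  "upper_chart k x = x(k := sqrt (1 - sqnorm k x))"

abbreviation sphere_space :: "nat \<Rightarrow> (nat \<Rightarrow> real) topology" where
  "sphere_space k \<equiv> subtopology (disc (Suc k)) (disc_sphere (Suc k))"

lemma upper_chart_in_sphere: "x \<in> disc_set k \<Longrightarrow> upper_chart k x \<in> disc_sphere (Suc k)"
  by (auto simp: upper_chart_def disc_sphere_eq disc_set_def sqnorm_Suc)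

text \<open>The graph of \<open>sqrt (1 - sqnorm k x)\<close> over the disc is the upper hemisphere, so a sphere is
  its lower hemisphere with one cell attached. This gives an induction on dimension for the
  homology of discs.\<close>

lemma cell_attachment_hemisphere:
  "cell_attachment (sphere_space k) (lower_hemisphere k) k (upper_chart k)"
proof
  show "Hausdorff_space (sphere_space k)"
    by (intro Hausdorff_space_subtopology Hausdorff_space_disc)
  have "closed {x::nat \<Rightarrow> real. x k \<le> 0}"
    by (intro closed_Collect_le continuous_intros continuous_on_product_coordinates)
  then have "closedin (disc (Suc k)) (disc_set (Suc k) \<inter> {x. x k \<le> 0})"
    by (simp add: disc_top_of_set closedin_closed_Int)
  then have "closedin (disc (Suc k)) (disc_sphere (Suc k) \<inter> (disc_set (Suc k) \<inter> {x. x k \<le> 0}))"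
    by (rule closedin_Int[OF closedin_disc_sphere])
  moreover have "disc_sphere (Suc k) \<inter> (disc_set (Suc k) \<inter> {x. x k \<le> 0}) = lower_hemisphere k"
    by (auto simp: lower_hemisphere_def disc_sphere_eq)
  ultimately have "compactin (disc (Suc k)) (lower_hemisphere k)"
    using closedin_compact_space compact_space_disc by metis
  then show "compactin (sphere_space k) (lower_hemisphere k)"
    by (auto simp: compactin_subtopology lower_hemisphere_def)
  have "continuous_on (disc_set k) (\<lambda>x. upper_chart k x i)" for i
    by (cases "i = k") (auto simp: upper_chart_def intro!: continuous_intros continuous_on_product_then_coordinatewise[OF continuous_on_id])
  then have "continuous_on (disc_set k) (upper_chart k)"
    by (rule continuous_on_coordinatewise_then_product)
  moreover have "upper_chart k \<in> disc_set k \<rightarrow> disc_set (Suc k)"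
    using upper_chart_in_sphere by (auto simp: disc_sphere_eq)
  ultimately have "continuous_map (disc k) (disc (Suc k)) (upper_chart k)"
    by (auto simp: disc_top_of_set continuous_map_in_subtopology)
  then show "continuous_map (disc k) (sphere_space k) (upper_chart k)"
    using upper_chart_in_sphere by (auto simp: continuous_map_in_subtopology)
  show "upper_chart k ` disc_sphere k \<subseteq> lower_hemisphere k"
  proof
    fix y assume "y \<in> upper_chart k ` disc_sphere k"
    then obtain x where x: "x \<in> disc_sphere k" "y = upper_chart k x" by blast
    then have "y \<in> disc_sphere (Suc k)" using upper_chart_in_sphere by (simp add: disc_sphere_eq)
    moreover have "y k = 0" using x by (simp add: upper_chart_def disc_sphere_eq)
    ultimately show "y \<in> lower_hemisphere k" by (simp add: lower_hemisphere_def)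
  qed
  show "inj_on (upper_chart k) (open_disc k)"
  proof (rule inj_onI)
    fix x y assume xy: "x \<in> open_disc k" "y \<in> open_disc k" "upper_chart k x = upper_chart k y"
    show "x = y"
    proof
      fix i show "x i = y i"
      proof (cases "i = k")
        case True
        with xy show ?thesis by (simp add: open_disc_eq disc_set_def)
      next
        case False
        with fun_cong[OF xy(3), of i] show ?thesis by (simp add: upper_chart_def)
      qed
    qed
  qed
  show "upper_chart k ` open_disc k \<inter> lower_hemisphere k = {}"
    by (auto simp: upper_chart_def open_disc_eq lower_hemisphere_def)
  show "topspace (sphere_space k) = lower_hemisphere k \<union> upper_chart k ` open_disc k"
  proof
    show "lower_hemisphere k \<union> upper_chart k ` open_disc k \<subseteq> topspace (sphere_space k)"
      using upper_chart_in_sphere by (auto simp: lower_hemisphere_def disc_sphere_eq open_disc_eq)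
    show "topspace (sphere_space k) \<subseteq> lower_hemisphere k \<union> upper_chart k ` open_disc k"
    proof
      fix x assume "x \<in> topspace (sphere_space k)"
      then have x: "x \<in> disc_sphere (Suc k)" by auto
      show "x \<in> lower_hemisphere k \<union> upper_chart k ` open_disc k"
      proof (cases "x k \<le> 0")
        case True
        with x show ?thesis by (simp add: lower_hemisphere_def)
      next
        case False
        have n: "sqnorm k x + (x k)\<^sup>2 = 1" using x by (simp add: disc_sphere_eq sqnorm_Suc)
        have "0 < (x k)\<^sup>2" using False by simp
        then have "sqnorm k x < 1" using n by linarith
        then have "x(k := 0) \<in> open_disc k"
          using x by (auto simp: open_disc_eq disc_sphere_eq disc_set_def)
        moreover have "1 - sqnorm k x = (x k)\<^sup>2" using n by simp
        then have "upper_chart k (x(k := 0)) = x"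
          using False by (simp add: upper_chart_def)
        ultimately show ?thesis by (metis UnI2 imageI)
      qed
    qed
  qed
qed

text \<open>The disc can be pushed down vertically onto its lower hemisphere, with the hemisphere
  fixed, so the homology of this pair vanishes.\<close>

lemma relcycle_disc_lower_hemisphere:
  assumes z: "z \<in> relcycles p (disc (Suc k)) (lower_hemisphere k)"
  shows "z \<in> relboundaries p (disc (Suc k)) (lower_hemisphere k)"
proof -
  let ?D = "disc_set (Suc k)"
  define h where "h = (\<lambda>(t::real, x::nat \<Rightarrow> real). x(k := (1 - t) * x k - t * sqrt (1 - sqnorm k x)))"
  have abs_le: "\<bar>x k\<bar> \<le> sqrt (1 - sqnorm k x)" "sqnorm k x \<le> 1" if "x \<in> ?D" for x
  proof -
    have "sqnorm k x + (x k)\<^sup>2 \<le> 1" using that by (simp add: disc_set_def sqnorm_Suc)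
    moreover have "0 \<le> (x k)\<^sup>2" by simp
    ultimately show "\<bar>x k\<bar> \<le> sqrt (1 - sqnorm k x)" "sqnorm k x \<le> 1"
      by (intro real_le_rsqrt, simp, linarith)
  qed
  have in_D: "h (t, x) \<in> ?D" if t: "0 \<le> t" "t \<le> 1" and x: "x \<in> ?D" for t x
  proof -
    let ?r = "sqrt (1 - sqnorm k x)"
    have "\<bar>(1 - t) * x k - t * ?r\<bar> \<le> \<bar>(1 - t) * x k\<bar> + \<bar>t * ?r\<bar>" by (rule abs_triangle_ineq4)
    also have "\<dots> = (1 - t) * \<bar>x k\<bar> + t * ?r"
      using t abs_le[OF x] by (simp add: abs_mult)
    also have "\<dots> \<le> (1 - t) * ?r + t * ?r"
      using t abs_le[OF x] by (simp add: mult_left_mono)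
    also have "\<dots> = ?r" by (simp add: algebra_simps)
    finally have "((1 - t) * x k - t * ?r)\<^sup>2 \<le> ?r\<^sup>2"
      using power_mono[OF _ abs_ge_zero, of "(1 - t) * x k - t * ?r" ?r 2] by (simp only: power2_abs)
    then show ?thesis using x abs_le[OF x] by (auto simp: h_def disc_set_def sqnorm_Suc)
  qed
  have "continuous_on ({0..1} \<times> ?D) (\<lambda>z. h z i)" for i
    by (cases "i = k") (auto simp: h_def case_prod_beta intro!: continuous_intros
      continuous_on_product_then_coordinatewise[OF continuous_on_snd[OF continuous_on_id]])
  then have "continuous_on ({0..1} \<times> ?D) h"
    by (rule continuous_on_coordinatewise_then_product)
  then have conth: "continuous_map (prod_topology (top_of_set {0..1}) (disc (Suc k))) (disc (Suc k)) h"
    using in_D by (auto simp: disc_top_of_set prod_top_of_set continuous_map_in_subtopology)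
  have fix_L: "h (t, x) = x" if "x \<in> lower_hemisphere k" for t x
  proof -
    have "1 - sqnorm k x = (x k)\<^sup>2" using that by (simp add: lower_hemisphere_def disc_sphere_eq sqnorm_Suc)
    then have "sqrt (1 - sqnorm k x) = - x k" using that by (simp add: lower_hemisphere_def)
    then show ?thesis by (auto simp: h_def algebra_simps)
  qed
  have L1: "h (1, x) \<in> lower_hemisphere k" if "x \<in> ?D" for x
    using in_D[of 1 x] abs_le[OF that] that
    by (auto simp: h_def lower_hemisphere_def disc_sphere_eq sqnorm_Suc)
  have hom: "fchain_map p (\<lambda>x. h (1, x)) z - fchain_map p (\<lambda>x. h (0, x)) z \<in> relboundaries p (disc (Suc k)) (lower_hemisphere k)"
    by (rule homotopic_relcycles_homologous[OF conth _ z]) (simp add: fix_L)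
  have h0: "fchain_map p (\<lambda>x. h (0, x)) z = z"
    by (rule fchain_map_ident[of _ _ "disc (Suc k)"]) (use z in \<open>auto simp: relcycles_iff h_def\<close>)
  have h1: "fchain_map p (\<lambda>x. h (1, x)) z \<in> relboundaries p (disc (Suc k)) (lower_hemisphere k)"
  proof (rule chains_imp_relboundaries, rule fchain_map_chains)
    show "z \<in> chains p (disc (Suc k))" using z by (simp add: relcycles_iff)
    have "continuous_map (disc (Suc k)) (disc (Suc k)) (\<lambda>x. h (1, x))"
      using continuous_map_compose[OF _ conth, where X = "disc (Suc k)" and f = "\<lambda>y. (1, y)"]
      by (simp add: continuous_map_pairwise comp_def del: topspace_disc)
    then show "continuous_map (disc (Suc k)) (subtopology (disc (Suc k)) (lower_hemisphere k)) (\<lambda>x. h (1, x))"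
      using L1 by (auto simp: continuous_map_in_subtopology)
  qed
  show ?thesis
    using relboundaries_diff[OF h1 hom[unfolded h0]] by simp
qed

lemma chains_empty: "c \<in> chains p X \<Longrightarrow> topspace X = {} \<Longrightarrow> c = 0"
  using singular_simplex_empty[of X p]
  by (intro poly_mapping_eqI) (auto simp: chains_iff in_keys_iff)

lemma chains_singleton:
  assumes X: "topspace X = {a}" and c: "c \<in> chains p X"
  obtains r where "c = Poly_Mapping.single (restrict (\<lambda>x. a) (standard_simplex p)) r"
proof -
  have "Poly_Mapping.keys c \<subseteq> {restrict (\<lambda>x. a) (standard_simplex p)}"
    using c singular_simplex_singleton[OF X] by (auto simp: chains_iff)
  then have "c = Poly_Mapping.single (restrict (\<lambda>x. a) (standard_simplex p)) (Poly_Mapping.lookup c (restrict (\<lambda>x. a) (standard_simplex p)))"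
    by (auto intro!: poly_mapping_eqI simp: lookup_single when_def in_keys_iff)
  then show ?thesis using that by blast
qed

lemma fboundary_singleton:
  fixes r :: "'f::field"
  assumes X: "topspace X = {a}"
  shows "fboundary p (Poly_Mapping.single (restrict (\<lambda>x. a) (standard_simplex p)) r)
    = (if p = 0 \<or> odd p then 0 else Poly_Mapping.single (restrict (\<lambda>x. a) (standard_simplex (p - 1))) r)"
proof -
  let ?s = "\<lambda>p. restrict (\<lambda>x. a) (standard_simplex p) :: (nat \<Rightarrow> real) \<Rightarrow> 'a"
  have "singular_chain p X (frag_of (?s p))"
    by (simp add: singular_chain_of singular_simplex_singleton[OF X])
  from chain_boundary_of_singleton[OF X this]
  have "fboundary p (Poly_Mapping.single (?s p) (1::'f)) = (if p = 0 \<or> odd p then 0 else Poly_Mapping.single (?s (p - 1)) 1)"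
    by (simp add: fboundary_base_change base_change_single)
  moreover have "Poly_Mapping.single (?s p) r = scale_chain r (Poly_Mapping.single (?s p) 1)"
    by (simp add: scale_chain_single)
  then have "fboundary p (Poly_Mapping.single (?s p) r) = scale_chain r (fboundary p (Poly_Mapping.single (?s p) 1))"
    by (simp only: fboundary_scale)
  ultimately show ?thesis by (simp add: scale_chain_single)
qed

lemma singleton_homology:
  assumes X: "topspace X = {a}" and p: "0 < p" and c: "c \<in> relcycles p X {}"
  shows "c \<in> relboundaries p X {}"
proof -
  let ?s = "\<lambda>p. restrict (\<lambda>x. a) (standard_simplex p) :: (nat \<Rightarrow> real) \<Rightarrow> 'a"
  obtain r where r: "c = Poly_Mapping.single (?s p) r"
    using chains_singleton[OF X] c by (auto simp: relcycles_iff)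
  have "fboundary p c = 0"
    using c chains_empty[of "fboundary p c" "p - 1" "subtopology X {}"] by (simp add: relcycles_iff)
  show ?thesis
  proof (cases "odd p")
    case True
    then have "fboundary (Suc p) (Poly_Mapping.single (?s (Suc p)) r) = c"
      using fboundary_singleton[OF X, of "Suc p" r] by (simp add: r)
    moreover have "Poly_Mapping.single (?s (Suc p)) r \<in> chains (Suc p) X"
      by (simp add: chains_iff singular_simplex_singleton[OF X])
    ultimately show ?thesis using fboundary_imp_relboundaries by metis
  next
    case False
    then have "Poly_Mapping.single (?s (p - 1)) r = 0"
      using \<open>fboundary p c = 0\<close> p fboundary_singleton[OF X, of p r] by (simp add: r)
    then have "r = 0" by (metis lookup_single_eq lookup_zero)
    then show ?thesis using r by simp
  qed
qed

lemma singleton_homology_0: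
  assumes X: "topspace X = {a}" and c: "c \<in> relboundaries 0 X {}"
  shows "c = 0"
proof -
  obtain e b where e: "e \<in> chains 1 X" and b: "b \<in> chains 0 (subtopology X {})" and c': "c = fboundary 1 e + b"
    using c by (auto simp: relboundaries_iff)
  obtain r where "e = Poly_Mapping.single (restrict (\<lambda>x. a) (standard_simplex 1)) r"
    using chains_singleton[OF X e] .
  then have "fboundary 1 e = 0"
    using fboundary_singleton[OF X, of 1 r] by simp
  moreover have "b = 0" using b chains_empty by fastforce
  ultimately show ?thesis using c' by simp
qed

text \<open>In the exact sequence of the disc, its sphere and the lower hemisphere, the homology of
  the first relative to the third vanishes, so that the homology of the disc relative to the
  sphere is, one dimension lower, that of the sphere relative to the hemisphere; by attaching
  the upper hemisphere this is the homology of a disc of smaller dimension.\<close>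

theorem disc_homology_vanishes:
  assumes "p \<noteq> k" "z \<in> relcycles p (disc k) (disc_sphere k)"
  shows "z \<in> relboundaries p (disc k) (disc_sphere k)"
  using assms
proof (induction k arbitrary: p z)
  case 0
  have "disc_set 0 = {\<lambda>i. 0}" by (auto simp: disc_set_def sqnorm_def)
  moreover have "disc_sphere 0 = {}" by (auto simp: disc_sphere_eq sqnorm_def)
  ultimately show ?case
    using 0 singleton_homology[of "disc 0" "\<lambda>i. 0" p z] by simp
next
  case (Suc k)
  interpret cell_attachment "sphere_space k" "lower_hemisphere k" k "upper_chart k"
    by (rule cell_attachment_hemisphere)
  let ?D = "disc (Suc k)" and ?S = "disc_sphere (Suc k)" and ?L = "lower_hemisphere k"
  have LS: "?L \<subseteq> ?S" by (auto simp: lower_hemisphere_def)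
  have zD: "z \<in> chains p ?D" and zS: "fboundary p z \<in> chains (p - 1) (sphere_space k)"
    using Suc.prems(2) by (auto simp: relcycles_iff)
  \<comment> \<open>It suffices to change \<open>z\<close> by a chain of the sphere into a cycle relative to the lower
    hemisphere.\<close>
  obtain e where e: "e \<in> chains p (sphere_space k)" "z - e \<in> relcycles p ?D ?L"
  proof (cases p)
    case 0
    have "z - 0 \<in> relcycles p ?D ?L" using zD 0 by (simp add: relcycles_iff)
    then show ?thesis using that[of 0] by simp
  next
    case (Suc q)
    then have "q \<noteq> k" using Suc.prems by simp
    have bz: "fboundary p z \<in> relcycles q (sphere_space k) ?L"
      using zS fboundary_fboundary[OF zD] Suc by (simp add: relcycles_iff)
    obtain w where w: "w \<in> relcycles q (disc k) (disc_sphere k)"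
      "fboundary p z - fchain_map q (upper_chart k) w \<in> relboundaries q (sphere_space k) ?L"
      using relcycle_from_disc[OF bz] by blast
    have "w \<in> relboundaries q (disc k) (disc_sphere k)"
      by (rule Suc.IH[OF \<open>q \<noteq> k\<close> w(1)])
    then have "fchain_map q (upper_chart k) w \<in> relboundaries q (sphere_space k) ?L"
      by (rule relboundaries_fchain_map[OF _ cont]) (use sphere in auto)
    then have "fboundary p z \<in> relboundaries q (sphere_space k) ?L"
      using relboundaries_add[OF w(2)] by fastforce
    then obtain e a where ea: "e \<in> chains (Suc q) (sphere_space k)" "a \<in> chains q (subtopology (sphere_space k) ?L)"
      "fboundary p z = fboundary (Suc q) e + a" unfolding relboundaries_iff by blast
    have "a \<in> chains q (subtopology ?D ?L)"
      using ea(2) LS by (simp add: subtopology_subtopology Int_absorb1)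
    then have "z - e \<in> relcycles p ?D ?L"
      using ea zD chains_subtopology[OF ea(1)] Suc by (simp add: relcycles_iff chains_diff fboundary_diff)
    then show ?thesis using that[of e] ea(1) Suc by simp
  qed
  have "z - e \<in> relboundaries p ?D ?L"
    by (rule relcycle_disc_lower_hemisphere[OF e(2)])
  then have "z - e \<in> relboundaries p ?D ?S"
    using relboundaries_mono[of "z - e" p ?D UNIV ?L UNIV ?S] LS by simp
  from relboundaries_add[OF this chains_imp_relboundaries[OF e(1)]] show ?case by simp
qed

text \<open>The same exact sequence read backwards: the image of a nontrivial class under the chart of
  the upper hemisphere bounds in the disc relative to the lower hemisphere, and the chain whose
  boundary it is represents a nontrivial class one dimension higher. This makes the given
  generators of the discs nonzero, so that the homology is exactly one-dimensional.\<close>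

theorem disc_homology_nontrivial:
  "\<exists>z::(nat \<Rightarrow> real, 'f::field) fchain. z \<in> relcycles k (disc k) (disc_sphere k) \<and> z \<notin> relboundaries k (disc k) (disc_sphere k)"
proof (induction k)
  case 0
  let ?s = "restrict (\<lambda>x i. 0) (standard_simplex 0) :: (nat \<Rightarrow> real) \<Rightarrow> nat \<Rightarrow> real"
  let ?z = "Poly_Mapping.single ?s 1 :: (nat \<Rightarrow> real, 'f) fchain"
  have t: "topspace (disc 0) = {\<lambda>i. 0}" by (auto simp: disc_set_def sqnorm_def)
  have s: "disc_sphere 0 = {}" by (auto simp: disc_sphere_eq sqnorm_def)
  have "?z \<in> relcycles 0 (disc 0) {}"
    using singular_simplex_singleton[OF t, of 0] by (simp add: relcycles_iff chains_iff del: topspace_disc)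
  moreover have "?z \<noteq> 0" by (metis lookup_single_eq lookup_zero zero_neq_one)
  ultimately show ?case unfolding s using singleton_homology_0[OF t] by metis
next
  case (Suc k)
  interpret cell_attachment "sphere_space k" "lower_hemisphere k" k "upper_chart k"
    by (rule cell_attachment_hemisphere)
  let ?D = "disc (Suc k)" and ?S = "disc_sphere (Suc k)" and ?L = "lower_hemisphere k"
  have LS: "?L \<subseteq> ?S" by (auto simp: lower_hemisphere_def)
  obtain z :: "(nat \<Rightarrow> real, 'f) fchain" where z: "z \<in> relcycles k (disc k) (disc_sphere k)" "z \<notin> relboundaries k (disc k) (disc_sphere k)"
    using Suc by blast
  define w where "w = fchain_map k (upper_chart k) z"
  have w: "w \<in> relcycles k (sphere_space k) ?L"
    unfolding w_def by (rule relcycles_fchain_map[OF z(1) cont]) (use sphere in auto)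
  have wn: "w \<notin> relboundaries k (sphere_space k) ?L"
    using relboundary_from_disc[OF z(1)] z(2) by (auto simp: w_def)
  have wS: "w \<in> chains k (sphere_space k)" using w by (simp add: relcycles_iff)
  have "w \<in> relcycles k ?D ?L"
    using relcycles_mono[of w k ?D ?S ?L UNIV ?L] w by simp
  then have "w \<in> relboundaries k ?D ?L" by (rule relcycle_disc_lower_hemisphere)
  then obtain u b where ub: "u \<in> chains (Suc k) ?D" "b \<in> chains k (subtopology ?D ?L)" "w = fboundary (Suc k) u + b"
    unfolding relboundaries_iff by blast
  have b': "b \<in> chains k (subtopology (sphere_space k) ?L)"
    using ub(2) LS by (simp add: subtopology_subtopology Int_absorb1)
  have "fboundary (Suc k) u = w - b" using ub(3) by simp
  then have "u \<in> relcycles (Suc k) ?D ?S"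
    using ub(1) wS chains_mono[OF ub(2) LS] by (simp add: relcycles_iff chains_diff)
  moreover have "u \<notin> relboundaries (Suc k) ?D ?S"
  proof
    assume "u \<in> relboundaries (Suc k) ?D ?S"
    then obtain e a where ea: "e \<in> chains (Suc (Suc k)) ?D" "a \<in> chains (Suc k) (sphere_space k)"
      "u = fboundary (Suc (Suc k)) e + a" unfolding relboundaries_iff by blast
    have "fboundary (Suc k) u = fboundary (Suc k) a"
      using fboundary_fboundary[OF ea(1)] ea(3) by (simp add: fboundary_add)
    then have "w = fboundary (Suc k) a + b" using ub(3) by simp
    then have "w \<in> relboundaries k (sphere_space k) ?L"
      unfolding relboundaries_iff using ea(2) b' by blast
    with wn show False by contradiction
  qed
  ultimately show ?case by blast
qed

section \<open>Subcomplexes of a CW-complex\<close>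

locale cw_complex =
  fixes K :: "'a cw_data" and \<iota> :: "nat \<Rightarrow> (nat \<Rightarrow> real, 'f::field) fchain"
  assumes cw: "filtered_cw_complex K" and generators: "disc_generators \<iota>"
begin

abbreviation "n \<equiv> last_cell K"
abbreviation "d \<equiv> cell_dim K"
abbreviation "e \<equiv> cell_chain K \<iota>"

definition cells :: "nat set \<Rightarrow> 'a set" where "cells L = (\<Union>j\<in>L. cell K j)"

abbreviation Y :: "nat set \<Rightarrow> 'a topology" where "Y L \<equiv> subtopology (cw_space K) (cells L)"

text \<open>A condition on the indices alone that makes the union of a set of cells a closed
  subcomplex: the boundary of a cell only meets earlier cells of smaller dimension. Both the
  stages of the filtration and the skeleta are of this form, and so is the set of cells on which
  the boundary of a given cell may lie.\<close>

definition lower :: "nat set \<Rightarrow> bool" where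
  "lower L \<longleftrightarrow> L \<subseteq> {..n} \<and> (\<forall>i\<in>L. \<forall>i'<i. d i' < d i \<longrightarrow> i' \<in> L)"

lemma lowerD: "lower L \<Longrightarrow> i \<in> L \<Longrightarrow> i' < i \<Longrightarrow> d i' < d i \<Longrightarrow> i' \<in> L"
  and lower_le: "lower L \<Longrightarrow> i \<in> L \<Longrightarrow> i \<le> n"
  and lower_finite: "lower L \<Longrightarrow> finite L"
  using finite_subset by (auto simp: lower_def)

lemma lower_empty [simp]: "lower {}"
  by (simp add: lower_def)

lemma cells_mono: "A \<subseteq> L \<Longrightarrow> cells A \<subseteq> cells L"
  by (auto simp: cells_def)

lemma cells_empty [simp]: "cells {} = {}"
  by (simp add: cells_def)

lemma continuous_char: "j \<le> n \<Longrightarrow> continuous_map (disc (d j)) (cw_space K) (char_map K j)"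
  and homeo_char: "j \<le> n \<Longrightarrow> homeomorphic_map (subtopology (disc (d j)) (open_disc (d j))) (subtopology (cw_space K) (cell K j)) (char_map K j)"
  and sphere_char: "j \<le> n \<Longrightarrow> char_map K j ` disc_sphere (d j) \<subseteq> cells {i. i < j \<and> d i < d j}"
  and Hausdorff_K: "Hausdorff_space (cw_space K)"
  and topspace_K: "topspace (cw_space K) = cells {..n}"
  and disjoint_cells: "disjoint_family_on (cell K) {..n}"
  using cw by (auto simp: filtered_cw_complex_def cells_def)

lemma closed_cell_subset:
  assumes "lower L" "j \<in> L" shows "char_map K j ` disc_set (d j) \<subseteq> cells L"
proof -
  have "cells {i. i < j \<and> d i < d j} \<subseteq> cells L"
    using lowerD[OF assms] by (intro cells_mono) auto
  moreover have "char_map K j ` open_disc (d j) \<subseteq> cells L"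
    using assms(2) by (auto simp: cells_def cell_def)
  ultimately show ?thesis
    using sphere_char[OF lower_le[OF assms]] by (auto simp: disc_set_Un)
qed

lemma compactin_cells:
  assumes L: "lower L" shows "compactin (cw_space K) (cells L)"
proof -
  have "cells L = (\<Union>j\<in>L. char_map K j ` disc_set (d j))"
  proof
    show "cells L \<subseteq> (\<Union>j\<in>L. char_map K j ` disc_set (d j))"
      by (auto simp: cells_def cell_def disc_set_Un)
    show "(\<Union>j\<in>L. char_map K j ` disc_set (d j)) \<subseteq> cells L"
      using closed_cell_subset[OF L] by blast
  qed
  moreover have "compactin (cw_space K) (char_map K j ` disc_set (d j))" if "j \<in> L" for j
    using image_compactin[OF _ continuous_char[OF lower_le[OF L that]], of "disc_set (d j)"] compact_space_disc[of "d j"]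
    by (simp add: compact_space_def)
  ultimately show ?thesis
    using compactin_Union[of "(\<lambda>j. char_map K j ` disc_set (d j)) ` L" "cw_space K"] lower_finite[OF L] by auto
qed

lemma cells_subset_topspace: "lower L \<Longrightarrow> cells L \<subseteq> topspace (cw_space K)"
  using compactin_cells compactin_subset_topspace by blast

lemma subtopology_Y [simp]: "A \<subseteq> L \<Longrightarrow> subtopology (Y L) (cells A) = Y A"
  using cells_mono by (simp add: subtopology_subtopology Int_absorb1)

lemma Y_top: "Y {..n} = cw_space K"
  by (metis topspace_K subtopology_topspace)

lemma cell_attachment_top_cell:
  assumes L: "lower L" and L': "lower (L - {b})" and b: "b \<in> L"
  shows "cell_attachment (Y L) (cells (L - {b})) (d b) (char_map K b)"
proof
  have bn: "b \<le> n" using lower_le[OF L b] .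
  show "Hausdorff_space (Y L)" by (rule Hausdorff_space_subtopology[OF Hausdorff_K])
  show "compactin (Y L) (cells (L - {b}))"
    using compactin_cells[OF L'] cells_mono[of "L - {b}" L] by (auto simp: compactin_subtopology)
  show "continuous_map (disc (d b)) (Y L) (char_map K b)"
    using continuous_char[OF bn] closed_cell_subset[OF L b] by (auto simp: continuous_map_in_subtopology)
  have "cells {i. i < b \<and> d i < d b} \<subseteq> cells (L - {b})"
    using lowerD[OF L b] by (intro cells_mono) auto
  then show "char_map K b ` disc_sphere (d b) \<subseteq> cells (L - {b})"
    using sphere_char[OF bn] by blast
  have "topspace (subtopology (disc (d b)) (open_disc (d b))) = open_disc (d b)"
    by (auto simp: disc_set_Un)
  then show "inj_on (char_map K b) (open_disc (d b))"
    using homeomorphic_imp_injective_map[OF homeo_char[OF bn]] by simp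
  show "char_map K b ` open_disc (d b) \<inter> cells (L - {b}) = {}"
    using disjoint_cells L bn unfolding disjoint_family_on_def lower_def cells_def cell_def[symmetric] by blast
  have "topspace (Y L) = cells L"
    using cells_subset_topspace[OF L] by auto
  then show "topspace (Y L) = cells (L - {b}) \<union> char_map K b ` open_disc (d b)"
    using b by (auto simp: cells_def cell_def)
qed

lemma relcycles_disc_generator: "\<iota> k \<in> relcycles k (disc k) (disc_sphere k)"
  and disc_generator: "z \<in> relcycles k (disc k) (disc_sphere k) \<Longrightarrow>
     \<exists>a. z - scale_chain a (\<iota> k) \<in> relboundaries k (disc k) (disc_sphere k)"
  using generators by (auto simp: disc_generators_def)

lemma disc_generator_nontrivial: "\<iota> k \<notin> relboundaries k (disc k) (disc_sphere k)"
proof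
  assume i: "\<iota> k \<in> relboundaries k (disc k) (disc_sphere k)"
  obtain z :: "(nat \<Rightarrow> real, 'f) fchain" where z: "z \<in> relcycles k (disc k) (disc_sphere k)" "z \<notin> relboundaries k (disc k) (disc_sphere k)"
    using disc_homology_nontrivial by blast
  obtain a where "z - scale_chain a (\<iota> k) \<in> relboundaries k (disc k) (disc_sphere k)"
    using disc_generator[OF z(1)] by blast
  from relboundaries_add[OF this relboundaries_scale[OF i, of a]] z(2) show False by simp
qed

lemma cell_chain_chains:
  assumes "lower L" "j \<in> L" shows "e j \<in> chains (d j) (Y L)"
  unfolding cell_chain_def
proof (rule fchain_map_chains)
  show "\<iota> (d j) \<in> chains (d j) (disc (d j))"
    using relcycles_disc_generator by (simp add: relcycles_iff)
  show "continuous_map (disc (d j)) (Y L) (char_map K j)"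
    using continuous_char[OF lower_le[OF assms]] closed_cell_subset[OF assms] by (auto simp: continuous_map_in_subtopology)
qed

lemma fboundary_cell_chain:
  assumes "j \<le> n" shows "fboundary (d j) (e j) \<in> chains (d j - 1) (Y {i. i < j \<and> d i < d j})"
proof -
  have "e j \<in> relcycles (d j) (cw_space K) (cells {i. i < j \<and> d i < d j})"
    unfolding cell_chain_def
    by (rule relcycles_fchain_map[OF relcycles_disc_generator continuous_char[OF assms]])
       (use sphere_char[OF assms] in auto)
  then show ?thesis by (simp add: relcycles_iff)
qed

section \<open>The homology of a one-cell extension\<close>

lemma one_cell_vanishing:
  assumes L: "lower L" "lower (L - {b})" "b \<in> L" and z: "z \<in> relcycles p (Y L) (cells (L - {b}))" and p: "p \<noteq> d b"
  shows "z \<in> relboundaries p (Y L) (cells (L - {b}))"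
proof -
  interpret cell_attachment "Y L" "cells (L - {b})" "d b" "char_map K b"
    by (rule cell_attachment_top_cell[OF L])
  obtain w where w: "w \<in> relcycles p (disc (d b)) (disc_sphere (d b))"
    "z - fchain_map p (char_map K b) w \<in> relboundaries p (Y L) (cells (L - {b}))"
    using relcycle_from_disc[OF z] by blast
  have "fchain_map p (char_map K b) w \<in> relboundaries p (Y L) (cells (L - {b}))"
    by (rule relboundaries_fchain_map[OF disc_homology_vanishes[OF p w(1)] cont]) (use sphere in auto)
  from relboundaries_add[OF w(2) this] show ?thesis by simp
qed

lemma one_cell_generator:
  assumes L: "lower L" "lower (L - {b})" "b \<in> L" and z: "z \<in> relcycles (d b) (Y L) (cells (L - {b}))"
  shows "\<exists>a. z - scale_chain a (e b) \<in> relboundaries (d b) (Y L) (cells (L - {b}))"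
proof -
  interpret cell_attachment "Y L" "cells (L - {b})" "d b" "char_map K b"
    by (rule cell_attachment_top_cell[OF L])
  obtain w where w: "w \<in> relcycles (d b) (disc (d b)) (disc_sphere (d b))"
    "z - fchain_map (d b) (char_map K b) w \<in> relboundaries (d b) (Y L) (cells (L - {b}))"
    using relcycle_from_disc[OF z] by blast
  obtain a where a: "w - scale_chain a (\<iota> (d b)) \<in> relboundaries (d b) (disc (d b)) (disc_sphere (d b))"
    using disc_generator[OF w(1)] by blast
  have "fchain_map (d b) (char_map K b) (w - scale_chain a (\<iota> (d b))) \<in> relboundaries (d b) (Y L) (cells (L - {b}))"
    by (rule relboundaries_fchain_map[OF a cont]) (use sphere in auto)
  from relboundaries_add[OF w(2) this] show ?thesis
    by (auto simp: cell_chain_def fchain_map_diff fchain_map_scale)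
qed

lemma one_cell_nontrivial:
  assumes L: "lower L" "lower (L - {b})" "b \<in> L"
  shows "e b \<notin> relboundaries (d b) (Y L) (cells (L - {b}))"
proof -
  interpret cell_attachment "Y L" "cells (L - {b})" "d b" "char_map K b"
    by (rule cell_attachment_top_cell[OF L])
  show ?thesis
    using relboundary_from_disc[OF relcycles_disc_generator] disc_generator_nontrivial by (auto simp: cell_chain_def)
qed

section \<open>The chain map from cellular to singular chains\<close>

abbreviation coeff :: "nat \<Rightarrow> nat \<Rightarrow> 'f" where "coeff \<equiv> cellular_coeff K \<iota>"

definition bd :: "(nat \<Rightarrow> 'f) \<Rightarrow> nat \<Rightarrow> 'f" where
  "bd c i = (\<Sum>j\<le>n. coeff i j * c j)"

definition comb :: "(nat \<Rightarrow> ('a, 'f) fchain) \<Rightarrow> (nat \<Rightarrow> 'f) \<Rightarrow> ('a, 'f) fchain" where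
  "comb s c = (\<Sum>j\<le>n. scale_chain (c j) (s j))"

definition supported :: "nat set \<Rightarrow> (nat \<Rightarrow> 'f) \<Rightarrow> bool" where
  "supported J c \<longleftrightarrow> (\<forall>j. c j \<noteq> 0 \<longrightarrow> j \<in> J)"

text \<open>The chain \<open>s j\<close> represents the cell \<open>j\<close> as well as \<open>e j\<close> does, because it is changed only
  inside the boundary of the cell, and its boundary formula is an equality of chains. The last
  condition makes the boundary formula refer only to chains of earlier cells, so that the chains
  can be built one after another.\<close>

definition adapted :: "(nat \<Rightarrow> ('a, 'f) fchain) \<Rightarrow> nat \<Rightarrow> bool" where
  "adapted s j \<longleftrightarrow> s j - e j \<in> chains (d j) (Y {i. i < j \<and> d i < d j})
     \<and> fboundary (d j) (s j) = comb s (\<lambda>i. coeff i j)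
     \<and> (\<forall>i. coeff i j \<noteq> 0 \<longrightarrow> i < j \<and> Suc (d i) = d j)"

lemma comb_add: "comb s (\<lambda>i. c i + c' i) = comb s c + comb s c'"
  and comb_diff: "comb s (\<lambda>i. c i - c' i) = comb s c - comb s c'"
  and comb_scale: "comb s (\<lambda>i. r * c i) = scale_chain r (comb s c)"
  by (simp_all add: comb_def fch.scale_left_distrib fch.scale_left_diff_distrib sum.distrib sum_subtractf fch.scale_sum_right)

lemma comb_zero [simp]: "comb s (\<lambda>i. 0) = 0"
  by (simp add: comb_def)

lemma bd_add: "bd (\<lambda>i. c i + c' i) i = bd c i + bd c' i"
  and bd_diff: "bd (\<lambda>i. c i - c' i) i = bd c i - bd c' i"
  by (simp_all add: bd_def algebra_simps sum.distrib sum_subtractf)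

lemma bd_scale: "bd (\<lambda>i. r * c i) i = r * bd c i"
  by (simp add: bd_def sum_distrib_left algebra_simps)

lemma bd_zero [simp]: "bd (\<lambda>i. 0) i = 0"
  by (simp add: bd_def)

definition unit :: "nat \<Rightarrow> nat \<Rightarrow> 'f" where "unit b = (\<lambda>i. if i = b then 1 else 0)"

lemma bd_unit: "b \<le> n \<Longrightarrow> bd (unit b) i = coeff i b"
  by (simp add: bd_def unit_def if_distrib cong: if_cong)

lemma comb_unit: "b \<le> n \<Longrightarrow> comb s (unit b) = s b"
proof -
  assume b: "b \<le> n"
  have "comb s (unit b) = (\<Sum>j\<le>n. if j = b then s b else 0)"
    unfolding comb_def by (rule sum.cong) (auto simp: unit_def)
  then show ?thesis using b by simp
qed

definition cut :: "nat set \<Rightarrow> (nat \<Rightarrow> 'f) \<Rightarrow> nat \<Rightarrow> 'f" where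
  "cut J c = (\<lambda>i. if i \<in> J then c i else 0)"

lemma supported_add: "supported J c \<Longrightarrow> supported J c' \<Longrightarrow> supported J (\<lambda>i. c i + c' i)"
  unfolding supported_def by (metis add_0)

lemma supported_diff: "supported J c \<Longrightarrow> supported J c' \<Longrightarrow> supported J (\<lambda>i. c i - c' i)"
  unfolding supported_def by (metis diff_self)

lemma supported_cut [simp]: "supported J (cut J c)"
  by (simp add: supported_def cut_def)

lemma adapted_chains:
  assumes "lower L" "j \<in> L" "adapted s j" shows "s j \<in> chains (d j) (Y L)"
proof -
  have "s j - e j \<in> chains (d j) (Y L)"
    using assms lowerD[OF assms(1,2)] cells_mono[of "{i. i < j \<and> d i < d j}" L]
    by (auto simp: adapted_def intro: chains_mono)
  from chains_add[OF this cell_chain_chains[OF assms(1,2)]] show ?thesis by simp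
qed

lemma adapted_coeff: "adapted s j \<Longrightarrow> coeff i j \<noteq> 0 \<Longrightarrow> i < j \<and> Suc (d i) = d j"
  by (simp add: adapted_def)

lemma comb_chains:
  assumes "lower L" "supported (L \<inter> {j. d j = p}) c" "\<And>j. j \<in> L \<Longrightarrow> adapted s j"
  shows "comb s c \<in> chains p (Y L)"
  unfolding comb_def
proof (rule chains_sum)
  fix j
  show "scale_chain (c j) (s j) \<in> chains p (Y L)"
  proof (cases "c j = 0")
    case False
    then have "j \<in> L" "d j = p" using assms(2) by (auto simp: supported_def)
    then show ?thesis using adapted_chains[OF assms(1) _ assms(3), of j] by (auto intro: chains_scale)
  qed simp
qed

lemma fboundary_comb:
  assumes "supported (L \<inter> {j. d j = p}) c" "\<And>j. j \<in> L \<Longrightarrow> adapted s j"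
  shows "fboundary p (comb s c) = comb s (bd c)"
proof -
  have "fboundary p (comb s c) = (\<Sum>j\<le>n. scale_chain (c j) (comb s (\<lambda>i. coeff i j)))"
    unfolding comb_def[of s c] fboundary_sum
  proof (rule sum.cong[OF refl])
    fix j
    show "fboundary p (scale_chain (c j) (s j)) = scale_chain (c j) (comb s (\<lambda>i. coeff i j))"
    proof (cases "c j = 0")
      case False
      then have "j \<in> L" "d j = p" using assms(1) by (auto simp: supported_def)
      then show ?thesis using assms(2)[of j] by (simp add: fboundary_scale adapted_def)
    qed simp
  qed
  also have "\<dots> = (\<Sum>j\<le>n. \<Sum>i\<le>n. scale_chain (coeff i j * c j) (s i))"
    by (simp add: comb_def fch.scale_sum_right mult.commute)
  also have "\<dots> = (\<Sum>i\<le>n. \<Sum>j\<le>n. scale_chain (coeff i j * c j) (s i))"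
    by (rule sum.swap)
  also have "\<dots> = comb s (bd c)"
    by (simp add: comb_def bd_def fch.scale_sum_left)
  finally show ?thesis .
qed

lemma supported_bd:
  assumes "lower L" "supported (L \<inter> {j. d j = p}) c" "\<And>j. j \<in> L \<Longrightarrow> adapted s j"
  shows "supported (L \<inter> {j. Suc (d j) = p}) (bd c)"
  unfolding supported_def
proof (intro allI impI)
  fix i assume "bd c i \<noteq> 0"
  then obtain j where "coeff i j * c j \<noteq> 0" unfolding bd_def by (meson sum.neutral)
  then have "coeff i j \<noteq> 0" "j \<in> L" "d j = p" using assms(2) by (auto simp: supported_def)
  then show "i \<in> L \<inter> {j. Suc (d j) = p}"
    using adapted_coeff[OF assms(3)] lowerD[OF assms(1), of j i] by force
qed

lemma adapted_nontrivial:
  assumes L: "lower L" "lower (L - {b})" "b \<in> L" and s: "adapted s b"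
    and c: "scale_chain c (s b) \<in> relboundaries (d b) (Y L) (cells (L - {b}))"
  shows "c = 0"
proof (rule ccontr)
  assume "c \<noteq> 0"
  then have "s b = scale_chain (inverse c) (scale_chain c (s b))" by simp
  then have sb: "s b \<in> relboundaries (d b) (Y L) (cells (L - {b}))"
    using relboundaries_scale[OF c] by metis
  have "s b - e b \<in> chains (d b) (Y (L - {b}))"
    using s lowerD[OF L(1,3)] cells_mono[of "{i. i < b \<and> d i < d b}" "L - {b}"]
    by (auto simp: adapted_def intro: chains_mono)
  then have "s b - e b \<in> relboundaries (d b) (Y L) (cells (L - {b}))"
    by (intro chains_imp_relboundaries) simp
  from relboundaries_diff[OF sb this] one_cell_nontrivial[OF L] show False by simp
qed

lemma adapted_generator:
  assumes L: "lower L" "lower (L - {b})" "b \<in> L" and s: "adapted s b"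
    and z: "z \<in> relcycles p (Y L) (cells (L - {b}))"
  obtains a u x where "a \<noteq> 0 \<Longrightarrow> p = d b" "u \<in> chains (Suc p) (Y L)" "x \<in> chains p (Y (L - {b}))"
    "z = scale_chain a (s b) + fboundary (Suc p) u + x"
proof -
  have "\<exists>a. (a \<noteq> 0 \<longrightarrow> p = d b) \<and> z - scale_chain a (s b) \<in> relboundaries p (Y L) (cells (L - {b}))"
  proof (cases "p = d b")
    case True
    obtain a where a: "z - scale_chain a (e b) \<in> relboundaries p (Y L) (cells (L - {b}))"
      using one_cell_generator[OF L] z True by blast
    have "s b - e b \<in> chains p (Y (L - {b}))"
      using s lowerD[OF L(1,3)] cells_mono[of "{i. i < b \<and> d i < d b}" "L - {b}"] True
      by (auto simp: adapted_def intro: chains_mono)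
    then have "s b - e b \<in> relboundaries p (Y L) (cells (L - {b}))"
      by (intro chains_imp_relboundaries) simp
    from relboundaries_diff[OF a relboundaries_scale[OF this, of a]]
    have "z - scale_chain a (s b) \<in> relboundaries p (Y L) (cells (L - {b}))"
      by (simp add: fch.scale_right_diff_distrib)
    with True show ?thesis by blast
  next
    case False
    then show ?thesis using one_cell_vanishing[OF L z] by (intro exI[of _ 0]) simp
  qed
  then obtain a where a: "a \<noteq> 0 \<longrightarrow> p = d b" "z - scale_chain a (s b) \<in> relboundaries p (Y L) (cells (L - {b}))"
    by blast
  then obtain u x where "u \<in> chains (Suc p) (Y L)" "x \<in> chains p (Y (L - {b}))"
    "z - scale_chain a (s b) = fboundary (Suc p) u + x"
    unfolding relboundaries_iff by auto
  then show ?thesis using that[of a u x] a(1) by (simp add: algebra_simps)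
qed

text \<open>A later cell is never part of the boundary of an earlier one, so the last cell of \<open>L - A\<close>
  can be removed from \<open>L\<close> unless it is needed by a cell of \<open>A\<close>; this would put it into \<open>A\<close>.\<close>

lemma lower_remove_max:
  assumes "lower L" "lower A" "A \<subseteq> L" "b \<in> L - A" "\<And>i. i \<in> L - A \<Longrightarrow> i \<le> b"
  shows "lower (L - {b})"
  unfolding lower_def
proof (intro conjI ballI allI impI)
  show "L - {b} \<subseteq> {..n}" using assms(1) by (auto simp: lower_def)
  fix i i' assume i: "i \<in> L - {b}" "i' < i" "d i' < d i"
  then have "i' \<in> L" using lowerD[OF assms(1)] by blast
  moreover have "i' \<noteq> b"
  proof
    assume "i' = b"
    then have "i \<in> A" using i assms(5)[of i] by force
    then show False using lowerD[OF assms(2) _ i(2,3)] \<open>i' = b\<close> assms(4) by blast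
  qed
  ultimately show "i' \<in> L - {b}" by blast
qed

text \<open>Relative to the subcomplex of everything that precedes it, the last cell with nonzero
  coefficient would have a multiple of \<open>s b\<close> that bounds, but \<open>s b\<close> is a nontrivial class
  there.\<close>

lemma adapted_independent:
  assumes L: "lower L" and A: "lower A" "A \<subseteq> L" and s: "\<And>j. j \<in> L \<Longrightarrow> adapted s j"
    and c: "supported ((L - A) \<inter> {j. d j = p}) c" and comb: "comb s c \<in> chains p (Y A)"
  shows "c i = 0"
proof (rule ccontr)
  assume "c i \<noteq> 0"
  let ?T = "{j. c j \<noteq> 0}"
  have T: "?T \<subseteq> (L - A) \<inter> {j. d j = p}" using c by (auto simp: supported_def)
  then have fin: "finite ?T" using lower_finite[OF L] by (meson finite_Diff finite_Int finite_subset)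
  define b where "b = Max ?T"
  have b: "b \<in> ?T" unfolding b_def using fin \<open>c i \<noteq> 0\<close> by (intro Max_in) auto
  have le: "j \<le> b" if "c j \<noteq> 0" for j unfolding b_def using fin that by (intro Max_ge) auto
  have bL: "b \<in> L" "b \<notin> A" "d b = p" using T b by auto
  \<comment> \<open>Cells of \<open>L - A\<close> beyond \<open>b\<close> are discarded, since \<open>b\<close> could lie in the boundary of one of
    them and then \<open>L - {b}\<close> would not be a subcomplex.\<close>
  let ?M = "A \<union> {j \<in> L. j \<le> b}"
  have M: "lower ?M"
    using A(1) L unfolding lower_def by (auto simp: subset_iff)
  have M': "lower (?M - {b})"
    by (rule lower_remove_max[OF M A(1)]) (use bL in auto)
  have bn: "b \<le> n" using lower_le[OF L bL(1)] .
  define c' where "c' = (\<lambda>j. c j - c b * unit b j)"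
  have c': "supported ((?M - {b}) \<inter> {j. d j = p}) c'"
    using T le by (auto simp: supported_def c'_def unit_def split: if_splits)
  have MsubL: "?M \<subseteq> L" using A(2) by auto
  have "comb s c' \<in> chains p (Y (?M - {b}))"
    by (rule comb_chains[OF M' c']) (use s MsubL in blast)
  moreover have "comb s c \<in> chains p (Y (?M - {b}))"
    using comb cells_mono[of A "?M - {b}"] bL(2) by (auto intro: chains_mono)
  ultimately have "comb s c - comb s c' \<in> chains p (Y (?M - {b}))"
    by (intro chains_diff)
  moreover have "comb s c - comb s c' = scale_chain (c b) (s b)"
    unfolding c'_def comb_diff comb_scale comb_unit[OF bn] by simp
  ultimately have "scale_chain (c b) (s b) \<in> relboundaries (d b) (Y ?M) (cells (?M - {b}))"
    using bL(3) by (intro chains_imp_relboundaries) simp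
  then have "c b = 0"
    using adapted_nontrivial[OF M M' _ s[OF bL(1)], of "c b"] bL by blast
  with b show False by simp
qed

text \<open>The square of the singular boundary vanishes, and the singular chains \<open>s j\<close> are linearly
  independent.\<close>

lemma bd_bd:
  assumes L: "lower L" and s: "\<And>j. j \<in> L \<Longrightarrow> adapted s j" and c: "supported (L \<inter> {j. d j = p}) c"
  shows "bd (bd c) i = 0"
proof -
  have c1: "supported (L \<inter> {j. Suc (d j) = p}) (bd c)" by (rule supported_bd[OF L c s])
  have c2: "supported (L \<inter> {j. d j = p - 1}) (bd c)" using c1 by (auto simp: supported_def)
  have c3: "supported ((L - {}) \<inter> {j. d j = p - 2}) (bd (bd c))"
    using supported_bd[OF L c2 s] by (auto simp: supported_def)
  have "comb s (bd (bd c)) = fboundary (p - 1) (comb s (bd c))"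
    by (rule fboundary_comb[OF c2 s, symmetric])
  also have "\<dots> = fboundary (p - 1) (fboundary p (comb s c))"
    by (simp only: fboundary_comb[OF c s])
  also have "\<dots> = 0"
    by (rule fboundary_fboundary[OF comb_chains[OF L c s]])
  finally have "comb s (bd (bd c)) \<in> chains (p - 2) (Y {})" by simp
  from adapted_independent[OF L lower_empty _ s c3 this] show ?thesis by simp
qed

lemma bd_outside_lower:
  assumes A: "lower A" and s: "\<And>j. j \<in> A \<Longrightarrow> adapted s j" and c: "supported A c" and i: "i \<notin> A"
  shows "bd c i = 0"
  unfolding bd_def
proof (rule sum.neutral, intro ballI)
  fix j
  show "coeff i j * c j = 0"
  proof (rule ccontr)
    assume "coeff i j * c j \<noteq> 0"
    then have "j \<in> A" "coeff i j \<noteq> 0" using c by (auto simp: supported_def)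
    then show False using adapted_coeff[OF s] lowerD[OF A] i by (metis lessI)
  qed
qed

lemma bd_max:
  assumes s: "\<And>j. c j \<noteq> 0 \<Longrightarrow> adapted s j \<and> j \<le> b"
  shows "bd c b = 0"
  unfolding bd_def
proof (rule sum.neutral, intro ballI)
  fix j
  show "coeff b j * c j = 0"
    using s[of j] adapted_coeff[of s j b] by (cases "c j = 0") auto
qed

text \<open>For a cell \<open>b\<close> that is last in \<open>L - A\<close>, the triple of \<open>L\<close>, \<open>L - {b}\<close> and \<open>A\<close> reduces the
  claim to the smaller pair: by the homology of one attached cell, a chain that is a cycle
  relative to \<open>L - {b}\<close> is a multiple of \<open>s b\<close> up to boundaries and chains of \<open>L - {b}\<close>.
  Surjectivity and injectivity are proved together, because the step for surjectivity needs
  injectivity for the smaller pair, one dimension lower.\<close>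

theorem cellular_homology:
  assumes "lower L" "lower A" "A \<subseteq> L" "\<And>j. j \<in> L \<Longrightarrow> adapted s j"
  shows "\<And>p z. z \<in> relcycles p (Y L) (cells A) \<Longrightarrow>
      \<exists>c. supported ((L - A) \<inter> {j. d j = p}) c \<and> (\<forall>i\<in>L - A. bd c i = 0) \<and> z - comb s c \<in> relboundaries p (Y L) (cells A)"
    and "\<And>p c. supported ((L - A) \<inter> {j. d j = p}) c \<Longrightarrow> (\<And>i. i \<in> L - A \<Longrightarrow> bd c i = 0)
      \<Longrightarrow> comb s c \<in> relboundaries p (Y L) (cells A)
      \<Longrightarrow> \<exists>c'. supported ((L - A) \<inter> {j. d j = Suc p}) c' \<and> (\<forall>i\<in>L - A. c i = bd c' i)"
proof -
  have "(\<forall>p z. z \<in> relcycles p (Y L) (cells A) \<longrightarrow>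
      (\<exists>c. supported ((L - A) \<inter> {j. d j = p}) c \<and> (\<forall>i\<in>L - A. bd c i = 0) \<and> z - comb s c \<in> relboundaries p (Y L) (cells A)))
    \<and> (\<forall>p c. supported ((L - A) \<inter> {j. d j = p}) c \<longrightarrow> (\<forall>i\<in>L - A. bd c i = 0)
      \<longrightarrow> comb s c \<in> relboundaries p (Y L) (cells A)
      \<longrightarrow> (\<exists>c'. supported ((L - A) \<inter> {j. d j = Suc p}) c' \<and> (\<forall>i\<in>L - A. c i = bd c' i)))"
    using assms
  proof (induction "card (L - A)" arbitrary: L)
    case 0
    then have "L = A" using lower_finite[OF \<open>lower L\<close>] by auto
    then show ?case
      by (auto simp: supported_def relcycles_iff intro!: exI[of _ "\<lambda>i. 0"] chains_imp_relboundaries)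
  next
    case (Suc k L)
    note L = \<open>lower L\<close> and A = \<open>lower A\<close> and AL = \<open>A \<subseteq> L\<close> and s = Suc.prems(4)
    have fin: "finite (L - A)" using lower_finite[OF L] by blast
    define b where "b = Max (L - A)"
    have "L - A \<noteq> {}" using Suc.hyps(2) by force
    then have b: "b \<in> L - A" unfolding b_def using fin by (intro Max_in)
    have le: "j \<le> b" if "j \<in> L - A" for j unfolding b_def using fin that by (intro Max_ge)
    define L' where "L' = L - {b}"
    have L': "lower L'" unfolding L'_def by (rule lower_remove_max[OF L A AL b le])
    have AL': "A \<subseteq> L'" using AL b by (auto simp: L'_def)
    have L'L: "L' \<subseteq> L" by (auto simp: L'_def)
    have s': "adapted s j" if "j \<in> L'" for j using s that by (auto simp: L'_def)
    have J: "L - A = insert b (L' - A)" "b \<notin> L' - A" using b by (auto simp: L'_def)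
    have "k = card (L' - A)" using Suc.hyps(2) J fin by simp
    note IH = Suc.hyps(1)[OF this L' A AL' s']
    have bL: "b \<in> L" and bA: "b \<notin> A" and bn: "b \<le> n" using b lower_le[OF L] by auto
    note sb = s[OF bL]
    have lt: "j < b" if "j \<in> L' - A" for j using le[of j] that by (auto simp: L'_def)
    have mono: "x \<in> relboundaries p (Y L') (cells A) \<Longrightarrow> x \<in> relboundaries p (Y L) (cells A)" for x :: "('a, 'f) fchain" and p
      by (rule relboundaries_mono) (use cells_mono[OF L'L] in auto)
    have top_zero: "bd c b = 0" if "supported (L - A) c" for c
    proof (rule bd_max[where s = s])
      fix j assume "c j \<noteq> 0"
      then have "j \<in> L - A" using that by (simp add: supported_def)
      then show "adapted s j \<and> j \<le> b" using s le by blast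
    qed
    \<comment> \<open>The boundary of \<open>a \<cdot> s b\<close> is, modulo chains of \<open>A\<close>, the combination \<open>v\<close> of the remaining
      cells, and \<open>v\<close> is a relative cycle because \<open>A\<close> is a subcomplex. The condition on the
      dimension is imposed only for \<open>a \<noteq> 0\<close>, so that the cycles of the other dimensions are
      covered with \<open>a = 0\<close>.\<close>
    have split: "\<exists>v. supported ((L' - A) \<inter> {j. Suc (d j) = p}) v \<and> (\<forall>i\<in>L' - A. v i = a * coeff i b)
        \<and> (\<forall>i\<in>L' - A. bd v i = 0)
        \<and> scale_chain a (fboundary p (s b)) - comb s v \<in> chains (p - 1) (Y A)"
      if a: "a \<noteq> 0 \<Longrightarrow> p = d b" for a p
    proof -
      define w where "w = bd (\<lambda>i. a * unit b i)"
      have u: "supported (L \<inter> {j. d j = p}) (\<lambda>i. a * unit b i)"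
        using bL a by (auto simp: supported_def unit_def)
      have w: "w i = a * coeff i b" for i
        using bn by (simp add: w_def bd_scale bd_unit)
      have wL: "supported (L \<inter> {j. Suc (d j) = p}) w"
        unfolding w_def by (rule supported_bd[OF L u s])
      have wb: "w b = 0" using adapted_coeff[OF sb, of b] w[of b] by auto
      have wsplit: "w = (\<lambda>i. cut (L' - A) w i + cut A w i)"
        using wL wb AL by (fastforce simp: cut_def supported_def L'_def fun_eq_iff)
      have cA: "supported (A \<inter> {j. d j = p - 1}) (cut A w)"
        using wL by (auto simp: cut_def supported_def)
      have "bd (cut (L' - A) w) i = 0" if "i \<in> L' - A" for i
      proof -
        have "bd w i = 0" unfolding w_def by (rule bd_bd[OF L s u])
        moreover have "bd w i = bd (cut (L' - A) w) i + bd (cut A w) i"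
          by (subst wsplit) (rule bd_add)
        moreover have "bd (cut A w) i = 0"
          by (rule bd_outside_lower[OF A _ supported_cut]) (use that s AL in auto)
        ultimately show ?thesis by simp
      qed
      moreover have "scale_chain a (fboundary p (s b)) - comb s (cut (L' - A) w) \<in> chains (p - 1) (Y A)"
      proof -
        have "scale_chain a (fboundary p (s b)) = fboundary p (comb s (\<lambda>i. a * unit b i))"
          by (simp add: comb_scale comb_unit[OF bn] fboundary_scale)
        also have "\<dots> = comb s w" unfolding w_def by (rule fboundary_comb[OF u s])
        also have "\<dots> = comb s (cut (L' - A) w) + comb s (cut A w)"
          by (subst wsplit) (rule comb_add)
        finally have "scale_chain a (fboundary p (s b)) - comb s (cut (L' - A) w) = comb s (cut A w)" by simp
        then show ?thesis using comb_chains[OF A cA, of s] s AL by auto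
      qed
      moreover have "supported ((L' - A) \<inter> {j. Suc (d j) = p}) (cut (L' - A) w)"
        using wL by (auto simp: cut_def supported_def)
      moreover have "\<forall>i\<in>L' - A. cut (L' - A) w i = a * coeff i b"
        by (simp add: cut_def w)
      ultimately show ?thesis by blast
    qed
    show ?case
    proof (intro conjI allI impI)
      fix p and z :: "('a, 'f) fchain" assume z: "z \<in> relcycles p (Y L) (cells A)"
      have zL: "z \<in> chains p (Y L)" and zA: "fboundary p z \<in> chains (p - 1) (Y A)"
        using z AL by (auto simp: relcycles_iff)
      have "z \<in> relcycles p (Y L) (cells L')"
        using relcycles_mono[OF z subset_refl cells_mono[OF AL']] .
      then obtain a u x where a: "a \<noteq> 0 \<Longrightarrow> p = d b" and u: "u \<in> chains (Suc p) (Y L)" and x: "x \<in> chains p (Y L')"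
        and zeq: "z = scale_chain a (s b) + fboundary (Suc p) u + x"
        using adapted_generator[OF L _ bL sb, of z p] L' unfolding L'_def by metis
      obtain v where v: "supported ((L' - A) \<inter> {j. Suc (d j) = p}) v" "\<forall>i\<in>L' - A. v i = a * coeff i b"
         "\<forall>i\<in>L' - A. bd v i = 0" "scale_chain a (fboundary p (s b)) - comb s v \<in> chains (p - 1) (Y A)"
        using split[OF a] by blast
      have bz: "fboundary p z = scale_chain a (fboundary p (s b)) + fboundary p x"
        using fboundary_fboundary[OF u] by (simp add: zeq fboundary_add fboundary_scale)
      \<comment> \<open>As \<open>z\<close> is a relative cycle, \<open>- x\<close> shows that the image of \<open>v\<close> bounds in the smaller
        pair; injectivity there gives a cellular chain with boundary \<open>v\<close>.\<close>
      obtain c' where c': "supported ((L' - A) \<inter> {j. d j = p}) c'" "\<forall>i\<in>L' - A. v i = bd c' i"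
      proof (cases p)
        case 0
        then have "v = (\<lambda>i. 0)" using v(1) by (auto simp: supported_def)
        then show ?thesis by (intro that[of "\<lambda>i. 0"]) (auto simp: supported_def)
      next
        case (Suc q)
        have vq: "supported ((L' - A) \<inter> {j. d j = q}) v" using v(1) Suc by (simp add: supported_def)
        have x': "- x \<in> chains (Suc q) (Y L')" using x Suc by (simp add: chains_neg)
        have "comb s v - fboundary (Suc q) (- x) = fboundary p z - (scale_chain a (fboundary p (s b)) - comb s v)"
          using bz Suc by (simp add: chain_linear_neg)
        also have "\<dots> \<in> chains q (Y A)"
          using chains_diff[OF zA v(4)] Suc by simp
        finally have "comb s v \<in> relboundaries q (Y L') (cells A)"
          by (intro relboundariesI[OF x']) (use AL' in simp)
        with IH vq v(3) show ?thesis using that Suc by blast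
      qed
      \<comment> \<open>Now \<open>a \<cdot> b - c'\<close> is a cellular relative cycle, and after subtracting its image from \<open>z\<close>
        a relative cycle of the smaller pair remains, up to a boundary.\<close>
      define c1 where "c1 = (\<lambda>i. a * unit b i - c' i)"
      have "c' b = 0" using c'(1) by (auto simp: supported_def L'_def)
      then have c1: "supported ((L - A) \<inter> {j. d j = p}) c1"
        using c'(1) a b by (auto simp: supported_def c1_def unit_def L'_def split: if_splits)
      have c1L: "supported (L \<inter> {j. d j = p}) c1" using c1 by (auto simp: supported_def)
      have bc1: "bd c1 i = 0" if i: "i \<in> L - A" for i
      proof (cases "i = b")
        case True
        then show ?thesis using top_zero[of c1] c1 by (auto simp: supported_def)
      next
        case False
        then have "i \<in> L' - A" using i by (simp add: L'_def)
        then show ?thesis using v(2) c'(2) by (simp add: c1_def bd_diff bd_scale bd_unit[OF bn])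
      qed
      have "supported (L \<inter> {j. Suc (d j) = p}) (bd c1)"
        by (rule supported_bd[OF L c1L s])
      then have "supported (A \<inter> {j. d j = p - 1}) (bd c1)"
        using bc1 by (auto simp: supported_def)
      then have bc1A: "comb s (bd c1) \<in> chains (p - 1) (Y A)"
        by (rule comb_chains[OF A]) (use s AL in auto)
      define x' where "x' = x + comb s c'"
      have x'eq: "x' = z - comb s c1 - fboundary (Suc p) u"
        unfolding x'_def c1_def comb_diff comb_scale comb_unit[OF bn] zeq by simp
      have "fboundary p x' = fboundary p z - comb s (bd c1)"
        unfolding x'eq using fboundary_fboundary[OF u] by (simp add: fboundary_diff fboundary_comb[OF c1L s])
      then have "fboundary p x' \<in> chains (p - 1) (Y A)"
        using chains_diff[OF zA bc1A] by simp
      moreover have "x' \<in> chains p (Y L')"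
      proof -
        have "supported (L' \<inter> {j. d j = p}) c'" using c'(1) by (auto simp: supported_def)
        from comb_chains[OF L' this s'] show ?thesis unfolding x'_def using x by (intro chains_add)
      qed
      ultimately have "x' \<in> relcycles p (Y L') (cells A)"
        using AL' by (simp add: relcycles_iff)
      then obtain c2 where c2: "supported ((L' - A) \<inter> {j. d j = p}) c2" "\<forall>i\<in>L' - A. bd c2 i = 0"
        "x' - comb s c2 \<in> relboundaries p (Y L') (cells A)"
        using IH by blast
      have c2b: "bd c2 b = 0" using top_zero[of c2] c2(1) L'L by (auto simp: supported_def)
      show "\<exists>c. supported ((L - A) \<inter> {j. d j = p}) c \<and> (\<forall>i\<in>L - A. bd c i = 0) \<and> z - comb s c \<in> relboundaries p (Y L) (cells A)"
      proof (intro exI conjI)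
        show "supported ((L - A) \<inter> {j. d j = p}) (\<lambda>i. c1 i + c2 i)"
          using c2(1) L'L by (intro supported_add[OF c1]) (auto simp: supported_def)
        show "\<forall>i\<in>L - A. bd (\<lambda>i. c1 i + c2 i) i = 0"
          using bc1 c2(2) c2b J by (auto simp: bd_add)
        have "z - comb s (\<lambda>i. c1 i + c2 i) = (x' - comb s c2) + fboundary (Suc p) u"
          unfolding comb_add x'eq by simp
        also have "\<dots> \<in> relboundaries p (Y L) (cells A)"
          using mono[OF c2(3)] fboundary_imp_relboundaries[OF u] by (rule relboundaries_add)
        finally show "z - comb s (\<lambda>i. c1 i + c2 i) \<in> relboundaries p (Y L) (cells A)" .
      qed
    next
      fix p c assume c: "supported ((L - A) \<inter> {j. d j = p}) c" and bc: "\<forall>i\<in>L - A. bd c i = 0"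
        and rb: "comb s c \<in> relboundaries p (Y L) (cells A)"
      obtain f y where f: "f \<in> chains (Suc p) (Y L)" and y: "y \<in> chains p (Y A)" and eq: "comb s c = fboundary (Suc p) f + y"
        using rb AL unfolding relboundaries_iff by auto
      have yL': "y \<in> chains p (Y L')" using chains_mono[OF y cells_mono[OF AL']] .
      \<comment> \<open>Otherwise a nonzero multiple of \<open>s b\<close> would bound relative to \<open>L - {b}\<close>.\<close>
      have cb: "c b = 0"
      proof (rule ccontr)
        assume "c b \<noteq> 0"
        then have p: "d b = p" using c by (auto simp: supported_def)
        define c' where "c' = (\<lambda>j. c j - c b * unit b j)"
        have "supported (L' \<inter> {j. d j = p}) c'"
          using c by (auto simp: supported_def c'_def unit_def L'_def split: if_splits)
        then have c': "comb s c' \<in> chains p (Y L')" by (rule comb_chains[OF L' _ s'])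
        have "comb s c = comb s c' + scale_chain (c b) (s b)"
          unfolding c'_def comb_diff comb_scale comb_unit[OF bn] by simp
        then have "scale_chain (c b) (s b) - fboundary (Suc p) f = y - comb s c'"
          using eq by (simp add: algebra_simps)
        then have "scale_chain (c b) (s b) - fboundary (Suc p) f \<in> chains p (Y L')"
          using chains_diff[OF yL' c'] by simp
        then have "scale_chain (c b) (s b) \<in> relboundaries p (Y L) (cells L')"
          by (intro relboundariesI[OF f]) (use L'L in simp)
        then have "c b = 0"
          using adapted_nontrivial[OF L _ bL sb] L' p by (auto simp: L'_def)
        with \<open>c b \<noteq> 0\<close> show False by contradiction
      qed
      have c': "supported ((L' - A) \<inter> {j. d j = p}) c"
        using c cb by (auto simp: supported_def L'_def)
      have c'': "supported (L' \<inter> {j. d j = p}) c" using c' by (auto simp: supported_def)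
      have "fboundary (Suc p) f = comb s c - y" using eq by simp
      then have "fboundary (Suc p) f \<in> chains p (Y L')"
        using chains_diff[OF comb_chains[OF L' c'' s'] yL'] by simp
      then have "f \<in> relcycles (Suc p) (Y L) (cells L')"
        using f L'L by (simp add: relcycles_iff)
      then obtain a u x where a: "a \<noteq> 0 \<Longrightarrow> Suc p = d b" and u: "u \<in> chains (Suc (Suc p)) (Y L)" and x: "x \<in> chains (Suc p) (Y L')"
        and feq: "f = scale_chain a (s b) + fboundary (Suc (Suc p)) u + x"
        using adapted_generator[OF L _ bL sb, of f "Suc p"] L' unfolding L'_def by metis
      obtain v where v: "supported ((L' - A) \<inter> {j. Suc (d j) = Suc p}) v" "\<forall>i\<in>L' - A. v i = a * coeff i b"
         "\<forall>i\<in>L' - A. bd v i = 0" "scale_chain a (fboundary (Suc p) (s b)) - comb s v \<in> chains (Suc p - 1) (Y A)"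
        using split[OF a] by blast
      have bf: "fboundary (Suc p) f = scale_chain a (fboundary (Suc p) (s b)) + fboundary (Suc p) x"
        using fboundary_fboundary[OF u] by (simp add: feq fboundary_add fboundary_scale)
      have "comb s (\<lambda>i. c i - v i) - fboundary (Suc p) x = y + (scale_chain a (fboundary (Suc p) (s b)) - comb s v)"
        unfolding comb_diff eq bf by simp
      also have "\<dots> \<in> chains p (Y A)" using chains_add[OF y] v(4) by simp
      finally have "comb s (\<lambda>i. c i - v i) \<in> relboundaries p (Y L') (cells A)"
        by (intro relboundariesI[OF x]) (use AL' in simp)
      moreover have "supported ((L' - A) \<inter> {j. d j = p}) (\<lambda>i. c i - v i)"
        using c' v(1) by (intro supported_diff) (auto simp: supported_def)
      moreover have "\<forall>i\<in>L' - A. bd (\<lambda>i. c i - v i) i = 0"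
        using bc v(3) L'L by (auto simp: bd_diff)
      ultimately obtain w where w: "supported ((L' - A) \<inter> {j. d j = Suc p}) w" "\<forall>i\<in>L' - A. c i - v i = bd w i"
        using IH by blast
      define c1 where "c1 = (\<lambda>i. w i + a * unit b i)"
      have "w b = 0" using w(1) by (auto simp: supported_def L'_def)
      then have c1: "supported ((L - A) \<inter> {j. d j = Suc p}) c1"
        using w(1) a b by (auto simp: supported_def c1_def unit_def L'_def split: if_splits)
      moreover have "c i = bd c1 i" if i: "i \<in> L - A" for i
      proof (cases "i = b")
        case True
        then show ?thesis using top_zero[of c1] c1 cb by (auto simp: supported_def)
      next
        case False
        then have "i \<in> L' - A" using i by (simp add: L'_def)
        then show ?thesis using v(2) w(2) by (simp add: c1_def bd_add bd_scale bd_unit[OF bn] algebra_simps)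
      qed
      ultimately show "\<exists>c'. supported ((L - A) \<inter> {j. d j = Suc p}) c' \<and> (\<forall>i\<in>L - A. c i = bd c' i)"
        by blast
    qed
  qed
  then show "\<And>p z. z \<in> relcycles p (Y L) (cells A) \<Longrightarrow>
      \<exists>c. supported ((L - A) \<inter> {j. d j = p}) c \<and> (\<forall>i\<in>L - A. bd c i = 0) \<and> z - comb s c \<in> relboundaries p (Y L) (cells A)"
    and "\<And>p c. supported ((L - A) \<inter> {j. d j = p}) c \<Longrightarrow> (\<And>i. i \<in> L - A \<Longrightarrow> bd c i = 0)
      \<Longrightarrow> comb s c \<in> relboundaries p (Y L) (cells A)
      \<Longrightarrow> \<exists>c'. supported ((L - A) \<inter> {j. d j = Suc p}) c' \<and> (\<forall>i\<in>L - A. c i = bd c' i)"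
    by blast+
qed


section \<open>The cellular coefficients\<close>

lemma skeleton_below_cells: "skeleton_below K k = cells {j. j \<le> n \<and> d j < k}"
  by (simp add: skeleton_below_def cells_def)

text \<open>The skeleton with one cell \<open>i\<close> of top dimension removed is still a subcomplex, and
  relative to it the difference of the two combinations is a multiple of the nontrivial class
  \<open>e i\<close>.\<close>

lemma cellular_coeff_unique:
  assumes j: "j \<le> n" and k: "d j = Suc k"
    and l: "\<And>i. l i \<noteq> 0 \<Longrightarrow> i < j \<and> d i = k" and l': "\<And>i. l' i \<noteq> 0 \<Longrightarrow> i < j \<and> d i = k"
    and rb: "z - (\<Sum>i | i < j \<and> d i = k. scale_chain (l i) (e i)) \<in> relboundaries k (Y {j. j \<le> n \<and> d j < Suc k}) (cells {j. j \<le> n \<and> d j < k})"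
    and rb': "z - (\<Sum>i | i < j \<and> d i = k. scale_chain (l' i) (e i)) \<in> relboundaries k (Y {j. j \<le> n \<and> d j < Suc k}) (cells {j. j \<le> n \<and> d j < k})"
  shows "l i = l' i"
proof (rule ccontr)
  assume ne: "l i \<noteq> l' i"
  let ?L = "{j. j \<le> n \<and> d j < Suc k}" and ?A = "{j. j \<le> n \<and> d j < k}" and ?T = "{i. i < j \<and> d i = k}"
  have i: "i < j" "d i = k" using ne l[of i] l'[of i] by (cases "l i = 0"; auto)+
  have L: "lower ?L" by (auto simp: lower_def)
  have iL: "i \<in> ?L" using i j by simp
  have L': "lower (?L - {i})" using i by (auto simp: lower_def)
  have AL': "?A \<subseteq> ?L - {i}" using i by auto
  define c where "c = (\<lambda>i. l' i - l i)"
  have "(\<Sum>i\<in>?T. scale_chain (c i) (e i)) =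
     (z - (\<Sum>i\<in>?T. scale_chain (l i) (e i))) - (z - (\<Sum>i\<in>?T. scale_chain (l' i) (e i)))"
    by (simp add: c_def fch.scale_left_diff_distrib sum_subtractf)
  also have "\<dots> \<in> relboundaries k (Y ?L) (cells ?A)" by (rule relboundaries_diff[OF rb rb'])
  finally have "(\<Sum>i\<in>?T. scale_chain (c i) (e i)) \<in> relboundaries k (Y ?L) (cells ?A)" .
  then have 1: "(\<Sum>i\<in>?T. scale_chain (c i) (e i)) \<in> relboundaries k (Y ?L) (cells (?L - {i}))"
    using relboundaries_mono[OF _ subset_refl cells_mono[OF AL']] by blast
  have "(\<Sum>i\<in>?T - {i}. scale_chain (c i) (e i)) \<in> chains k (Y (?L - {i}))"
  proof (rule chains_sum)
    fix i' assume "i' \<in> ?T - {i}"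
    then have "i' \<in> ?L - {i}" "d i' = k" using j by auto
    then show "scale_chain (c i') (e i') \<in> chains k (Y (?L - {i}))"
      using cell_chain_chains[OF L', of i'] by (auto intro: chains_scale)
  qed
  then have 2: "(\<Sum>i\<in>?T - {i}. scale_chain (c i) (e i)) \<in> relboundaries k (Y ?L) (cells (?L - {i}))"
    by (intro chains_imp_relboundaries) (simp add: subtopology_Y[of "?L - {i}" ?L])
  have "(\<Sum>i\<in>?T. scale_chain (c i) (e i)) = scale_chain (c i) (e i) + (\<Sum>i\<in>?T - {i}. scale_chain (c i) (e i))"
    by (rule sum.remove) (use i in auto)
  then have 3: "scale_chain (c i) (e i) \<in> relboundaries k (Y ?L) (cells (?L - {i}))"
    using relboundaries_diff[OF 1 2] by simp
  have "c i \<noteq> 0" using ne by (simp add: c_def)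
  then have "e i = scale_chain (inverse (c i)) (scale_chain (c i) (e i))" by simp
  then have "e i \<in> relboundaries (d i) (Y ?L) (cells (?L - {i}))"
    using relboundaries_scale[OF 3, of "inverse (c i)"] i(2) by simp
  then show False using one_cell_nontrivial[OF L L' iL] by contradiction
qed

lemma cellular_coeff_eqI:
  assumes j: "j \<le> n" and k: "d j = Suc k"
    and l: "\<And>i. l i \<noteq> 0 \<Longrightarrow> i < j \<and> d i = k"
    and rb: "fboundary (d j) (e j) - (\<Sum>i | i < j \<and> d i = k. scale_chain (l i) (e i))
      \<in> relboundaries k (Y {j. j \<le> n \<and> d j < Suc k}) (cells {j. j \<le> n \<and> d j < k})"
  shows "coeff i j = l i"
proof -
  have "(THE l. (\<forall>i. l i \<noteq> 0 \<longrightarrow> i < j \<and> Suc (d i) = d j)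
    \<and> (d j > 0 \<longrightarrow> fboundary (d j) (e j)
          - (\<Sum>i | i < j \<and> Suc (d i) = d j. scale_chain (l i) (e i))
        \<in> relboundaries (d j - 1) (subtopology (cw_space K) (skeleton_below K (d j))) (skeleton_below K (d j - 1)))) = l"
  proof (rule the_equality)
    show "(\<forall>i. l i \<noteq> 0 \<longrightarrow> i < j \<and> Suc (d i) = d j)
    \<and> (d j > 0 \<longrightarrow> fboundary (d j) (e j)
          - (\<Sum>i | i < j \<and> Suc (d i) = d j. scale_chain (l i) (e i))
        \<in> relboundaries (d j - 1) (subtopology (cw_space K) (skeleton_below K (d j))) (skeleton_below K (d j - 1)))"
      using l rb by (simp add: k skeleton_below_cells)
    fix l' assume "(\<forall>i. l' i \<noteq> 0 \<longrightarrow> i < j \<and> Suc (d i) = d j)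
    \<and> (d j > 0 \<longrightarrow> fboundary (d j) (e j)
          - (\<Sum>i | i < j \<and> Suc (d i) = d j. scale_chain (l' i) (e i))
        \<in> relboundaries (d j - 1) (subtopology (cw_space K) (skeleton_below K (d j))) (skeleton_below K (d j - 1)))"
    then have l': "\<And>i. l' i \<noteq> 0 \<Longrightarrow> i < j \<and> d i = k"
      and rb': "fboundary (d j) (e j) - (\<Sum>i | i < j \<and> d i = k. scale_chain (l' i) (e i))
      \<in> relboundaries k (Y {j. j \<le> n \<and> d j < Suc k}) (cells {j. j \<le> n \<and> d j < k})"
      by (simp_all add: k skeleton_below_cells)
    show "l' = l"
      by (rule ext) (rule cellular_coeff_unique[OF j k l' l rb' rb])
  qed
  then show ?thesis unfolding cellular_coeff_def by (rule fun_cong)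
qed

lemma cellular_coeff_vertex:
  assumes "d j = 0" shows "coeff i j = 0"
proof -
  have "(THE l. (\<forall>i. l i \<noteq> 0 \<longrightarrow> i < j \<and> Suc (d i) = d j)
    \<and> (d j > 0 \<longrightarrow> fboundary (d j) (e j)
          - (\<Sum>i | i < j \<and> Suc (d i) = d j. scale_chain (l i) (e i))
        \<in> relboundaries (d j - 1) (subtopology (cw_space K) (skeleton_below K (d j))) (skeleton_below K (d j - 1)))) = (\<lambda>i. 0)"
    by (rule the_equality) (use assms in \<open>auto simp: fun_eq_iff\<close>)
  then show ?thesis unfolding cellular_coeff_def by (rule fun_cong)
qed

lemma adapted_cong: "(\<And>i. i \<le> j \<Longrightarrow> s i = s' i) \<Longrightarrow> adapted s j \<Longrightarrow> adapted s' j"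
proof -
  assume eq: "\<And>i. i \<le> j \<Longrightarrow> s i = s' i" and s: "adapted s j"
  have "comb s (\<lambda>i. coeff i j) = comb s' (\<lambda>i. coeff i j)"
    unfolding comb_def
  proof (rule sum.cong[OF refl])
    fix i show "scale_chain (coeff i j) (s i) = scale_chain (coeff i j) (s' i)"
      using adapted_coeff[OF s, of i] eq[of i] by (cases "coeff i j = 0") auto
  qed
  then show ?thesis using s eq[of j] by (simp add: adapted_def)
qed

text \<open>The boundary of \<open>e m\<close> is a cycle in the subcomplex of earlier cells of smaller dimension,
  where the adapted chains already compute the homology. It is thus \<open>comb s c\<close> plus the boundary
  of a chain \<open>a\<close>, and \<open>e m - a\<close> has boundary \<open>comb s c\<close>. Modulo the skeleton of the next smaller
  dimension, \<open>s i\<close> is \<open>e i\<close>, so \<open>c\<close> satisfies the condition that defines the cellular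
  coefficients.\<close>

lemma adapted_extend:
  assumes m: "m \<le> n" and s: "\<And>j. j < m \<Longrightarrow> adapted s j"
  shows "\<exists>x. adapted (s(m := x)) m"
proof (cases "d m")
  case 0
  have "comb (s(m := e m)) (\<lambda>i. coeff i m) = 0"
    unfolding cellular_coeff_vertex[OF 0] by simp
  then show ?thesis
    using 0 cellular_coeff_vertex[OF 0] by (intro exI[of _ "e m"]) (simp add: adapted_def)
next
  case (Suc k)
  let ?L = "{i. i < m \<and> d i < d m}"
  have L: "lower ?L" using m by (auto simp: lower_def)
  have sL: "adapted s j" if "j \<in> ?L" for j using s that by simp
  have bc: "fboundary (Suc k) (e m) \<in> chains k (Y ?L)"
    using fboundary_cell_chain[OF m] Suc by simp
  have top: "lower {..n}" by (auto simp: lower_def)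
  have "fboundary k (fboundary (Suc k) (e m)) = 0"
    using fboundary_fboundary[OF cell_chain_chains[OF top, of m]] m Suc by simp
  then have "fboundary (Suc k) (e m) \<in> relcycles k (Y ?L) (cells {})"
    using bc by (simp add: relcycles_iff)
  from cellular_homology(1)[OF L lower_empty empty_subsetI sL this]
  obtain c where c: "supported (?L \<inter> {j. d j = k}) c"
    "fboundary (Suc k) (e m) - comb s c \<in> relboundaries k (Y ?L) (cells {})" by auto
  then obtain a b where a: "a \<in> chains (Suc k) (Y ?L)" and b: "b \<in> chains k (subtopology (Y ?L) {})"
    and eq: "fboundary (Suc k) (e m) - comb s c = fboundary (Suc k) a + b"
    unfolding relboundaries_iff by auto
  have "b = 0" using chains_empty[OF b] by simp
  with eq have ba: "fboundary (Suc k) (e m) - comb s c = fboundary (Suc k) a" by simp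
  have cz: "c i \<noteq> 0 \<Longrightarrow> i < m \<and> d i = k" for i using c(1) by (auto simp: supported_def)
  let ?T = "{i. i < m \<and> d i = k}" and ?B = "{j. j \<le> n \<and> d j < k}" and ?M = "{j. j \<le> n \<and> d j < Suc k}"
  have comb_eq: "comb f c = (\<Sum>i\<in>?T. scale_chain (c i) (f i))" for f
    unfolding comb_def by (rule sum.mono_neutral_right) (use m cz in auto)
  have LM: "?L \<subseteq> ?M" using m Suc by auto
  have coeff: "coeff i m = c i" for i
  proof (rule cellular_coeff_eqI[OF m Suc cz])
    have "(\<Sum>i\<in>?T. scale_chain (c i) (s i - e i)) \<in> chains k (Y ?B)"
    proof (rule chains_sum, rule chains_scale)
      fix i assume i: "i \<in> ?T"
      then have "s i - e i \<in> chains k (Y {i'. i' < i \<and> d i' < d i})"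
        using s[of i] by (auto simp: adapted_def)
      then show "s i - e i \<in> chains k (Y ?B)"
        by (rule chains_mono) (use i m in \<open>auto intro!: cells_mono\<close>)
    qed
    moreover have "?B \<subseteq> ?M" by auto
    ultimately have 1: "(\<Sum>i\<in>?T. scale_chain (c i) (s i - e i)) \<in> relboundaries k (Y ?M) (cells ?B)"
      by (intro chains_imp_relboundaries) simp
    have "a \<in> chains (Suc k) (Y ?M)" using chains_mono[OF a cells_mono[OF LM]] .
    then have 2: "fboundary (Suc k) a \<in> relboundaries k (Y ?M) (cells ?B)" by (rule fboundary_imp_relboundaries)
    have "fboundary (d m) (e m) - (\<Sum>i\<in>?T. scale_chain (c i) (e i)) = fboundary (Suc k) a + (\<Sum>i\<in>?T. scale_chain (c i) (s i - e i))"
      using ba unfolding comb_eq Suc by (simp add: fch.scale_right_diff_distrib sum_subtractf algebra_simps)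
    then show "fboundary (d m) (e m) - (\<Sum>i\<in>?T. scale_chain (c i) (e i)) \<in> relboundaries k (Y ?M) (cells ?B)"
      using relboundaries_add[OF 2 1] by simp
  qed
  let ?s = "s(m := e m - a)"
  have "comb ?s (\<lambda>i. coeff i m) = comb s c"
    unfolding coeff comb_eq by (rule sum.cong) auto
  moreover have "fboundary (d m) (e m - a) = comb s c"
    using ba Suc by (simp add: fboundary_diff algebra_simps)
  moreover have "- a \<in> chains (d m) (Y ?L)" using a Suc by (simp add: chains_neg)
  ultimately have "adapted ?s m"
    using cz Suc by (auto simp: adapted_def coeff)
  then show ?thesis by blast
qed

theorem adapted_exists: "\<exists>s. \<forall>j\<le>n. adapted s j"
proof -
  have "\<exists>s. \<forall>j<m. adapted s j" if "m \<le> Suc n" for m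
    using that
  proof (induction m)
    case (Suc m)
    then obtain s where s: "\<And>j. j < m \<Longrightarrow> adapted s j" by auto
    obtain x where x: "adapted (s(m := x)) m" using adapted_extend[OF _ s] Suc.prems by auto
    have "adapted (s(m := x)) j" if "j < Suc m" for j
    proof (cases "j = m")
      case False
      then have "j < m" using that by simp
      then show ?thesis by (intro adapted_cong[OF _ s]) auto
    qed (use x in simp)
    then show ?case by blast
  qed simp
  from this[of "Suc n"] show ?thesis by (auto simp: less_Suc_eq_le)
qed

end

section \<open>Cohomology by duality\<close>

text \<open>A linear relation that is single-valued at 0 is the graph of a linear functional on a
  subspace, and over a field this extends to the whole space. A relation is convenient because
  the functionals needed below are given on elements by representatives that are not unique.\<close>

lemma linear_functional_extension:
  fixes R :: "('s \<Rightarrow>\<^sub>0 'f::field) \<Rightarrow> 'f \<Rightarrow> bool"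
  assumes add: "\<And>u a v b. R u a \<Longrightarrow> R v b \<Longrightarrow> R (u + v) (a + b)"
    and scale: "\<And>r u a. R u a \<Longrightarrow> R (scale_chain r u) (r * a)"
    and zero: "\<And>a. R 0 a \<longleftrightarrow> a = 0"
  obtains F where "\<And>x y. F (x + y) = F x + F y" "\<And>r x. F (scale_chain r x) = r * F x" "\<And>u a. R u a \<Longrightarrow> F u = a"
proof -
  interpret vf: vector_space "(*) :: 'f \<Rightarrow> 'f \<Rightarrow> 'f"
    by unfold_locales (auto simp: algebra_simps)
  interpret vp: vector_space_pair "scale_chain :: 'f \<Rightarrow> ('s \<Rightarrow>\<^sub>0 'f) \<Rightarrow> _" "(*) :: 'f \<Rightarrow> 'f \<Rightarrow> 'f"
    by unfold_locales
  define U where "U = {u. \<exists>a. R u a}"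
  obtain B where B: "B \<subseteq> U" "fch.independent B" "U \<subseteq> fch.span B"
    using fch.maximal_independent_subset by blast
  define f where "f = (\<lambda>u. SOME a. R u a)"
  have f: "R u (f u)" if "u \<in> U" for u
    using that unfolding f_def U_def by (auto intro: someI)
  define F where "F = vp.construct B f"
  have lin: "Vector_Spaces.linear scale_chain (*) F" unfolding F_def by (rule vp.linear_construct[OF B(2)])
  have F_add: "F (x + y) = F x + F y" and F_scale: "F (scale_chain r x) = r * F x" for x y r
    using lin by (auto simp: Vector_Spaces.linear_def module_hom.add module_hom.scale)
  have F_zero: "F 0 = 0" using F_scale[of 0 0] by simp
  have Fb: "R b (F b)" if "b \<in> B" for b
    using f[of b] B(1) that vp.construct_basis[OF B(2) that, of f] by (auto simp: F_def)
  have RF: "R u (F u)" if "u \<in> fch.span B" for u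
    using that
  proof (induction rule: fch.span_induct_alt)
    case base
    then show ?case by (simp add: F_zero zero)
  next
    case (step c x y)
    then show ?case unfolding F_add F_scale by (intro add[OF scale[OF Fb]])
  qed
  have "F u = a" if "R u a" for u a
  proof -
    have "u \<in> fch.span B" using that B(3) by (auto simp: U_def)
    from add[OF that scale[OF RF[OF this], of "-1"]] have "R 0 (a - F u)" by simp
    then show ?thesis by (simp add: zero)
  qed
  with F_add F_scale show ?thesis using that by blast
qed

lemma dual_space_iff:
  "\<phi> \<in> carrier (dual_space (fchains p X)) \<longleftrightarrow>
    (\<forall>x\<in>chains p X. \<forall>y\<in>chains p X. \<phi> (x + y) = \<phi> x + \<phi> y) \<and> (\<forall>a. \<forall>x\<in>chains p X. \<phi> (scale_chain a x) = a * \<phi> x)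
    \<and> (\<forall>x. x \<notin> chains p X \<longrightarrow> \<phi> x = 0)"
  by (simp add: dual_space_def vspace_def linear_on_def base_field_def fchains_def)

lemma relcochains_iff:
  "\<phi> \<in> relcochains p X S \<longleftrightarrow> \<phi> \<in> carrier (dual_space (fchains p X)) \<and> (\<forall>c\<in>chains p (subtopology X S). \<phi> c = 0)"
  by (simp add: relcochains_def)

lemma cochain_add: "\<phi> \<in> carrier (dual_space (fchains p X)) \<Longrightarrow> x \<in> chains p X \<Longrightarrow> y \<in> chains p X \<Longrightarrow> \<phi> (x + y) = \<phi> x + \<phi> y"
  and cochain_scale: "\<phi> \<in> carrier (dual_space (fchains p X)) \<Longrightarrow> x \<in> chains p X \<Longrightarrow> \<phi> (scale_chain a x) = a * \<phi> x"
  and cochain_outside: "\<phi> \<in> carrier (dual_space (fchains p X)) \<Longrightarrow> x \<notin> chains p X \<Longrightarrow> \<phi> x = 0"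
  by (auto simp: dual_space_iff)

lemma cochain_zero: "\<phi> \<in> carrier (dual_space (fchains p X)) \<Longrightarrow> \<phi> 0 = 0"
  using cochain_scale[of \<phi> p X 0 0] by simp

lemma cochain_diff: "\<phi> \<in> carrier (dual_space (fchains p X)) \<Longrightarrow> x \<in> chains p X \<Longrightarrow> y \<in> chains p X \<Longrightarrow> \<phi> (x - y) = \<phi> x - \<phi> y"
  using cochain_add[of \<phi> p X "x - y" y] chains_diff[of x p X y] by simp

lemma cochain_sum:
  assumes "\<phi> \<in> carrier (dual_space (fchains p X))" "\<And>j. j \<in> J \<Longrightarrow> c j \<noteq> 0 \<Longrightarrow> f j \<in> chains p X"
  shows "\<phi> (\<Sum>j\<in>J. scale_chain (c j) (f j)) = (\<Sum>j\<in>J. c j * \<phi> (f j))"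
  using assms(2)
proof (induction J rule: infinite_finite_induct)
  case (insert j J)
  have 1: "scale_chain (c i) (f i) \<in> chains p X" if "i \<in> insert j J" for i
    using insert.prems[OF that] by (cases "c i = 0") (auto intro: chains_scale)
  have 2: "\<phi> (scale_chain (c j) (f j)) = c j * \<phi> (f j)"
    using insert.prems[of j] cochain_scale[OF assms(1)] by (cases "c j = 0") (auto simp: cochain_zero[OF assms(1)])
  have "(\<Sum>j\<in>J. scale_chain (c j) (f j)) \<in> chains p X" using 1 by (intro chains_sum) auto
  then show ?case
    using insert cochain_add[OF assms(1) 1[of j]] 2 by simp
qed (auto simp: cochain_zero[OF assms(1)])

text \<open>Vanishing on the chains of the subspace and having coboundary 0 say together that the
  functional kills relative boundaries.\<close>

lemma relcocycles_iff:
  "\<phi> \<in> relcocycles p X S \<longleftrightarrow> \<phi> \<in> carrier (dual_space (fchains p X)) \<and> (\<forall>c\<in>relboundaries p X S. \<phi> c = 0)"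
proof
  assume "\<phi> \<in> relcocycles p X S"
  then have \<phi>: "\<phi> \<in> carrier (dual_space (fchains p X))" and S: "\<forall>c\<in>chains p (subtopology X S). \<phi> c = 0"
    and co: "coboundary p X \<phi> = (\<lambda>c. 0)" by (auto simp: relcocycles_def relcochains_iff)
  have b: "\<phi> (fboundary (Suc p) x) = 0" if "x \<in> chains (Suc p) X" for x
    using fun_cong[OF co, of x] that by (simp add: coboundary_def on_carrier_def)
  have "\<phi> c = 0" if "c \<in> relboundaries p X S" for c
  proof -
    obtain x a where xa: "x \<in> chains (Suc p) X" "a \<in> chains p (subtopology X S)" "c = fboundary (Suc p) x + a"
      using \<open>c \<in> relboundaries p X S\<close> unfolding relboundaries_iff by blast
    then have "\<phi> c = \<phi> (fboundary (Suc p) x) + \<phi> a"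
      using cochain_add[OF \<phi>, of "fboundary (Suc p) x" a] fboundary_chains[OF xa(1)] chains_subtopology[OF xa(2)] by simp
    then show ?thesis using b S xa by simp
  qed
  with \<phi> show "\<phi> \<in> carrier (dual_space (fchains p X)) \<and> (\<forall>c\<in>relboundaries p X S. \<phi> c = 0)" by blast
next
  assume \<phi>: "\<phi> \<in> carrier (dual_space (fchains p X)) \<and> (\<forall>c\<in>relboundaries p X S. \<phi> c = 0)"
  have "\<phi> c = 0" if "c \<in> chains p (subtopology X S)" for c
    using \<phi> chains_imp_relboundaries[OF that] by blast
  moreover have "\<phi> (fboundary (Suc p) c) = 0" if "c \<in> chains (Suc p) X" for c
    using \<phi> fboundary_imp_relboundaries[OF that] by blast
  ultimately show "\<phi> \<in> relcocycles p X S"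
    using \<phi> by (auto simp: relcocycles_def relcochains_iff coboundary_def on_carrier_def fun_eq_iff)
qed

lemma restrict_functional_dual:
  assumes "\<And>x y. F (x + y) = F x + F y" "\<And>r x. F (scale_chain r x) = r * F x"
  shows "on_carrier (fchains p X) F \<in> carrier (dual_space (fchains p X))"
  using assms by (simp add: dual_space_iff on_carrier_def chains_add chains_scale)

text \<open>A functional that kills relative cycles factors through the boundary modulo chains of the
  subspace; the relation \<open>R\<close> is this factorisation, and any extension of it to all chains has
  the given coboundary.\<close>

lemma relcoboundaryI:
  assumes \<phi>: "\<phi> \<in> carrier (dual_space (fchains p X))" and z: "\<And>z. z \<in> relcycles p X S \<Longrightarrow> \<phi> z = 0"
  shows "\<phi> \<in> relcoboundaries p X S"
proof (cases p)
  case 0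
  have "\<phi> c = 0" for c
    using z[of c] cochain_outside[OF \<phi>, of c] 0 by (cases "c \<in> chains p X") (auto simp: relcycles_iff)
  then show ?thesis using 0 by (auto simp: relcoboundaries_def)
next
  case (Suc q)
  define R where "R = (\<lambda>u a. \<exists>x\<in>chains (Suc q) X. u - fboundary (Suc q) x \<in> chains q (subtopology X S) \<and> a = \<phi> x)"
  note \<phi>' = \<phi>[unfolded Suc]
  obtain F where F: "\<And>x y. F (x + y) = F x + F y" "\<And>r x. F (scale_chain r x) = r * F x" "\<And>u a. R u a \<Longrightarrow> F u = a"
  proof (rule linear_functional_extension[of R])
    fix u a v b assume "R u a" "R v b"
    then obtain x y where xy: "x \<in> chains (Suc q) X" "u - fboundary (Suc q) x \<in> chains q (subtopology X S)" "a = \<phi> x"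
      "y \<in> chains (Suc q) X" "v - fboundary (Suc q) y \<in> chains q (subtopology X S)" "b = \<phi> y"
      unfolding R_def by blast
    have "u + v - fboundary (Suc q) (x + y) = (u - fboundary (Suc q) x) + (v - fboundary (Suc q) y)"
      by (simp add: fboundary_add)
    also have "\<dots> \<in> chains q (subtopology X S)" using xy(2,5) by (rule chains_add)
    finally show "R (u + v) (a + b)"
      unfolding R_def using xy(1,3,4,6) by (intro bexI[of _ "x + y"]) (auto simp: cochain_add[OF \<phi>'] chains_add)
  next
    fix r u a assume "R u a"
    then obtain x where x: "x \<in> chains (Suc q) X" "u - fboundary (Suc q) x \<in> chains q (subtopology X S)" "a = \<phi> x"
      unfolding R_def by blast
    have "scale_chain r u - fboundary (Suc q) (scale_chain r x) = scale_chain r (u - fboundary (Suc q) x)"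
      by (simp add: fboundary_scale fch.scale_right_diff_distrib)
    then show "R (scale_chain r u) (r * a)"
      unfolding R_def using x by (intro bexI[of _ "scale_chain r x"]) (auto simp: cochain_scale[OF \<phi>'] chains_scale)
  next
    fix a
    show "R 0 a \<longleftrightarrow> a = 0"
    proof
      assume "R 0 a"
      then obtain x where x: "x \<in> chains (Suc q) X" "- fboundary (Suc q) x \<in> chains q (subtopology X S)" "a = \<phi> x"
        unfolding R_def by auto
      then have "x \<in> relcycles p X S" using Suc chains_neg[OF x(2)] by (simp add: relcycles_iff)
      then show "a = 0" using z x(3) by simp
    next
      assume "a = 0"
      then show "R 0 a" unfolding R_def using cochain_zero[OF \<phi>'] by (intro bexI[of _ 0]) auto
    qed
  qed blast
  let ?\<psi> = "on_carrier (fchains q X) F"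
  have "F c = 0" if "c \<in> chains q (subtopology X S)" for c
    by (rule F(3)) (use that cochain_zero[OF \<phi>'] in \<open>auto simp: R_def intro!: bexI[of _ 0]\<close>)
  then have "?\<psi> \<in> relcochains q X S"
    using restrict_functional_dual[OF F(1,2)] by (auto simp: relcochains_iff on_carrier_def)
  moreover have "coboundary q X ?\<psi> = \<phi>"
  proof
    fix c
    show "coboundary q X ?\<psi> c = \<phi> c"
    proof (cases "c \<in> chains (Suc q) X")
      case True
      have "F (fboundary (Suc q) c) = \<phi> c"
        by (rule F(3)) (use True in \<open>auto simp: R_def intro!: bexI[of _ c]\<close>)
      then show ?thesis using True fboundary_chains[OF True] by (simp add: coboundary_def on_carrier_def)
    next
      case False
      then show ?thesis using cochain_outside[OF \<phi>'] by (simp add: coboundary_def on_carrier_def)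
    qed
  qed
  ultimately show ?thesis using Suc by (auto simp: relcoboundaries_def)
qed

context cw_complex
begin

definition cobd :: "(nat \<Rightarrow> 'f) \<Rightarrow> nat \<Rightarrow> 'f" where
  "cobd c i = (\<Sum>j\<le>n. coeff j i * c j)"

text \<open>The two matrices are transposes of each other.\<close>

lemma bd_cobd_adjoint: "(\<Sum>j\<le>n. x j * cobd c j) = (\<Sum>i\<le>n. c i * bd x i)"
proof -
  have "(\<Sum>j\<le>n. x j * cobd c j) = (\<Sum>j\<le>n. \<Sum>i\<le>n. c i * (coeff i j * x j))"
    by (simp add: cobd_def sum_distrib_left mult.commute mult.left_commute)
  also have "\<dots> = (\<Sum>i\<le>n. \<Sum>j\<le>n. c i * (coeff i j * x j))" by (rule sum.swap)
  finally show ?thesis by (simp add: bd_def sum_distrib_left)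
qed

text \<open>Both parts dualise \<open>cellular_homology\<close>. A cocycle is determined on relative cycles by its
  values on the chains \<open>s j\<close>, and these pair to zero with cellular cycles if they form a
  cellular coboundary. Conversely a cellular cocycle defines a functional on the combinations of
  the \<open>s j\<close> modulo relative boundaries. It is well defined, since a combination that is a
  relative boundary is cellularly a boundary, and a cellular cocycle pairs to zero with it.\<close>

theorem cellular_cohomology:
  assumes L: "lower L" and A: "lower A" "A \<subseteq> L" and s: "\<And>j. j \<in> L \<Longrightarrow> adapted s j"
  shows cellular_coboundary: "\<And>p \<phi> c'. \<phi> \<in> relcocycles p (Y L) (cells A) \<Longrightarrow> supported (L - A) c' \<Longrightarrow>
      (\<And>j. j \<in> L - A \<Longrightarrow> d j = p \<Longrightarrow> \<phi> (s j) = cobd c' j) \<Longrightarrow> \<phi> \<in> relcoboundaries p (Y L) (cells A)"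
    and cellular_cocycle: "\<And>p c. supported (L - A) c \<Longrightarrow> (\<And>i. i \<in> L - A \<Longrightarrow> cobd c i = 0) \<Longrightarrow>
      \<exists>\<phi>\<in>relcocycles p (Y L) (cells A). \<forall>j\<in>L - A. d j = p \<longrightarrow> \<phi> (s j) = c j"
proof -
  fix p \<phi> c'
  assume \<phi>: "\<phi> \<in> relcocycles p (Y L) (cells A)" and c': "supported (L - A) c'"
    and eq: "\<And>j. j \<in> L - A \<Longrightarrow> d j = p \<Longrightarrow> \<phi> (s j) = cobd c' j"
  have \<phi>D: "\<phi> \<in> carrier (dual_space (fchains p (Y L)))" and \<phi>0: "\<And>c. c \<in> relboundaries p (Y L) (cells A) \<Longrightarrow> \<phi> c = 0"
    using \<phi> by (auto simp: relcocycles_iff)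
  show "\<phi> \<in> relcoboundaries p (Y L) (cells A)"
  proof (rule relcoboundaryI[OF \<phi>D])
    fix z :: "('a, 'f) fchain" assume z: "z \<in> relcycles p (Y L) (cells A)"
    from cellular_homology(1)[OF L A s z] obtain c where
      c: "supported ((L - A) \<inter> {j. d j = p}) c" "\<forall>i\<in>L - A. bd c i = 0" "z - comb s c \<in> relboundaries p (Y L) (cells A)"
      by blast
    have cL: "supported (L \<inter> {j. d j = p}) c" using c(1) by (auto simp: supported_def)
    have comb: "comb s c \<in> chains p (Y L)" by (rule comb_chains[OF L cL s])
    have "\<phi> (z - comb s c) = 0" using \<phi>0 c(3) by blast
    then have "\<phi> z = \<phi> (comb s c)"
      using cochain_diff[OF \<phi>D _ comb, of z] z by (simp add: relcycles_iff)
    also have "\<dots> = (\<Sum>j\<le>n. c j * \<phi> (s j))"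
      unfolding comb_def
    proof (rule cochain_sum[OF \<phi>D])
      fix j assume "c j \<noteq> 0"
      then have "j \<in> L" "d j = p" using c(1) by (auto simp: supported_def)
      then show "s j \<in> chains p (Y L)" using adapted_chains[OF L _ s] by blast
    qed
    also have "\<dots> = (\<Sum>j\<le>n. c j * cobd c' j)"
    proof (rule sum.cong[OF refl])
      fix j show "c j * \<phi> (s j) = c j * cobd c' j"
        using c(1) eq[of j] by (cases "c j = 0") (auto simp: supported_def)
    qed
    also have "\<dots> = (\<Sum>i\<le>n. c' i * bd c i)" by (rule bd_cobd_adjoint)
    also have "\<dots> = 0"
    proof (rule sum.neutral, intro ballI)
      fix i show "c' i * bd c i = 0"
        using c(2) c' by (cases "c' i = 0") (auto simp: supported_def)
    qed
    finally show "\<phi> z = 0" .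
  qed
next
  fix p c
  assume c: "supported (L - A) c" and cc: "\<And>i. i \<in> L - A \<Longrightarrow> cobd c i = 0"
  define R where "R = (\<lambda>u a. \<exists>x. supported ((L - A) \<inter> {j. d j = p}) x \<and> u - comb s x \<in> relboundaries p (Y L) (cells A)
      \<and> a = (\<Sum>j\<le>n. x j * c j))"
  obtain F where F: "\<And>x y. F (x + y) = F x + F y" "\<And>r x. F (scale_chain r x) = r * F x" "\<And>u a. R u a \<Longrightarrow> F u = a"
  proof (rule linear_functional_extension[of R])
    fix u a v b assume "R u a" "R v b"
    then obtain x y where xy: "supported ((L - A) \<inter> {j. d j = p}) x" "u - comb s x \<in> relboundaries p (Y L) (cells A)" "a = (\<Sum>j\<le>n. x j * c j)"
      "supported ((L - A) \<inter> {j. d j = p}) y" "v - comb s y \<in> relboundaries p (Y L) (cells A)" "b = (\<Sum>j\<le>n. y j * c j)"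
      unfolding R_def by blast
    have "u + v - comb s (\<lambda>i. x i + y i) = (u - comb s x) + (v - comb s y)"
      by (simp add: comb_add)
    then have "u + v - comb s (\<lambda>i. x i + y i) \<in> relboundaries p (Y L) (cells A)"
      using relboundaries_add[OF xy(2,5)] by (simp only:)
    moreover have "supported ((L - A) \<inter> {j. d j = p}) (\<lambda>i. x i + y i)"
      using xy(1,4) by (rule supported_add)
    ultimately show "R (u + v) (a + b)"
      unfolding R_def using xy by (intro exI[of _ "\<lambda>i. x i + y i"]) (auto simp: sum.distrib algebra_simps)
  next
    fix r u a assume "R u a"
    then obtain x where x: "supported ((L - A) \<inter> {j. d j = p}) x" "u - comb s x \<in> relboundaries p (Y L) (cells A)" "a = (\<Sum>j\<le>n. x j * c j)"
      unfolding R_def by blast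
    have "scale_chain r u - comb s (\<lambda>i. r * x i) = scale_chain r (u - comb s x)"
      by (simp add: comb_scale fch.scale_right_diff_distrib)
    then have "scale_chain r u - comb s (\<lambda>i. r * x i) \<in> relboundaries p (Y L) (cells A)"
      using relboundaries_scale[OF x(2)] by (simp only:)
    moreover have "supported ((L - A) \<inter> {j. d j = p}) (\<lambda>i. r * x i)"
      using x(1) by (auto simp: supported_def)
    ultimately show "R (scale_chain r u) (r * a)"
      unfolding R_def using x by (intro exI[of _ "\<lambda>i. r * x i"]) (auto simp: sum_distrib_left algebra_simps)
  next
    fix a
    show "R 0 a \<longleftrightarrow> a = 0"
    proof
      assume "R 0 a"
      then obtain x where x: "supported ((L - A) \<inter> {j. d j = p}) x" "0 - comb s x \<in> relboundaries p (Y L) (cells A)" "a = (\<Sum>j\<le>n. x j * c j)"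
        unfolding R_def by blast
      have xb: "comb s x \<in> relboundaries p (Y L) (cells A)"
        using relboundaries_diff[OF relboundaries_zero x(2)] by simp
      have xL: "supported (L \<inter> {j. d j = p}) x" using x(1) by (auto simp: supported_def)
      have "fboundary p (comb s x) \<in> chains (p - 1) (Y A)"
        using xb relboundaries_subset_relcycles A by (fastforce simp: relcycles_iff)
      then have bA: "comb s (bd x) \<in> chains (p - 1) (Y A)"
        by (simp only: fboundary_comb[OF xL s])
      have bL: "supported (L \<inter> {j. Suc (d j) = p}) (bd x)" by (rule supported_bd[OF L xL s])
      have split: "bd x = (\<lambda>i. cut (L - A) (bd x) i + cut A (bd x) i)"
        using bL A by (fastforce simp: cut_def supported_def fun_eq_iff)
      have "supported (A \<inter> {j. d j = p - 1}) (cut A (bd x))"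
        using bL by (auto simp: cut_def supported_def)
      then have 1: "comb s (cut A (bd x)) \<in> chains (p - 1) (Y A)"
        by (rule comb_chains[OF A(1)]) (use s A in auto)
      have "comb s (cut (L - A) (bd x)) = comb s (bd x) - comb s (cut A (bd x))"
        by (subst (2) split) (simp add: comb_add)
      then have 2: "comb s (cut (L - A) (bd x)) \<in> chains (p - 1) (Y A)"
        using chains_diff[OF bA 1] by simp
      have "supported ((L - A) \<inter> {j. d j = p - 1}) (cut (L - A) (bd x))"
        using bL by (auto simp: cut_def supported_def)
      \<comment> \<open>Independence of the \<open>s j\<close> modulo chains of \<open>A\<close> makes \<open>x\<close> a cellular relative cycle.\<close>
      from adapted_independent[OF L A s this 2] have "cut (L - A) (bd x) i = 0" for i .
      then have bx: "bd x i = 0" if "i \<in> L - A" for i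
        using that unfolding cut_def by metis
      obtain y where y: "supported ((L - A) \<inter> {j. d j = Suc p}) y" "\<forall>i\<in>L - A. x i = bd y i"
        using cellular_homology(2)[OF L A s x(1) bx xb] by blast
      have "(\<Sum>j\<le>n. x j * c j) = (\<Sum>j\<le>n. c j * bd y j)"
      proof (rule sum.cong[OF refl])
        fix j show "x j * c j = c j * bd y j"
          using c y(2) by (cases "c j = 0") (auto simp: supported_def)
      qed
      also have "\<dots> = (\<Sum>j\<le>n. y j * cobd c j)" by (rule bd_cobd_adjoint[symmetric])
      also have "\<dots> = 0"
      proof (rule sum.neutral, intro ballI)
        fix j show "y j * cobd c j = 0"
          using cc y(1) by (cases "y j = 0") (auto simp: supported_def)
      qed
      finally show "a = 0" using x(3) by simp
    next
      assume "a = 0"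
      then show "R 0 a" unfolding R_def by (intro exI[of _ "\<lambda>i. 0"]) (auto simp: supported_def)
    qed
  qed blast
  let ?\<phi> = "on_carrier (fchains p (Y L)) F"
  have \<phi>: "?\<phi> \<in> carrier (dual_space (fchains p (Y L)))" by (rule restrict_functional_dual[OF F(1,2)])
  have "?\<phi> r = 0" if "r \<in> relboundaries p (Y L) (cells A)" for r
  proof -
    have "F r = 0"
      by (rule F(3)) (use that in \<open>auto simp: R_def supported_def intro!: exI[of _ "\<lambda>i. 0"]\<close>)
    then show ?thesis by (simp add: on_carrier_def)
  qed
  then have "?\<phi> \<in> relcocycles p (Y L) (cells A)" using \<phi> by (simp add: relcocycles_iff)
  moreover have "?\<phi> (s j) = c j" if j: "j \<in> L - A" "d j = p" for j
  proof -
    have jn: "j \<le> n" using lower_le[OF L] j by blast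
    have "F (s j) = (\<Sum>i\<le>n. unit j i * c i)"
      by (rule F(3), unfold R_def, rule exI[of _ "unit j"])
         (use j in \<open>simp add: comb_unit[OF jn] supported_def, simp add: unit_def\<close>)
    also have "\<dots> = (\<Sum>i\<le>n. if i = j then c j else 0)"
      by (rule sum.cong) (auto simp: unit_def)
    also have "\<dots> = c j" using jn by simp
    finally show ?thesis
      using adapted_chains[OF L _ s, of j] j by (simp add: on_carrier_def)
  qed
  ultimately show "\<exists>\<phi>\<in>relcocycles p (Y L) (cells A). \<forall>j\<in>L - A. d j = p \<longrightarrow> \<phi> (s j) = c j"
    by blast
qed

end

section \<open>Vector spaces and graded modules\<close>

locale field_module =
  fixes V :: "('f::field, 'v) module" (structure)
  assumes module: "Module.module (type_ring :: 'f ring) V"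
begin

sublocale abelian_group V
  using module by (rule module.axioms)

lemma smult_closed [simp, intro]: "x \<in> carrier V \<Longrightarrow> a \<odot> x \<in> carrier V"
  and smult_add_left: "x \<in> carrier V \<Longrightarrow> (a + b) \<odot> x = a \<odot> x \<oplus> b \<odot> x"
  and smult_add_right: "x \<in> carrier V \<Longrightarrow> y \<in> carrier V \<Longrightarrow> a \<odot> (x \<oplus> y) = a \<odot> x \<oplus> a \<odot> y"
  and smult_smult: "x \<in> carrier V \<Longrightarrow> a \<odot> (b \<odot> x) = (a * b) \<odot> x"
  and smult_1 [simp]: "x \<in> carrier V \<Longrightarrow> 1 \<odot> x = x"
  and smult_0 [simp]: "x \<in> carrier V \<Longrightarrow> 0 \<odot> x = \<zero>"
  and smult_zero [simp]: "a \<odot> \<zero> = \<zero>"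
  using module.smult_closed[OF module] module.smult_l_distr[OF module] module.smult_r_distr[OF module]
    module.smult_assoc1[OF module] module.smult_one[OF module] module.smult_l_null[OF module] module.smult_r_null[OF module]
  by (auto simp: type_ring_def)

lemma add_neg [simp]: "x \<in> carrier V \<Longrightarrow> x \<oplus> (-1) \<odot> x = \<zero>"
  using smult_add_left[of x 1 "-1"] by simp

lemma neg_add [simp]: "x \<in> carrier V \<Longrightarrow> (-1) \<odot> x \<oplus> x = \<zero>"
  using add_neg[of x] a_comm[of x "(-1) \<odot> x"] by simp

end

lemma cring_type_ring: "cring (type_ring :: 'r::comm_ring_1 ring)"
proof (rule cringI)
  show "abelian_group (type_ring :: 'r ring)"
  proof (rule abelian_groupI)
    fix x :: 'r
    show "\<exists>y\<in>carrier type_ring. y \<oplus>\<^bsub>type_ring\<^esub> x = \<zero>\<^bsub>type_ring\<^esub>"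
      by (rule bexI[of _ "- x"]) (simp_all add: type_ring_def)
  qed (simp_all add: type_ring_def algebra_simps)
  show "Group.comm_monoid (type_ring :: 'r ring)"
    by (rule comm_monoidI) (simp_all add: type_ring_def algebra_simps)
qed (simp_all add: type_ring_def algebra_simps)

lemma field_moduleI:
  fixes V :: "('f::field, 'v) module" (structure)
  assumes "\<zero> \<in> carrier V" "\<And>x y. x \<in> carrier V \<Longrightarrow> y \<in> carrier V \<Longrightarrow> x \<oplus> y \<in> carrier V"
    "\<And>a x. x \<in> carrier V \<Longrightarrow> a \<odot> x \<in> carrier V"
    "\<And>x y z. x \<in> carrier V \<Longrightarrow> y \<in> carrier V \<Longrightarrow> z \<in> carrier V \<Longrightarrow> (x \<oplus> y) \<oplus> z = x \<oplus> (y \<oplus> z)"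
    "\<And>x y. x \<in> carrier V \<Longrightarrow> y \<in> carrier V \<Longrightarrow> x \<oplus> y = y \<oplus> x"
    "\<And>x. x \<in> carrier V \<Longrightarrow> \<zero> \<oplus> x = x"
    "\<And>x. x \<in> carrier V \<Longrightarrow> (-1) \<odot> x \<oplus> x = \<zero>"
    "\<And>a b x. x \<in> carrier V \<Longrightarrow> (a + b) \<odot> x = a \<odot> x \<oplus> b \<odot> x"
    "\<And>a x y. x \<in> carrier V \<Longrightarrow> y \<in> carrier V \<Longrightarrow> a \<odot> (x \<oplus> y) = a \<odot> x \<oplus> a \<odot> y"
    "\<And>a b x. x \<in> carrier V \<Longrightarrow> (a * b) \<odot> x = a \<odot> (b \<odot> x)"
    "\<And>x. x \<in> carrier V \<Longrightarrow> 1 \<odot> x = x"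
  shows "field_module V"
proof (rule field_module.intro)
  have "abelian_group V"
  proof (rule abelian_groupI)
    fix x assume "x \<in> carrier V"
    then show "\<exists>y\<in>carrier V. y \<oplus> x = \<zero>" using assms(3,7) by blast
  qed (auto intro: assms(1,2,4,5,6))
  then show "Module.module (type_ring :: 'f ring) V"
    by (rule moduleI[OF cring_type_ring]) (use assms in \<open>auto simp: type_ring_def\<close>)
qed

lemma linear_onI:
  assumes "\<And>x. x \<in> carrier V \<Longrightarrow> f x \<in> carrier W"
    "\<And>x y. x \<in> carrier V \<Longrightarrow> y \<in> carrier V \<Longrightarrow> f (x \<oplus>\<^bsub>V\<^esub> y) = f x \<oplus>\<^bsub>W\<^esub> f y"
    "\<And>a x. x \<in> carrier V \<Longrightarrow> f (a \<odot>\<^bsub>V\<^esub> x) = a \<odot>\<^bsub>W\<^esub> f x"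
  shows "linear_on V W f"
  using assms by (auto simp: linear_on_def)

lemma linear_on_closed: "linear_on V W f \<Longrightarrow> x \<in> carrier V \<Longrightarrow> f x \<in> carrier W"
  and linear_on_add: "linear_on V W f \<Longrightarrow> x \<in> carrier V \<Longrightarrow> y \<in> carrier V \<Longrightarrow> f (x \<oplus>\<^bsub>V\<^esub> y) = f x \<oplus>\<^bsub>W\<^esub> f y"
  and linear_on_smult: "linear_on V W f \<Longrightarrow> x \<in> carrier V \<Longrightarrow> f (a \<odot>\<^bsub>V\<^esub> x) = a \<odot>\<^bsub>W\<^esub> f x"
  by (auto simp: linear_on_def)

lemma linear_on_zero:
  assumes "field_module V" "field_module W" "linear_on V W f"
  shows "f \<zero>\<^bsub>V\<^esub> = \<zero>\<^bsub>W\<^esub>"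
proof -
  interpret V: field_module V by fact
  interpret W: field_module W by fact
  have "f (0 \<odot>\<^bsub>V\<^esub> \<zero>\<^bsub>V\<^esub>) = 0 \<odot>\<^bsub>W\<^esub> f \<zero>\<^bsub>V\<^esub>"
    by (rule linear_on_smult[OF assms(3)]) simp
  then show ?thesis using linear_on_closed[OF assms(3), of "\<zero>\<^bsub>V\<^esub>"] by simp
qed

lemma linear_on_finsum:
  assumes "field_module V" "field_module W" "linear_on V W f" "g \<in> A \<rightarrow> carrier V"
  shows "f (finsum V g A) = finsum W (\<lambda>i. f (g i)) A"
proof -
  interpret V: field_module V by fact
  interpret W: field_module W by fact
  show ?thesis using assms(4)
  proof (induction A rule: infinite_finite_induct)
    case (insert i A)
    then have "f (finsum V g (insert i A)) = f (g i \<oplus>\<^bsub>V\<^esub> finsum V g A)"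
      by (subst V.finsum_insert) auto
    also have "\<dots> = f (g i) \<oplus>\<^bsub>W\<^esub> f (finsum V g A)"
      by (rule linear_on_add[OF assms(3)]) (use insert in \<open>auto intro: V.finsum_closed\<close>)
    also have "\<dots> = finsum W (\<lambda>i. f (g i)) (insert i A)"
      using insert linear_on_closed[OF assms(3)] by (subst W.finsum_insert) (auto simp: Pi_iff)
    finally show ?case .
  qed (auto simp: linear_on_zero[OF assms(1-3)] V.finsum_infinite W.finsum_infinite)
qed

lemma graded_module_iff:
  "graded_module M \<longleftrightarrow> (\<forall>m. field_module (part M m) \<and> linear_on (part M m) (part M (m + 1)) (tact M m))"
  by (simp add: graded_module_def field_module_def)

lemma direct_sum_simps [simp]:
  "carrier (direct_sum V) = {x. (\<forall>i. x i \<in> carrier (V i)) \<and> finite {i. x i \<noteq> \<zero>\<^bsub>V i\<^esub>}}"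
  "\<zero>\<^bsub>direct_sum V\<^esub> = (\<lambda>i. \<zero>\<^bsub>V i\<^esub>)"
  "x \<oplus>\<^bsub>direct_sum V\<^esub> y = (\<lambda>i. x i \<oplus>\<^bsub>V i\<^esub> y i)"
  "a \<odot>\<^bsub>direct_sum V\<^esub> x = (\<lambda>i. a \<odot>\<^bsub>V i\<^esub> x i)"
  by (simp_all add: direct_sum_def vspace_def)

lemma field_module_direct_sum:
  assumes "\<And>i. field_module (V i)" shows "field_module (direct_sum V)"
proof -
  interpret V: field_module "V i" for i by fact
  show ?thesis
proof (rule field_moduleI)
  fix x y a
  show "\<zero>\<^bsub>direct_sum V\<^esub> \<in> carrier (direct_sum V)" by simp
  assume x: "x \<in> carrier (direct_sum V)"
  show "a \<odot>\<^bsub>direct_sum V\<^esub> x \<in> carrier (direct_sum V)"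
    using x by (auto elim!: rev_finite_subset)
  assume y: "y \<in> carrier (direct_sum V)"
  have "{i. x i \<oplus>\<^bsub>V i\<^esub> y i \<noteq> \<zero>\<^bsub>V i\<^esub>} \<subseteq> {i. x i \<noteq> \<zero>\<^bsub>V i\<^esub>} \<union> {i. y i \<noteq> \<zero>\<^bsub>V i\<^esub>}"
    by auto
  then show "x \<oplus>\<^bsub>direct_sum V\<^esub> y \<in> carrier (direct_sum V)"
    using x y finite_subset by auto
qed (auto simp: fun_eq_iff V.smult_add_left V.smult_add_right V.smult_smult V.a_ac)
qed

text \<open>The maps in the single degrees assemble to a map of the modules over \<open>F[t]\<close>. It is linear
  over polynomials because it commutes with \<open>t\<close>, hence with the powers of \<open>t\<close>, and is linear
  over \<open>F\<close>.\<close>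

lemma gmod_isoI:
  assumes M: "graded_module M" and N: "graded_module N"
    and lin: "\<And>m. linear_on (part M m) (part N m) (f m)"
    and bij: "\<And>m. bij_betw (f m) (carrier (part M m)) (carrier (part N m))"
    and tact: "\<And>m x. x \<in> carrier (part M m) \<Longrightarrow> f (m + 1) (tact M m x) = tact N m (f m x)"
  shows "M \<cong>\<^sub>g\<^sub>r N"
proof -
  interpret M: field_module "part M m" for m using M by (auto simp: graded_module_iff)
  interpret N: field_module "part N m" for m using N by (auto simp: graded_module_iff)
  have Mt: "linear_on (part M m) (part M (m + 1)) (tact M m)" for m using M by (auto simp: graded_module_iff)
  define F where "F = (\<lambda>x m. f m (x m))"
  have f0: "f m \<zero>\<^bsub>part M m\<^esub> = \<zero>\<^bsub>part N m\<^esub>" for m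
    by (rule linear_on_zero[OF M.field_module_axioms N.field_module_axioms lin])
  have f_eq0: "f m x = \<zero>\<^bsub>part N m\<^esub> \<longleftrightarrow> x = \<zero>\<^bsub>part M m\<^esub>" if "x \<in> carrier (part M m)" for m x
    using bij_betw_imp_inj_on[OF bij[of m]] that f0[of m] inj_onD[of "f m" _ x "\<zero>\<^bsub>part M m\<^esub>"] by auto
  have tot: "carrier (total M) = carrier (direct_sum (part M))" "carrier (total N) = carrier (direct_sum (part N))"
    by (simp_all add: total_def vspace_def)
  have pow: "tpow M k m x \<in> carrier (part M (m + int k)) \<and> f (m + int k) (tpow M k m x) = tpow N k m (f m x)"
    if "x \<in> carrier (part M m)" for k m x
  proof (induction k)
    case (Suc k)
    then have "tact M (m + int k) (tpow M k m x) \<in> carrier (part M (m + int k + 1))"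
      using linear_on_closed[OF Mt] by blast
    moreover have "m + int (Suc k) = m + int k + 1" by simp
    ultimately show ?case using Suc tact[of "tpow M k m x" "m + int k"]
      by (simp only: tpow.simps)
  qed (use that in simp)
  have pow': "tpow M k (m - int k) x \<in> carrier (part M m)" "f m (tpow M k (m - int k) x) = tpow N k (m - int k) (f (m - int k) x)"
    if "x \<in> carrier (part M (m - int k))" for k m x
    using pow[OF that, of k] by simp_all
  have F_carrier: "F x \<in> carrier (total N)" if "x \<in> carrier (total M)" for x
    using that linear_on_closed[OF lin] f0 unfolding tot
    by (auto simp: F_def elim!: rev_finite_subset)
  have F_lin: "linear_on (total M) (total N) F"
  proof (rule linear_onI)
    fix x y assume x: "x \<in> carrier (total M)" and y: "y \<in> carrier (total M)"
    then show "F (x \<oplus>\<^bsub>total M\<^esub> y) = F x \<oplus>\<^bsub>total N\<^esub> F y"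
      using linear_on_add[OF lin] unfolding tot by (auto simp: F_def total_def vspace_def fun_eq_iff)
  next
    fix p x assume x: "x \<in> carrier (total M)"
    then have xc: "x m \<in> carrier (part M m)" for m unfolding tot by simp
    show "F (p \<odot>\<^bsub>total M\<^esub> x) = p \<odot>\<^bsub>total N\<^esub> F x"
    proof
      fix m
      have t: "Polynomial.coeff p k \<odot>\<^bsub>part M m\<^esub> tpow M k (m - int k) (x (m - int k)) \<in> carrier (part M m)" for k
        using pow'(1)[OF xc] by blast
      have "F (p \<odot>\<^bsub>total M\<^esub> x) m = f m (\<Oplus>\<^bsub>part M m\<^esub>k\<in>{..Polynomial.degree p}.
        Polynomial.coeff p k \<odot>\<^bsub>part M m\<^esub> tpow M k (m - int k) (x (m - int k)))"
        by (simp add: F_def total_def vspace_def)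
      also have "\<dots> = (\<Oplus>\<^bsub>part N m\<^esub>k\<in>{..Polynomial.degree p}.
        f m (Polynomial.coeff p k \<odot>\<^bsub>part M m\<^esub> tpow M k (m - int k) (x (m - int k))))"
        by (rule linear_on_finsum[OF M.field_module_axioms N.field_module_axioms lin]) (use t in auto)
      also have "\<dots> = (\<Oplus>\<^bsub>part N m\<^esub>k\<in>{..Polynomial.degree p}.
        Polynomial.coeff p k \<odot>\<^bsub>part N m\<^esub> tpow N k (m - int k) (F x (m - int k)))"
        using linear_on_smult[OF lin pow'(1)[OF xc]] pow'(2)[OF xc] by (simp add: F_def)
      also have "\<dots> = (p \<odot>\<^bsub>total N\<^esub> F x) m"
        by (simp add: total_def vspace_def)
      finally show "F (p \<odot>\<^bsub>total M\<^esub> x) m = (p \<odot>\<^bsub>total N\<^esub> F x) m" .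
    qed
  qed (rule F_carrier)
  have preimage: "\<exists>x\<in>carrier (total M). F x = y" if y: "y \<in> carrier (total N)" for y
  proof -
    have yc: "y m \<in> f m ` carrier (part M m)" for m
      using y bij[of m] unfolding tot by (auto simp: bij_betw_def)
    define x where "x = (\<lambda>m. inv_into (carrier (part M m)) (f m) (y m))"
    have x: "x m \<in> carrier (part M m)" "f m (x m) = y m" for m
      unfolding x_def by (rule inv_into_into[OF yc], rule f_inv_into_f[OF yc])
    have "{m. x m \<noteq> \<zero>\<^bsub>part M m\<^esub>} = {m. y m \<noteq> \<zero>\<^bsub>part N m\<^esub>}"
      using f_eq0[OF x(1)] x(2) by auto
    then have "x \<in> carrier (total M)" using x(1) y unfolding tot by simp
    moreover have "F x = y" using x(2) by (auto simp: F_def)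
    ultimately show ?thesis by blast
  qed
  have inj: "inj_on F (carrier (total M))"
  proof (rule inj_onI)
    fix x y assume xy: "x \<in> carrier (total M)" "y \<in> carrier (total M)" "F x = F y"
    have "x m = y m" for m
      by (rule inj_onD[OF bij_betw_imp_inj_on[OF bij[of m]]])
         (use xy(1,2) fun_cong[OF xy(3), of m] in \<open>auto simp: F_def tot\<close>)
    then show "x = y" by blast
  qed
  have bijF: "bij_betw F (carrier (total M)) (carrier (total N))"
  proof (rule bij_betw_imageI[OF inj])
    show "F ` carrier (total M) = carrier (total N)"
    proof (intro equalityI subsetI)
      fix y assume "y \<in> carrier (total N)"
      then obtain x where "x \<in> carrier (total M)" "F x = y" using preimage[of y] by (auto simp del: direct_sum_simps)
      then show "y \<in> F ` carrier (total M)" by (metis imageI)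
    next
      fix y assume "y \<in> F ` carrier (total M)"
      then obtain x where "x \<in> carrier (total M)" "y = F x" by (rule imageE)
      then show "y \<in> carrier (total N)" using F_carrier by simp
    qed
  qed
  have "F ` homogeneous M m = homogeneous N m" for m
  proof
    show "F ` homogeneous M m \<subseteq> homogeneous N m"
      using F_carrier f0 by (auto simp: homogeneous_def F_def)
    show "homogeneous N m \<subseteq> F ` homogeneous M m"
    proof
      fix y assume y: "y \<in> homogeneous N m"
      then obtain x where x: "x \<in> carrier (total M)" "F x = y"
        using preimage by (auto simp: homogeneous_def)
      have "x k = \<zero>\<^bsub>part M k\<^esub>" if "k \<noteq> m" for k
      proof -
        have "x k \<in> carrier (part M k)" using x(1) unfolding tot by simp
        moreover have "f k (x k) = \<zero>\<^bsub>part N k\<^esub>" using y x(2) that by (auto simp: homogeneous_def F_def)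
        ultimately show ?thesis using f_eq0 by blast
      qed
      then show "y \<in> F ` homogeneous M m" using x by (auto simp: homogeneous_def)
    qed
  qed
  then show ?thesis unfolding gmod_iso_def using M N F_lin bijF by blast
qed

section \<open>Quotient spaces\<close>

definition submodule :: "('f::field, 'v) module \<Rightarrow> 'v set \<Rightarrow> bool" where
  "submodule V Z \<longleftrightarrow> Z \<subseteq> carrier V \<and> \<zero>\<^bsub>V\<^esub> \<in> Z \<and> (\<forall>x\<in>Z. \<forall>y\<in>Z. x \<oplus>\<^bsub>V\<^esub> y \<in> Z) \<and> (\<forall>a. \<forall>x\<in>Z. a \<odot>\<^bsub>V\<^esub> x \<in> Z)"

lemma submodule_subset: "submodule V Z \<Longrightarrow> x \<in> Z \<Longrightarrow> x \<in> carrier V"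
  and submodule_zero: "submodule V Z \<Longrightarrow> \<zero>\<^bsub>V\<^esub> \<in> Z"
  and submodule_add: "submodule V Z \<Longrightarrow> x \<in> Z \<Longrightarrow> y \<in> Z \<Longrightarrow> x \<oplus>\<^bsub>V\<^esub> y \<in> Z"
  and submodule_smult: "submodule V Z \<Longrightarrow> x \<in> Z \<Longrightarrow> a \<odot>\<^bsub>V\<^esub> x \<in> Z"
  by (auto simp: submodule_def)

context field_module
begin

lemma coset_member: "y \<in> B +> x \<longleftrightarrow> (\<exists>b\<in>B. y = b \<oplus> x)"
  by (auto simp: a_r_coset_def')

lemma coset_eq_iff:
  assumes B: "submodule V B" and x: "x \<in> carrier V" and y: "y \<in> carrier V"
  shows "B +> x = B +> y \<longleftrightarrow> x \<oplus> (-1) \<odot> y \<in> B"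
proof
  assume "B +> x = B +> y"
  moreover have "x \<in> B +> x"
    by (rule coset_member[THEN iffD2]) (use submodule_zero[OF B] x in \<open>auto intro: bexI[of _ \<zero>]\<close>)
  ultimately have "x \<in> B +> y" by simp
  then obtain b where b: "b \<in> B" "x = b \<oplus> y" unfolding coset_member by blast
  then have "x \<oplus> (-1) \<odot> y = b" using submodule_subset[OF B b(1)] y by (simp add: a_assoc)
  then show "x \<oplus> (-1) \<odot> y \<in> B" using b by simp
next
  assume xy: "x \<oplus> (-1) \<odot> y \<in> B"
  let ?c = "x \<oplus> (-1) \<odot> y"
  have xc: "x = ?c \<oplus> y" using x y by (simp add: a_assoc a_comm[of "(-1) \<odot> y" y])
  have yc: "y = (-1) \<odot> ?c \<oplus> x"
  proof -
    have "(-1) \<odot> ?c \<oplus> x = ((-1) \<odot> x \<oplus> y) \<oplus> x" using x y by (simp add: smult_add_right smult_smult)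
    also have "\<dots> = y \<oplus> (x \<oplus> (-1) \<odot> x)" using x y by (simp only: a_ac smult_closed a_closed)
    finally show ?thesis using x y by simp
  qed
  have sub: "B +> u \<subseteq> B +> v" if "u = c \<oplus> v" "c \<in> B" "v \<in> carrier V" for u v c
  proof
    fix w assume "w \<in> B +> u"
    then obtain b where b: "b \<in> B" "w = b \<oplus> u" unfolding coset_member by blast
    then have "w = (b \<oplus> c) \<oplus> v" using that submodule_subset[OF B] by (simp add: a_assoc)
    then show "w \<in> B +> v" unfolding coset_member using submodule_add[OF B b(1) that(2)] by blast
  qed
  show "B +> x = B +> y"
    using sub[OF xc xy y] sub[OF yc submodule_smult[OF B xy] x] by blast
qed

lemma coset_zero: "submodule V B \<Longrightarrow> B +> \<zero> = B"
  using submodule_subset[of V B] by (auto simp: a_r_coset_def')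

lemma coset_eq_subspace_iff:
  assumes "submodule V B" "x \<in> carrier V" shows "B +> x = B \<longleftrightarrow> x \<in> B"
  using coset_eq_iff[OF assms(1,2), of \<zero>] assms by (simp add: coset_zero)

lemma coset_add:
  assumes B: "submodule V B" and x: "x \<in> carrier V" and y: "y \<in> carrier V"
  shows "(B +> x) <+>\<^bsub>V\<^esub> (B +> y) = B +> (x \<oplus> y)"
proof
  show "(B +> x) <+>\<^bsub>V\<^esub> (B +> y) \<subseteq> B +> (x \<oplus> y)"
  proof
    fix w assume "w \<in> (B +> x) <+>\<^bsub>V\<^esub> (B +> y)"
    then obtain b c where bc: "b \<in> B" "c \<in> B" "w = (b \<oplus> x) \<oplus> (c \<oplus> y)"
      by (auto simp: set_add_def' coset_member)
    then have "w = (b \<oplus> c) \<oplus> (x \<oplus> y)"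
      using submodule_subset[OF B] x y by (simp add: a_ac)
    then show "w \<in> B +> (x \<oplus> y)" unfolding coset_member using submodule_add[OF B bc(1,2)] by blast
  qed
  show "B +> (x \<oplus> y) \<subseteq> (B +> x) <+>\<^bsub>V\<^esub> (B +> y)"
  proof
    fix w assume "w \<in> B +> (x \<oplus> y)"
    then obtain b where b: "b \<in> B" "w = b \<oplus> (x \<oplus> y)" unfolding coset_member by blast
    then have "w = (b \<oplus> x) \<oplus> (\<zero> \<oplus> y)" using submodule_subset[OF B] x y by (simp add: a_ac)
    then show "w \<in> (B +> x) <+>\<^bsub>V\<^esub> (B +> y)"
      unfolding set_add_def' using b(1) submodule_zero[OF B] by (fastforce simp: coset_member)
  qed
qed

end

lemma induced_coset:
  assumes V: "field_module V" and W: "field_module W" and B: "submodule V B" and B': "submodule W B'"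
    and add: "\<And>x y. x \<in> carrier V \<Longrightarrow> y \<in> carrier V \<Longrightarrow> f (x \<oplus>\<^bsub>V\<^esub> y) = f x \<oplus>\<^bsub>W\<^esub> f y"
    and closed: "\<And>x. x \<in> carrier V \<Longrightarrow> f x \<in> carrier W"
    and BB: "\<And>x. x \<in> B \<Longrightarrow> f x \<in> B'" and x: "x \<in> carrier V"
  shows "induced W B' f (B +>\<^bsub>V\<^esub> x) = B' +>\<^bsub>W\<^esub> f x"
proof -
  interpret V: field_module V by fact
  interpret W: field_module W by fact
  have "B' +>\<^bsub>W\<^esub> f u = B' +>\<^bsub>W\<^esub> f x" if "u \<in> B +>\<^bsub>V\<^esub> x" for u
  proof -
    obtain b where b: "b \<in> B" "u = b \<oplus>\<^bsub>V\<^esub> x" using \<open>u \<in> B +>\<^bsub>V\<^esub> x\<close> unfolding V.coset_member by blast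
    have bV: "b \<in> carrier V" using submodule_subset[OF B b(1)] .
    have "f u = f b \<oplus>\<^bsub>W\<^esub> f x" using b(2) add[OF bV x] by simp
    then have "f u \<oplus>\<^bsub>W\<^esub> (-1) \<odot>\<^bsub>W\<^esub> f x = f b"
      using closed[OF bV] closed[OF x] by (simp add: W.a_assoc)
    then show ?thesis using W.coset_eq_iff[OF B', of "f u" "f x"] BB[OF b(1)] closed[OF x] closed[OF bV] \<open>f u = _\<close> by simp
  qed
  moreover have "x \<in> B +>\<^bsub>V\<^esub> x"
    unfolding V.coset_member using submodule_zero[OF B] x by (intro bexI[of _ "\<zero>\<^bsub>V\<^esub>"]) simp_all
  ultimately show ?thesis unfolding induced_def by blast
qed

lemma quotient_simps [simp]:
  "carrier (quotient_space V Z B) = (\<lambda>z. B +>\<^bsub>V\<^esub> z) ` Z"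
  "\<zero>\<^bsub>quotient_space V Z B\<^esub> = B"
  "A \<oplus>\<^bsub>quotient_space V Z B\<^esub> A' = A <+>\<^bsub>V\<^esub> A'"
  "a \<odot>\<^bsub>quotient_space V Z B\<^esub> A = induced V B (\<lambda>x. a \<odot>\<^bsub>V\<^esub> x) A"
  by (simp_all add: quotient_space_def vspace_def)

lemma quotient_smult:
  assumes "field_module V" "submodule V B" "x \<in> carrier V"
  shows "induced V B (\<lambda>x. a \<odot>\<^bsub>V\<^esub> x) (B +>\<^bsub>V\<^esub> x) = B +>\<^bsub>V\<^esub> (a \<odot>\<^bsub>V\<^esub> x)"
proof -
  interpret V: field_module V by fact
  show ?thesis
    by (rule induced_coset) (use assms in \<open>auto simp: V.smult_add_right intro: submodule_smult\<close>)
qed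

lemma field_module_quotient:
  assumes V: "field_module V" and Z: "submodule V Z" and B: "submodule V B"
  shows "field_module (quotient_space V Z B)"
proof -
  interpret V: field_module V by fact
  have ZV: "z \<in> Z \<Longrightarrow> z \<in> carrier V" for z using submodule_subset[OF Z] .
  note S = ZV quotient_smult[OF V B] V.coset_add[OF B] submodule_add[OF Z] submodule_smult[OF Z]
  have z: "B +>\<^bsub>V\<^esub> \<zero>\<^bsub>V\<^esub> = B" by (rule V.coset_zero[OF B])
  have z': "B <+>\<^bsub>V\<^esub> (B +>\<^bsub>V\<^esub> x) = B +>\<^bsub>V\<^esub> x" if "x \<in> carrier V" for x
    using V.coset_add[OF B, of "\<zero>\<^bsub>V\<^esub>" x] that by (simp add: z)
  show ?thesis
  proof (rule field_moduleI)
    show "\<zero>\<^bsub>quotient_space V Z B\<^esub> \<in> carrier (quotient_space V Z B)"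
      using submodule_zero[OF Z] z by force
  next
    fix x assume "x \<in> carrier (quotient_space V Z B)"
    then obtain u where u: "u \<in> Z" "x = B +>\<^bsub>V\<^esub> u" by auto
    have "(-1) \<odot>\<^bsub>V\<^esub> u \<oplus>\<^bsub>V\<^esub> u = \<zero>\<^bsub>V\<^esub>" using V.a_comm[of "(-1) \<odot>\<^bsub>V\<^esub> u" u] u ZV by simp
    then show "(-1) \<odot>\<^bsub>quotient_space V Z B\<^esub> x \<oplus>\<^bsub>quotient_space V Z B\<^esub> x = \<zero>\<^bsub>quotient_space V Z B\<^esub>"
      using u by (simp add: S z)
  qed (auto simp: S z' V.a_ac V.smult_add_left V.smult_add_right V.smult_smult intro!: imageI)
qed

lemma linear_on_induced:
  assumes V: "field_module V" and W: "field_module W" and Z: "submodule V Z" and B: "submodule V B" and B': "submodule W B'"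
    and f: "linear_on V W f" and ZZ: "\<And>x. x \<in> Z \<Longrightarrow> f x \<in> Z'" and BB: "\<And>x. x \<in> B \<Longrightarrow> f x \<in> B'"
  shows "linear_on (quotient_space V Z B) (quotient_space W Z' B') (induced W B' f)"
proof -
  interpret V: field_module V by fact
  interpret W: field_module W by fact
  have ind: "induced W B' f (B +>\<^bsub>V\<^esub> x) = B' +>\<^bsub>W\<^esub> f x" if "x \<in> carrier V" for x
    by (rule induced_coset[OF V W B B' linear_on_add[OF f] linear_on_closed[OF f] BB that])
  note S = submodule_subset[OF Z] ind V.coset_add[OF B] W.coset_add[OF B'] quotient_smult[OF V B] quotient_smult[OF W B']
    linear_on_closed[OF f] linear_on_add[OF f] linear_on_smult[OF f]
  show ?thesis
    by (rule linear_onI) (auto simp: S intro!: imageI ZZ)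
qed


lemma linear_on_direct_sum:
  assumes "\<And>p. field_module (V p)" "\<And>p. field_module (W p)" "\<And>p. linear_on (V p) (W p) (g p)"
  shows "linear_on (direct_sum V) (direct_sum W) (\<lambda>x p. g p (x p))"
proof (rule linear_onI)
  fix x assume x: "x \<in> carrier (direct_sum V)"
  have "{p. g p (x p) \<noteq> \<zero>\<^bsub>W p\<^esub>} \<subseteq> {p. x p \<noteq> \<zero>\<^bsub>V p\<^esub>}"
    using linear_on_zero[OF assms] by auto
  then show "(\<lambda>p. g p (x p)) \<in> carrier (direct_sum W)"
    using x linear_on_closed[OF assms(3)] finite_subset by auto
qed (auto simp: fun_eq_iff linear_on_add[OF assms(3)] linear_on_smult[OF assms(3)])

text \<open>A relation between representatives, rather than a map, describes the isomorphism: it is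
  linear, defined everywhere on both sides, and relates boundaries exactly to boundaries. This
  suffices for a bijective linear map of the quotients, and it treats homology, where cellular
  chains map to singular chains, and cohomology, where singular cochains map to cellular
  cochains, in the same way. A family \<open>y\<close> represents an element of the direct sum if all but
  finitely many of its members are boundaries.\<close>

theorem gmod_iso_of_relation:
  fixes V :: "int \<Rightarrow> ('f::field, 'v) module" and W :: "int \<Rightarrow> nat \<Rightarrow> ('f, 'w) module"
    and R :: "int \<Rightarrow> 'v \<Rightarrow> (nat \<Rightarrow> 'w) \<Rightarrow> bool"
  assumes M: "\<And>m. part M m = quotient_space (V m) (Z m) (B m)"
      "\<And>m. tact M m = induced (V (m + 1)) (B (m + 1)) (\<tau> m)"
    and V: "\<And>m. field_module (V m)" "\<And>m. submodule (V m) (Z m)" "\<And>m. submodule (V m) (B m)"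
    and \<tau>: "\<And>m. linear_on (V m) (V (m + 1)) (\<tau> m)" "\<And>m x. x \<in> Z m \<Longrightarrow> \<tau> m x \<in> Z (m + 1)"
      "\<And>m x. x \<in> B m \<Longrightarrow> \<tau> m x \<in> B (m + 1)"
    and N: "\<And>m. part N m = direct_sum (\<lambda>p. quotient_space (W m p) (Z' m p) (B' m p))"
      "\<And>m x. tact N m x = (\<lambda>p. induced (W (m + 1) p) (B' (m + 1) p) (\<sigma> m p) (x p))"
    and W: "\<And>m p. field_module (W m p)" "\<And>m p. submodule (W m p) (Z' m p)" "\<And>m p. submodule (W m p) (B' m p)"
    and \<sigma>: "\<And>m p. linear_on (W m p) (W (m + 1) p) (\<sigma> m p)" "\<And>m p x. x \<in> Z' m p \<Longrightarrow> \<sigma> m p x \<in> Z' (m + 1) p"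
      "\<And>m p x. x \<in> B' m p \<Longrightarrow> \<sigma> m p x \<in> B' (m + 1) p"
    and R: "\<And>m x y. R m x y \<Longrightarrow> x \<in> Z m" "\<And>m x y p. R m x y \<Longrightarrow> y p \<in> Z' m p"
      "\<And>m x y. R m x y \<Longrightarrow> finite {p. y p \<notin> B' m p}"
    and R_add: "\<And>m x y x' y'. R m x y \<Longrightarrow> R m x' y' \<Longrightarrow> R m (x \<oplus>\<^bsub>V m\<^esub> x') (\<lambda>p. y p \<oplus>\<^bsub>W m p\<^esub> y' p)"
    and R_smult: "\<And>m x y a. R m x y \<Longrightarrow> R m (a \<odot>\<^bsub>V m\<^esub> x) (\<lambda>p. a \<odot>\<^bsub>W m p\<^esub> y p)"
    and R_total: "\<And>m x. x \<in> Z m \<Longrightarrow> \<exists>y. R m x y"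
    and R_surj: "\<And>m y. (\<And>p. y p \<in> Z' m p) \<Longrightarrow> finite {p. y p \<notin> B' m p} \<Longrightarrow> \<exists>x. R m x y"
    and R_boundary: "\<And>m x y. R m x y \<Longrightarrow> x \<in> B m \<longleftrightarrow> (\<forall>p. y p \<in> B' m p)"
    and R_tact: "\<And>m x y. R m x y \<Longrightarrow> R (m + 1) (\<tau> m x) (\<lambda>p. \<sigma> m p (y p))"
  shows "M \<cong>\<^sub>g\<^sub>r N"
proof -
  interpret V: field_module "V m" for m by (rule V)
  interpret W: field_module "W m p" for m p by (rule W)
  have ZV: "x \<in> Z m \<Longrightarrow> x \<in> carrier (V m)" for x m by (rule submodule_subset[OF V(2)])
  have ZW: "y \<in> Z' m p \<Longrightarrow> y \<in> carrier (W m p)" for y m p by (rule submodule_subset[OF W(2)])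
  define q where "q = (\<lambda>m x. B m +>\<^bsub>V m\<^esub> x)"
  define Q where "Q = (\<lambda>m (y :: nat \<Rightarrow> 'w) p. B' m p +>\<^bsub>W m p\<^esub> y p)"
  define f where "f = (\<lambda>m A. Q m (SOME y. \<exists>x. R m x y \<and> A = q m x))"
  \<comment> \<open>Linearity reduces equality of classes to the condition on boundaries, applied to the
    difference.\<close>
  have iff: "q m x = q m x' \<longleftrightarrow> Q m y = Q m y'" if xy: "R m x y" "R m x' y'" for m x y x' y'
  proof -
    have "q m x = q m x' \<longleftrightarrow> x \<oplus>\<^bsub>V m\<^esub> (-1) \<odot>\<^bsub>V m\<^esub> x' \<in> B m"
      unfolding q_def by (rule V.coset_eq_iff[OF V(3) ZV[OF R(1)[OF xy(1)]] ZV[OF R(1)[OF xy(2)]]])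
    also have "\<dots> \<longleftrightarrow> (\<forall>p. y p \<oplus>\<^bsub>W m p\<^esub> (-1) \<odot>\<^bsub>W m p\<^esub> y' p \<in> B' m p)"
      by (rule R_boundary[OF R_add[OF xy(1) R_smult[OF xy(2)]]])
    also have "\<dots> \<longleftrightarrow> (\<forall>p. B' m p +>\<^bsub>W m p\<^esub> y p = B' m p +>\<^bsub>W m p\<^esub> y' p)"
      using W.coset_eq_iff[OF W(3) ZW[OF R(2)[OF xy(1)]] ZW[OF R(2)[OF xy(2)]]] by simp
    finally show ?thesis by (simp add: Q_def fun_eq_iff)
  qed
  have f: "f m (q m x) = Q m y" if xy: "R m x y" for m x y
  proof -
    have "\<exists>y'. \<exists>x'. R m x' y' \<and> q m x = q m x'" using xy by blast
    from someI_ex[OF this] obtain x' where x': "R m x' (SOME y. \<exists>x'. R m x' y \<and> q m x = q m x')"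
      "q m x = q m x'" by blast
    then show ?thesis unfolding f_def using iff[OF x'(1) xy] by simp
  qed
  have carM: "A \<in> carrier (part M m) \<longleftrightarrow> (\<exists>x y. R m x y \<and> A = q m x)" for A m
    using R_total R(1) unfolding M quotient_simps q_def by blast
  have QN: "Q m y \<in> carrier (part N m)" if xy: "R m x y" for m x y
  proof -
    have "{p. Q m y p \<noteq> B' m p} = {p. y p \<notin> B' m p}"
      unfolding Q_def using W.coset_eq_subspace_iff[OF W(3) ZW[OF R(2)[OF xy]]] by simp
    then show ?thesis using R(2,3)[OF xy] by (auto simp: N Q_def)
  qed
  have gM: "graded_module M"
    unfolding graded_module_iff M
    using field_module_quotient[OF V] linear_on_induced[OF V(1,1,2,3,3) \<tau>] by blast
  have gN: "graded_module N"
    unfolding graded_module_iff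
  proof (intro allI conjI)
    fix m
    show "field_module (part N m)"
      unfolding N by (intro field_module_direct_sum field_module_quotient W)
    have t: "tact N m = (\<lambda>x p. induced (W (m + 1) p) (B' (m + 1) p) (\<sigma> m p) (x p))"
      by (rule ext) (rule N)
    show "linear_on (part N m) (part N (m + 1)) (tact N m)"
      unfolding t N(1)
      by (intro linear_on_direct_sum field_module_quotient W linear_on_induced[OF W(1,1,2,3,3) \<sigma>])
  qed
  show ?thesis
  proof (rule gmod_isoI[OF gM gN])
    fix m
    show "linear_on (part M m) (part N m) (f m)"
    proof (rule linear_onI)
      fix A assume "A \<in> carrier (part M m)"
      then obtain x y where xy: "R m x y" "A = q m x" unfolding carM by blast
      then show "f m A \<in> carrier (part N m)" using QN f by simp
      fix a
      have "a \<odot>\<^bsub>part M m\<^esub> A = q m (a \<odot>\<^bsub>V m\<^esub> x)"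
        unfolding xy(2) q_def M quotient_simps by (rule quotient_smult[OF V(1,3) ZV[OF R(1)[OF xy(1)]]])
      then have "f m (a \<odot>\<^bsub>part M m\<^esub> A) = Q m (\<lambda>p. a \<odot>\<^bsub>W m p\<^esub> y p)"
        using f[OF R_smult[OF xy(1)]] by simp
      also have "\<dots> = a \<odot>\<^bsub>part N m\<^esub> Q m y"
        unfolding Q_def N direct_sum_simps quotient_simps
        by (rule ext) (rule quotient_smult[OF W(1,3) ZW[OF R(2)[OF xy(1)]], symmetric])
      finally show "f m (a \<odot>\<^bsub>part M m\<^esub> A) = a \<odot>\<^bsub>part N m\<^esub> f m A"
        using f[OF xy(1)] xy(2) by simp
    next
      fix A A' assume "A \<in> carrier (part M m)" "A' \<in> carrier (part M m)"
      then obtain x y x' y' where xy: "R m x y" "A = q m x" "R m x' y'" "A' = q m x'" unfolding carM by blast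
      have "A \<oplus>\<^bsub>part M m\<^esub> A' = q m (x \<oplus>\<^bsub>V m\<^esub> x')"
        unfolding xy(2,4) q_def M quotient_simps
        by (rule V.coset_add[OF V(3) ZV[OF R(1)[OF xy(1)]] ZV[OF R(1)[OF xy(3)]]])
      then have "f m (A \<oplus>\<^bsub>part M m\<^esub> A') = Q m (\<lambda>p. y p \<oplus>\<^bsub>W m p\<^esub> y' p)"
        using f[OF R_add[OF xy(1,3)]] by simp
      also have "\<dots> = Q m y \<oplus>\<^bsub>part N m\<^esub> Q m y'"
        unfolding Q_def N direct_sum_simps quotient_simps
        by (rule ext) (rule W.coset_add[OF W(3) ZW[OF R(2)[OF xy(1)]] ZW[OF R(2)[OF xy(3)]], symmetric])
      finally show "f m (A \<oplus>\<^bsub>part M m\<^esub> A') = f m A \<oplus>\<^bsub>part N m\<^esub> f m A'"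
        using f[OF xy(1)] f[OF xy(3)] xy(2,4) by simp
    qed
    show "bij_betw (f m) (carrier (part M m)) (carrier (part N m))"
    proof (rule bij_betw_imageI)
      show "inj_on (f m) (carrier (part M m))"
      proof (rule inj_onI)
        fix A A' assume "A \<in> carrier (part M m)" "A' \<in> carrier (part M m)" and eq: "f m A = f m A'"
        then obtain x y x' y' where xy: "R m x y" "A = q m x" "R m x' y'" "A' = q m x'" unfolding carM by blast
        then have "Q m y = Q m y'" using eq f[OF xy(1)] f[OF xy(3)] by simp
        then show "A = A'" using iff[OF xy(1,3)] xy(2,4) by simp
      qed
      show "f m ` carrier (part M m) = carrier (part N m)"
      proof (intro equalityI subsetI)
        fix g assume "g \<in> f m ` carrier (part M m)"
        then obtain A where "A \<in> carrier (part M m)" "g = f m A" by (rule imageE)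
        then obtain x y where "R m x y" "g = f m (q m x)" using carM[of A m] by blast
        then show "g \<in> carrier (part N m)" using QN f by simp
      next
        fix g assume g: "g \<in> carrier (part N m)"
        then have "\<forall>p. \<exists>u. u \<in> Z' m p \<and> g p = B' m p +>\<^bsub>W m p\<^esub> u" unfolding N by auto
        then obtain y where y: "\<And>p. y p \<in> Z' m p" "\<And>p. g p = B' m p +>\<^bsub>W m p\<^esub> y p" by metis
        have "{p. y p \<notin> B' m p} = {p. g p \<noteq> B' m p}"
          using W.coset_eq_subspace_iff[OF W(3) ZW[OF y(1)]] by (simp add: y(2))
        then have "finite {p. y p \<notin> B' m p}" using g unfolding N by simp
        then obtain x where x: "R m x y" using R_surj y(1) by blast
        have "g = f m (q m x)" unfolding f[OF x] Q_def using y(2) by blast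
        moreover have "q m x \<in> carrier (part M m)" using carM[of "q m x" m] x by blast
        ultimately show "g \<in> f m ` carrier (part M m)" by (rule image_eqI)
      qed
    qed
    fix A assume A: "A \<in> carrier (part M m)"
    then obtain x y where xy: "R m x y" "A = q m x" unfolding carM by blast
    have "tact M m A = q (m + 1) (\<tau> m x)"
      unfolding xy(2) q_def M
      by (rule induced_coset[OF V(1,1,3,3) linear_on_add[OF \<tau>(1)] linear_on_closed[OF \<tau>(1)] \<tau>(3) ZV[OF R(1)[OF xy(1)]]])
    then have "f (m + 1) (tact M m A) = Q (m + 1) (\<lambda>p. \<sigma> m p (y p))"
      using f[OF R_tact[OF xy(1)]] by simp
    also have "\<dots> = tact N m (Q m y)"
      unfolding N Q_def
      by (rule ext)
         (rule induced_coset[OF W(1,1,3,3) linear_on_add[OF \<sigma>(1)] linear_on_closed[OF \<sigma>(1)] \<sigma>(3) ZW[OF R(2)[OF xy(1)]], symmetric])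
    finally show "f (m + 1) (tact M m A) = tact N m (f m A)"
      using f[OF xy(1)] xy(2) by simp
  qed
qed

section \<open>Chains and cochains as vector spaces\<close>

lemma vspace_simps [simp]:
  "carrier (vspace S z pl sc) = S" "\<zero>\<^bsub>vspace S z pl sc\<^esub> = z"
  "x \<oplus>\<^bsub>vspace S z pl sc\<^esub> y = pl x y" "a \<odot>\<^bsub>vspace S z pl sc\<^esub> x = sc a x"
  by (simp_all add: vspace_def)

lemma fchains_simps [simp]:
  "\<zero>\<^bsub>fchains p X\<^esub> = 0" "x \<oplus>\<^bsub>fchains p X\<^esub> y = x + y" "a \<odot>\<^bsub>fchains p X\<^esub> x = scale_chain a x"
  by (simp_all add: fchains_def)

lemma field_module_fchains: "field_module (fchains p X)"
  by (rule field_moduleI)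
     (simp_all add: chains_add chains_scale algebra_simps fch.scale_right_distrib fch.scale_left_distrib)

lemma submodule_fchains:
  assumes "fch.subspace S" "S \<subseteq> chains p X" shows "submodule (fchains p X) S"
  using assms by (auto simp: submodule_def fch.subspace_0 fch.subspace_add fch.subspace_scale)

lemma relboundaries_subset_chains: "relboundaries p X S \<subseteq> chains p X"
  by (rule order.trans[OF relboundaries_subset_relcycles]) (auto simp: relcycles_iff)

lemma submodule_relcycles: "submodule (fchains p X) (relcycles p X S)"
  by (rule submodule_fchains[OF subspace_relcycles]) (auto simp: relcycles_iff)

lemma submodule_relboundaries: "submodule (fchains p X) (relboundaries p X S)"
  by (rule submodule_fchains[OF subspace_relboundaries relboundaries_subset_chains])

lemma dual_space_simps [simp]:
  "\<zero>\<^bsub>dual_space V\<^esub> = (\<lambda>x. 0)" "\<phi> \<oplus>\<^bsub>dual_space V\<^esub> \<psi> = (\<lambda>x. \<phi> x + \<psi> x)" "a \<odot>\<^bsub>dual_space V\<^esub> \<phi> = (\<lambda>x. a * \<phi> x)"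
  by (simp_all add: dual_space_def)

lemma dual_space_carrier:
  "\<phi> \<in> carrier (dual_space V) \<longleftrightarrow>
    (\<forall>x\<in>carrier V. \<forall>y\<in>carrier V. \<phi> (x \<oplus>\<^bsub>V\<^esub> y) = \<phi> x + \<phi> y) \<and> (\<forall>a. \<forall>x\<in>carrier V. \<phi> (a \<odot>\<^bsub>V\<^esub> x) = a * \<phi> x)
    \<and> (\<forall>x. x \<notin> carrier V \<longrightarrow> \<phi> x = 0)"
  by (simp add: dual_space_def linear_on_def base_field_def)

lemma field_module_dual_space: "field_module (dual_space V)"
  by (rule field_moduleI) (auto simp: dual_space_carrier algebra_simps)

lemma submodule_relcocycles: "submodule (dual_space (fchains p X)) (relcocycles p X S)"
proof -
  have "\<phi> \<in> carrier (dual_space (fchains p X))" if "\<phi> \<in> relcocycles p X S" for \<phi>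
    using that by (simp add: relcocycles_iff)
  moreover have "(\<lambda>x. 0) \<in> relcocycles p X S"
    by (simp add: relcocycles_iff dual_space_carrier)
  moreover have "(\<lambda>x. \<phi> x + \<psi> x) \<in> relcocycles p X S" if "\<phi> \<in> relcocycles p X S" "\<psi> \<in> relcocycles p X S" for \<phi> \<psi>
    using that by (auto simp: relcocycles_iff dual_space_carrier algebra_simps)
  moreover have "(\<lambda>x. a * \<phi> x) \<in> relcocycles p X S" if "\<phi> \<in> relcocycles p X S" for a \<phi>
    using that by (auto simp: relcocycles_iff dual_space_carrier algebra_simps)
  ultimately show ?thesis by (auto simp: submodule_def)
qed

lemma relcochains_zero: "(\<lambda>x. 0) \<in> relcochains p X S"
  and relcochains_add: "\<phi> \<in> relcochains p X S \<Longrightarrow> \<psi> \<in> relcochains p X S \<Longrightarrow> (\<lambda>x. \<phi> x + \<psi> x) \<in> relcochains p X S"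
  and relcochains_scale: "\<phi> \<in> relcochains p X S \<Longrightarrow> (\<lambda>x. a * \<phi> x) \<in> relcochains p X S"
  by (auto simp: relcochains_iff dual_space_carrier algebra_simps)

lemma coboundary_dual:
  fixes \<phi> :: "('a, 'f::field) fcochain"
  assumes "\<phi> \<in> carrier (dual_space (fchains p X))"
  shows "coboundary p X \<phi> \<in> carrier (dual_space (fchains (Suc p) X))"
proof -
  have "fboundary (Suc p) x \<in> chains p X" if "x \<in> chains (Suc p) X" for x :: "('a, 'f) fchain"
    using fboundary_chains[OF that] by simp
  then show ?thesis using assms
    by (auto simp: dual_space_carrier coboundary_def on_carrier_def fboundary_add fboundary_scale chains_add chains_scale)
qed

lemma submodule_relcoboundaries:
  fixes X :: "'a topology"
  shows "submodule (dual_space (fchains p X)) (relcoboundaries p X S :: ('a, 'b::field) fcochain set)"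
proof (cases p)
  case 0
  then show ?thesis by (simp add: submodule_def relcoboundaries_def dual_space_carrier)
next
  case (Suc q)
  have 0: "(\<lambda>x. 0) = coboundary q X (\<lambda>x. 0)"
    by (simp add: coboundary_def on_carrier_def fun_eq_iff)
  have add: "(\<lambda>x. coboundary q X \<phi> x + coboundary q X \<psi> x) = coboundary q X (\<lambda>x. \<phi> x + \<psi> x)" for \<phi> \<psi> :: "('a, 'b) fcochain"
    by (simp add: coboundary_def on_carrier_def fun_eq_iff)
  have scale: "(\<lambda>x. a * coboundary q X \<phi> x) = coboundary q X (\<lambda>x. a * \<phi> x)" for a and \<phi> :: "('a, 'b) fcochain"
    by (simp add: coboundary_def on_carrier_def fun_eq_iff)
  show ?thesis
    unfolding submodule_def dual_space_simps
  proof (intro conjI ballI allI)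
    show "relcoboundaries p X S \<subseteq> carrier (dual_space (fchains p X))"
      using coboundary_dual by (auto simp: Suc relcoboundaries_def relcochains_iff)
    show "(\<lambda>x. 0) \<in> relcoboundaries p X S"
      unfolding Suc relcoboundaries_def using 0 relcochains_zero[of q X S] by auto
  next
    fix \<phi> \<psi> :: "('a, 'b) fcochain" assume "\<phi> \<in> relcoboundaries p X S" "\<psi> \<in> relcoboundaries p X S"
    then show "(\<lambda>x. \<phi> x + \<psi> x) \<in> relcoboundaries p X S"
      unfolding Suc relcoboundaries_def using relcochains_add[of _ q X S] by (auto simp: add intro!: imageI)
  next
    fix a and \<phi> :: "('a, 'b) fcochain" assume "\<phi> \<in> relcoboundaries p X S"
    then show "(\<lambda>x. a * \<phi> x) \<in> relcoboundaries p X S"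
      unfolding Suc relcoboundaries_def using relcochains_scale[of _ q X S] by (auto simp: scale intro!: imageI)
  qed
qed

section \<open>Complexes with coordinates indexed by cells\<close>

text \<open>All four complexes are described in the same way: the part of degree \<open>m\<close> is identified by
  \<open>\<kappa> m\<close> with the functions on a set \<open>J m\<close> of cells, extended by 0 to all cells; \<open>t\<close> restricts a
  function to the cells of the next degree, and the boundary is the restriction of an operator
  \<open>T\<close> that does not depend on the degree.\<close>

locale cellular_coordinates = cw_complex K \<iota>
  for K :: "'a cw_data" and \<iota> :: "nat \<Rightarrow> (nat \<Rightarrow> real, 'f::field) fchain" +
  fixes C :: "('f, 'v) gmod" and D :: "int \<Rightarrow> 'v \<Rightarrow> 'v" and J :: "int \<Rightarrow> nat set"
    and T :: "(nat \<Rightarrow> 'f) \<Rightarrow> nat \<Rightarrow> 'f" and \<kappa> :: "int \<Rightarrow> 'v \<Rightarrow> nat \<Rightarrow> 'f"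
  assumes graded: "graded_module C"
    and D_linear: "linear_on (part C m) (part C m) (D m)"
    and J_bound: "J m \<subseteq> {..n}"
    and \<kappa>_add: "x \<in> carrier (part C m) \<Longrightarrow> y \<in> carrier (part C m) \<Longrightarrow> \<kappa> m (x \<oplus>\<^bsub>part C m\<^esub> y) = (\<lambda>i. \<kappa> m x i + \<kappa> m y i)"
    and \<kappa>_smult: "x \<in> carrier (part C m) \<Longrightarrow> \<kappa> m (a \<odot>\<^bsub>part C m\<^esub> x) = (\<lambda>i. a * \<kappa> m x i)"
    and \<kappa>_supported: "x \<in> carrier (part C m) \<Longrightarrow> supported (J m) (\<kappa> m x)"
    and \<kappa>_inj: "x \<in> carrier (part C m) \<Longrightarrow> y \<in> carrier (part C m) \<Longrightarrow> \<kappa> m x = \<kappa> m y \<Longrightarrow> x = y"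
    and \<kappa>_surj: "supported (J m) c \<Longrightarrow> \<exists>x\<in>carrier (part C m). \<kappa> m x = c"
    and \<kappa>_D: "x \<in> carrier (part C m) \<Longrightarrow> \<kappa> m (D m x) = cut (J m) (T (\<kappa> m x))"
    and \<kappa>_tact: "x \<in> carrier (part C m) \<Longrightarrow> \<kappa> (m + 1) (tact C m x) = cut (J (m + 1)) (\<kappa> m x)"
begin

lemma field_module_part: "field_module (part C m)"
  and tact_linear: "linear_on (part C m) (part C (m + 1)) (tact C m)"
  using graded by (auto simp: graded_module_iff)

lemma \<kappa>_zero: "\<kappa> m \<zero>\<^bsub>part C m\<^esub> = (\<lambda>i. 0)"
proof -
  interpret field_module "part C m" by (rule field_module_part)
  show ?thesis using \<kappa>_smult[of "\<zero>\<^bsub>part C m\<^esub>" m 0] by simp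
qed

lemma cycle_iff:
  assumes x: "x \<in> carrier (part C m)"
  shows "D m x = \<zero>\<^bsub>part C m\<^esub> \<longleftrightarrow> (\<forall>i\<in>J m. T (\<kappa> m x) i = 0)"
proof -
  interpret field_module "part C m" by (rule field_module_part)
  have "D m x = \<zero>\<^bsub>part C m\<^esub> \<longleftrightarrow> \<kappa> m (D m x) = \<kappa> m \<zero>\<^bsub>part C m\<^esub>"
    using \<kappa>_inj[OF linear_on_closed[OF D_linear x], of "\<zero>\<^bsub>part C m\<^esub>"] by auto
  also have "\<dots> \<longleftrightarrow> (\<forall>i\<in>J m. T (\<kappa> m x) i = 0)"
    by (auto simp: \<kappa>_D[OF x] \<kappa>_zero cut_def fun_eq_iff)
  finally show ?thesis .
qed

lemma boundary_iff:
  assumes x: "x \<in> carrier (part C m)"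
  shows "x \<in> D m ` carrier (part C m) \<longleftrightarrow> (\<exists>c. supported (J m) c \<and> \<kappa> m x = cut (J m) (T c))"
proof
  assume "x \<in> D m ` carrier (part C m)"
  then obtain u where "u \<in> carrier (part C m)" "x = D m u" by blast
  then show "\<exists>c. supported (J m) c \<and> \<kappa> m x = cut (J m) (T c)"
    using \<kappa>_D \<kappa>_supported by blast
next
  assume "\<exists>c. supported (J m) c \<and> \<kappa> m x = cut (J m) (T c)"
  then obtain c where c: "supported (J m) c" "\<kappa> m x = cut (J m) (T c)" by blast
  obtain u where u: "u \<in> carrier (part C m)" "\<kappa> m u = c" using \<kappa>_surj[OF c(1)] by blast
  have "x = D m u"
    by (rule \<kappa>_inj[OF x linear_on_closed[OF D_linear u(1)]]) (simp add: \<kappa>_D[OF u(1)] u(2) c(2))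
  then show "x \<in> D m ` carrier (part C m)" using u(1) by blast
qed

text \<open>In coordinates, cycles are the functions on which \<open>T\<close> vanishes on \<open>J m\<close> and boundaries are
  the restrictions of values of \<open>T\<close>. The relation \<open>P\<close> between such functions and families of
  representatives of all dimensions is the comparison with singular theory. The first assumption
  says that restriction to the cells of the next degree is a chain map.\<close>

theorem coordinate_iso:
  fixes W :: "int \<Rightarrow> nat \<Rightarrow> ('f, 'w) module" and P :: "int \<Rightarrow> (nat \<Rightarrow> 'f) \<Rightarrow> (nat \<Rightarrow> 'w) \<Rightarrow> bool"
  assumes T_cut: "\<And>m c i. supported (J m) c \<Longrightarrow> i \<in> J (m + 1) \<Longrightarrow> T (cut (J (m + 1)) c) i = cut (J m) (T c) i"
    and N: "\<And>m. part N m = direct_sum (\<lambda>p. quotient_space (W m p) (Z' m p) (B' m p))"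
      "\<And>m x. tact N m x = (\<lambda>p. induced (W (m + 1) p) (B' (m + 1) p) (\<sigma> m p) (x p))"
    and W: "\<And>m p. field_module (W m p)" "\<And>m p. submodule (W m p) (Z' m p)" "\<And>m p. submodule (W m p) (B' m p)"
    and \<sigma>: "\<And>m p. linear_on (W m p) (W (m + 1) p) (\<sigma> m p)" "\<And>m p x. x \<in> Z' m p \<Longrightarrow> \<sigma> m p x \<in> Z' (m + 1) p"
      "\<And>m p x. x \<in> B' m p \<Longrightarrow> \<sigma> m p x \<in> B' (m + 1) p"
    and P_add: "\<And>m c y c' y'. (\<And>p. y p \<in> Z' m p) \<Longrightarrow> (\<And>p. y' p \<in> Z' m p) \<Longrightarrow> P m c y \<Longrightarrow> P m c' y' \<Longrightarrow>
        P m (\<lambda>i. c i + c' i) (\<lambda>p. y p \<oplus>\<^bsub>W m p\<^esub> y' p)"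
    and P_smult: "\<And>m c y a. (\<And>p. y p \<in> Z' m p) \<Longrightarrow> P m c y \<Longrightarrow> P m (\<lambda>i. a * c i) (\<lambda>p. a \<odot>\<^bsub>W m p\<^esub> y p)"
    and P_total: "\<And>m c. supported (J m) c \<Longrightarrow> (\<And>i. i \<in> J m \<Longrightarrow> T c i = 0) \<Longrightarrow>
        \<exists>y. (\<forall>p. y p \<in> Z' m p) \<and> finite {p. y p \<notin> B' m p} \<and> P m c y"
    and P_surj: "\<And>m y. (\<And>p. y p \<in> Z' m p) \<Longrightarrow> \<exists>c. supported (J m) c \<and> (\<forall>i\<in>J m. T c i = 0) \<and> P m c y"
    and P_boundary: "\<And>m c y. supported (J m) c \<Longrightarrow> (\<And>i. i \<in> J m \<Longrightarrow> T c i = 0) \<Longrightarrow> (\<And>p. y p \<in> Z' m p) \<Longrightarrow> P m c y \<Longrightarrow>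
        (\<exists>c'. supported (J m) c' \<and> c = cut (J m) (T c')) \<longleftrightarrow> (\<forall>p. y p \<in> B' m p)"
    and P_tact: "\<And>m c y. supported (J m) c \<Longrightarrow> (\<And>p. y p \<in> Z' m p) \<Longrightarrow> P m c y \<Longrightarrow> P (m + 1) (cut (J (m + 1)) c) (\<lambda>p. \<sigma> m p (y p))"
  shows "complex_homology C D \<cong>\<^sub>g\<^sub>r N"
proof -
  interpret C: field_module "part C m" for m by (rule field_module_part)
  interpret W: field_module "W m p" for m p by (rule W)
  let ?Z = "\<lambda>m. {x \<in> carrier (part C m). D m x = \<zero>\<^bsub>part C m\<^esub>}"
  let ?B = "\<lambda>m. D m ` carrier (part C m)"
  let ?R = "\<lambda>m x y. x \<in> ?Z m \<and> (\<forall>p. y p \<in> Z' m p) \<and> finite {p. y p \<notin> B' m p} \<and> P m (\<kappa> m x) y"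
  have D0: "D m \<zero>\<^bsub>part C m\<^esub> = \<zero>\<^bsub>part C m\<^esub>" for m
    by (rule linear_on_zero[OF C.field_module_axioms C.field_module_axioms D_linear])
  have Z: "submodule (part C m) (?Z m)" for m
    unfolding submodule_def by (auto simp: D0 linear_on_add[OF D_linear] linear_on_smult[OF D_linear])
  have B: "submodule (part C m) (?B m)" for m
    unfolding submodule_def
  proof (intro conjI ballI allI)
    show "?B m \<subseteq> carrier (part C m)" using linear_on_closed[OF D_linear] by blast
    show "\<zero>\<^bsub>part C m\<^esub> \<in> ?B m" using D0[of m] by (metis C.zero_closed imageI)
  next
    fix x y assume "x \<in> ?B m" "y \<in> ?B m"
    then obtain u v where "u \<in> carrier (part C m)" "x = D m u" "v \<in> carrier (part C m)" "y = D m v" by blast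
    then show "x \<oplus>\<^bsub>part C m\<^esub> y \<in> ?B m"
      using linear_on_add[OF D_linear] by (intro image_eqI[of _ _ "u \<oplus>\<^bsub>part C m\<^esub> v"]) auto
  next
    fix a x assume "x \<in> ?B m"
    then obtain u where "u \<in> carrier (part C m)" "x = D m u" by blast
    then show "a \<odot>\<^bsub>part C m\<^esub> x \<in> ?B m"
      using linear_on_smult[OF D_linear] by (intro image_eqI[of _ _ "a \<odot>\<^bsub>part C m\<^esub> u"]) auto
  qed
  have tc: "tact C m x \<in> carrier (part C (m + 1))" if "x \<in> carrier (part C m)" for m x
    using linear_on_closed[OF tact_linear that] .
  have \<tau>Z: "tact C m x \<in> ?Z (m + 1)" if "x \<in> ?Z m" for m x
  proof -
    have x: "x \<in> carrier (part C m)" and T0: "\<forall>i\<in>J m. T (\<kappa> m x) i = 0"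
      using that cycle_iff by auto
    have "T (\<kappa> (m + 1) (tact C m x)) i = 0" if i: "i \<in> J (m + 1)" for i
      using T_cut[OF \<kappa>_supported[OF x] i] T0 by (simp add: \<kappa>_tact[OF x] cut_def)
    then show ?thesis using cycle_iff[OF tc[OF x]] tc[OF x] by simp
  qed
  have \<tau>B: "tact C m x \<in> ?B (m + 1)" if xB: "x \<in> ?B m" for m x
  proof -
    have x: "x \<in> carrier (part C m)" using xB submodule_subset[OF B] by blast
    obtain c where c: "supported (J m) c" "\<kappa> m x = cut (J m) (T c)" using xB boundary_iff[OF x] by blast
    have "\<kappa> (m + 1) (tact C m x) = cut (J (m + 1)) (T (cut (J (m + 1)) c))"
      using T_cut[OF c(1)] by (auto simp: \<kappa>_tact[OF x] c(2) fun_eq_iff) (simp add: cut_def)+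
    then show ?thesis using boundary_iff[OF tc[OF x]] supported_cut by blast
  qed
  have Z_iff: "x \<in> ?Z m \<longleftrightarrow> x \<in> carrier (part C m) \<and> (\<forall>i\<in>J m. T (\<kappa> m x) i = 0)" for m x
    using cycle_iff by auto
  show ?thesis
  proof (rule gmod_iso_of_relation[where V = "part C" and Z = ?Z and B = ?B and \<tau> = "tact C" and W = W and Z' = Z' and B' = B'
        and \<sigma> = \<sigma> and R = ?R, OF _ _ field_module_part Z B tact_linear \<tau>Z \<tau>B N W \<sigma>])
    show "part (complex_homology C D) m = quotient_space (part C m) (?Z m) (?B m)" for m
      by (simp add: complex_homology_def Let_def)
    show "tact (complex_homology C D) m = induced (part C (m + 1)) (?B (m + 1)) (tact C m)" for m
      by (simp add: complex_homology_def Let_def)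
    show "x \<in> ?Z m" "y p \<in> Z' m p" "finite {p. y p \<notin> B' m p}" if "?R m x y" for m x y p
      using that by blast+
  next
    fix m x y x' y' assume xy: "?R m x y" "?R m x' y'"
    have "{p. y p \<oplus>\<^bsub>W m p\<^esub> y' p \<notin> B' m p} \<subseteq> {p. y p \<notin> B' m p} \<union> {p. y' p \<notin> B' m p}"
      using submodule_add[OF W(3)] by blast
    moreover have "finite ({p. y p \<notin> B' m p} \<union> {p. y' p \<notin> B' m p})" using xy by blast
    ultimately have "finite {p. y p \<oplus>\<^bsub>W m p\<^esub> y' p \<notin> B' m p}" by (rule finite_subset)
    moreover have "P m (\<kappa> m (x \<oplus>\<^bsub>part C m\<^esub> x')) (\<lambda>p. y p \<oplus>\<^bsub>W m p\<^esub> y' p)"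
      using P_add[of y m y' "\<kappa> m x" "\<kappa> m x'"] xy \<kappa>_add by simp
    ultimately show "?R m (x \<oplus>\<^bsub>part C m\<^esub> x') (\<lambda>p. y p \<oplus>\<^bsub>W m p\<^esub> y' p)"
      using submodule_add[OF Z] submodule_add[OF W(2)] xy by blast
  next
    fix m x y a assume xy: "?R m x y"
    have "{p. a \<odot>\<^bsub>W m p\<^esub> y p \<notin> B' m p} \<subseteq> {p. y p \<notin> B' m p}"
      using submodule_smult[OF W(3)] by blast
    moreover have "finite {p. y p \<notin> B' m p}" using xy by blast
    ultimately have "finite {p. a \<odot>\<^bsub>W m p\<^esub> y p \<notin> B' m p}" by (rule finite_subset)
    moreover have "P m (\<kappa> m (a \<odot>\<^bsub>part C m\<^esub> x)) (\<lambda>p. a \<odot>\<^bsub>W m p\<^esub> y p)"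
      using P_smult[of y m "\<kappa> m x" a] xy \<kappa>_smult by simp
    ultimately show "?R m (a \<odot>\<^bsub>part C m\<^esub> x) (\<lambda>p. a \<odot>\<^bsub>W m p\<^esub> y p)"
      using submodule_smult[OF Z] submodule_smult[OF W(2)] xy by blast
  next
    fix m x assume x: "x \<in> ?Z m"
    then have "x \<in> carrier (part C m)" "\<And>i. i \<in> J m \<Longrightarrow> T (\<kappa> m x) i = 0" using Z_iff by blast+
    from P_total[OF \<kappa>_supported[OF this(1)] this(2)] x show "\<exists>y. ?R m x y" by blast
  next
    fix m y assume y: "\<And>p. y p \<in> Z' m p" "finite {p. y p \<notin> B' m p}"
    obtain c where c: "supported (J m) c" "\<forall>i\<in>J m. T c i = 0" "P m c y" using P_surj[OF y(1)] by blast
    obtain x where "x \<in> carrier (part C m)" "\<kappa> m x = c" using \<kappa>_surj[OF c(1)] by blast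
    then show "\<exists>x. ?R m x y" using c y Z_iff by blast
  next
    fix m x y assume xy: "?R m x y"
    then have x: "x \<in> carrier (part C m)" "\<And>i. i \<in> J m \<Longrightarrow> T (\<kappa> m x) i = 0" using Z_iff by blast+
    show "x \<in> ?B m \<longleftrightarrow> (\<forall>p. y p \<in> B' m p)"
      unfolding boundary_iff[OF x(1)] using P_boundary[OF \<kappa>_supported[OF x(1)] x(2), of y] xy by blast
  next
    fix m x y assume xy: "?R m x y"
    then have x: "x \<in> carrier (part C m)" by blast
    have "{p. \<sigma> m p (y p) \<notin> B' (m + 1) p} \<subseteq> {p. y p \<notin> B' m p}" using \<sigma>(3) by blast
    moreover have "finite {p. y p \<notin> B' m p}" using xy by blast
    ultimately have "finite {p. \<sigma> m p (y p) \<notin> B' (m + 1) p}" by (rule finite_subset)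
    moreover have "P (m + 1) (\<kappa> (m + 1) (tact C m x)) (\<lambda>p. \<sigma> m p (y p))"
      using P_tact[OF \<kappa>_supported[OF x], of y] xy \<kappa>_tact[OF x] by simp
    moreover have "tact C m x \<in> ?Z (m + 1)" using xy \<tau>Z by blast
    ultimately show "?R (m + 1) (tact C m x) (\<lambda>p. \<sigma> m p (y p))"
      using \<sigma>(2) xy by blast
  qed
qed

text \<open>The basis of the part of degree \<open>m\<close> that the coordinates belong to; a functional on this
  part has its values on the basis as dual coordinates.\<close>

definition basis :: "int \<Rightarrow> nat \<Rightarrow> 'v" where
  "basis m j = (SOME x. x \<in> carrier (part C m) \<and> \<kappa> m x = unit j)"

lemma basis:
  assumes "j \<in> J m" shows "basis m j \<in> carrier (part C m)" "\<kappa> m (basis m j) = unit j"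
proof -
  have "supported (J m) (unit j)" using assms by (simp add: supported_def unit_def)
  then have "\<exists>x. x \<in> carrier (part C m) \<and> \<kappa> m x = unit j" using \<kappa>_surj by blast
  from someI_ex[OF this] show "basis m j \<in> carrier (part C m)" "\<kappa> m (basis m j) = unit j"
    unfolding basis_def by blast+
qed

definition dual_\<kappa> :: "int \<Rightarrow> ('v \<Rightarrow> 'f) \<Rightarrow> nat \<Rightarrow> 'f" where
  "dual_\<kappa> m \<phi> j = (if j \<in> J (- m) then \<phi> (basis (- m) j) else 0)"

lemma functional_eq:
  assumes \<phi>: "\<phi> \<in> carrier (dual_space (part C (- m)))" and x: "x \<in> carrier (part C (- m))"
  shows "\<phi> x = (\<Sum>j\<le>n. dual_\<kappa> m \<phi> j * \<kappa> (- m) x j)"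
proof -
  interpret field_module "part C (- m)" by (rule field_module_part)
  have add: "\<phi> (u \<oplus>\<^bsub>part C (- m)\<^esub> v) = \<phi> u + \<phi> v" and smult: "\<phi> (a \<odot>\<^bsub>part C (- m)\<^esub> u) = a * \<phi> u"
    if "u \<in> carrier (part C (- m))" "v \<in> carrier (part C (- m))" for u v a
    using \<phi> that by (auto simp: dual_space_carrier)
  have "\<phi> x = (\<Sum>j\<in>F. dual_\<kappa> m \<phi> j * \<kappa> (- m) x j)"
    if "finite F" "x \<in> carrier (part C (- m))" "supported F (\<kappa> (- m) x)" "F \<subseteq> J (- m)" for F x
    using that
  proof (induction F arbitrary: x rule: finite_induct)
    case empty
    then have "\<kappa> (- m) x = \<kappa> (- m) \<zero>\<^bsub>part C (- m)\<^esub>" by (auto simp: \<kappa>_zero supported_def)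
    then have "x = \<zero>\<^bsub>part C (- m)\<^esub>" using \<kappa>_inj[OF empty(1)] by simp
    then show ?case using smult[of "\<zero>\<^bsub>part C (- m)\<^esub>" "\<zero>\<^bsub>part C (- m)\<^esub>" 0] by simp
  next
    case (insert j F)
    have j: "j \<in> J (- m)" using insert.prems by blast
    note b = basis[OF j]
    let ?a = "- \<kappa> (- m) x j"
    define x' where "x' = x \<oplus>\<^bsub>part C (- m)\<^esub> ?a \<odot>\<^bsub>part C (- m)\<^esub> basis (- m) j"
    have x': "x' \<in> carrier (part C (- m))" using insert.prems(1) b(1) by (simp add: x'_def)
    have \<kappa>x': "\<kappa> (- m) x' = (\<lambda>i. \<kappa> (- m) x i + ?a * unit j i)"
      unfolding x'_def using insert.prems(1) b by (simp add: \<kappa>_add \<kappa>_smult)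
    have "supported F (\<kappa> (- m) x')"
      using insert.prems(2) by (auto simp: \<kappa>x' supported_def unit_def split: if_splits)
    from insert.IH[OF x' this] insert.prems(3)
    have "\<phi> x' = (\<Sum>i\<in>F. dual_\<kappa> m \<phi> i * \<kappa> (- m) x' i)" by blast
    also have "\<dots> = (\<Sum>i\<in>F. dual_\<kappa> m \<phi> i * \<kappa> (- m) x i)"
      by (rule sum.cong) (use insert.hyps in \<open>auto simp: \<kappa>x' unit_def\<close>)
    finally have "\<phi> x' = (\<Sum>i\<in>F. dual_\<kappa> m \<phi> i * \<kappa> (- m) x i)" .
    moreover have "\<phi> x' = \<phi> x + ?a * \<phi> (basis (- m) j)"
      unfolding x'_def using insert.prems(1) b(1) by (simp add: add smult)
    ultimately show ?case
      using insert.hyps j by (simp add: dual_\<kappa>_def algebra_simps)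
  qed
  from this[OF _ x \<kappa>_supported[OF x] subset_refl] J_bound[of "- m"]
  have "\<phi> x = (\<Sum>j\<in>J (- m). dual_\<kappa> m \<phi> j * \<kappa> (- m) x j)" using finite_subset by blast
  also have "\<dots> = (\<Sum>j\<le>n. dual_\<kappa> m \<phi> j * \<kappa> (- m) x j)"
    by (rule sum.mono_neutral_left) (use J_bound in \<open>auto simp: dual_\<kappa>_def\<close>)
  finally show ?thesis .
qed

text \<open>Composition with the boundary is given in the dual basis by the transposed matrix, and
  composition with \<open>t\<close>, which sends a basis vector to a basis vector or to 0, is again a
  restriction.\<close>

theorem dual_coordinates:
  assumes T: "\<And>c i. T c i = (\<Sum>j\<le>n. A i j * c j)"
  shows "cellular_coordinates K \<iota> (pdual C) (pdual_map C D) (\<lambda>m. J (- m)) (\<lambda>c i. \<Sum>j\<le>n. A j i * c j) dual_\<kappa>"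
proof -
  interpret C: field_module "part C m" for m by (rule field_module_part)
  have part: "part (pdual C) m = dual_space (part C (- m))" for m by (simp add: pdual_def)
  have tact: "tact (pdual C) m \<phi> = on_carrier (part C (- (m + 1))) (\<lambda>x. \<phi> (tact C (- (m + 1)) x))" for m \<phi>
    by (simp add: pdual_def)
  have tc: "tact C (- (m + 1)) x \<in> carrier (part C (- m))" "\<kappa> (- m) (tact C (- (m + 1)) x) = cut (J (- m)) (\<kappa> (- (m + 1)) x)"
    if "x \<in> carrier (part C (- (m + 1)))" for x m
    using linear_on_closed[OF tact_linear that] \<kappa>_tact[OF that] by (simp_all add: add.commute)
  have tlin: "linear_on (part C (- (m + 1))) (part C (- m)) (tact C (- (m + 1)))" for m
    using tact_linear[of "- (m + 1)"] by (simp add: add.commute)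
  show ?thesis
  proof (unfold_locales)
    show "graded_module (pdual C)"
      unfolding graded_module_iff part
    proof (intro allI conjI field_module_dual_space)
      fix m
      show "linear_on (dual_space (part C (- m))) (dual_space (part C (- (m + 1)))) (tact (pdual C) m)"
      proof (rule linear_onI)
        fix \<phi> assume \<phi>: "\<phi> \<in> carrier (dual_space (part C (- m)))"
        show "tact (pdual C) m \<phi> \<in> carrier (dual_space (part C (- (m + 1))))"
          using \<phi> linear_on_closed[OF tlin] unfolding tact
          by (simp add: dual_space_carrier on_carrier_def linear_on_add[OF tlin] linear_on_smult[OF tlin] del: minus_add_distrib)
      qed (auto simp: tact on_carrier_def fun_eq_iff)
    qed
    fix m
    show "linear_on (part (pdual C) m) (part (pdual C) m) (pdual_map C D m)"
      unfolding part
    proof (rule linear_onI)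
      fix \<phi> assume \<phi>: "\<phi> \<in> carrier (dual_space (part C (- m)))"
      show "pdual_map C D m \<phi> \<in> carrier (dual_space (part C (- m)))"
        using \<phi> linear_on_closed[OF D_linear]
        by (simp add: pdual_map_def dual_space_carrier on_carrier_def linear_on_add[OF D_linear] linear_on_smult[OF D_linear])
    qed (auto simp: pdual_map_def on_carrier_def fun_eq_iff)
    show "J (- m) \<subseteq> {..n}" by (rule J_bound)
    fix \<phi> assume \<phi>: "\<phi> \<in> carrier (part (pdual C) m)"
    note \<phi>' = \<phi>[unfolded part]
    show "supported (J (- m)) (dual_\<kappa> m \<phi>)" by (simp add: supported_def dual_\<kappa>_def)
    show "dual_\<kappa> m (a \<odot>\<^bsub>part (pdual C) m\<^esub> \<phi>) = (\<lambda>i. a * dual_\<kappa> m \<phi> i)" for a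
      by (simp add: part dual_\<kappa>_def fun_eq_iff)
    show "dual_\<kappa> m (pdual_map C D m \<phi>) = cut (J (- m)) (\<lambda>i. \<Sum>j\<le>n. A j i * dual_\<kappa> m \<phi> j)"
    proof
      fix i
      show "dual_\<kappa> m (pdual_map C D m \<phi>) i = cut (J (- m)) (\<lambda>i. \<Sum>j\<le>n. A j i * dual_\<kappa> m \<phi> j) i"
      proof (cases "i \<in> J (- m)")
        case True
        note b = basis[OF True]
        have i: "i \<le> n" using True J_bound by blast
        have Tu: "T (unit i) j = A j i" for j
          unfolding T using i by (simp add: unit_def if_distrib cong: if_cong)
        have "dual_\<kappa> m (pdual_map C D m \<phi>) i = \<phi> (D (- m) (basis (- m) i))"
          using True b by (simp add: dual_\<kappa>_def pdual_map_def on_carrier_def)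
        also have "\<dots> = (\<Sum>j\<le>n. dual_\<kappa> m \<phi> j * \<kappa> (- m) (D (- m) (basis (- m) i)) j)"
          by (rule functional_eq[OF \<phi>' linear_on_closed[OF D_linear b(1)]])
        also have "\<dots> = (\<Sum>j\<le>n. A j i * dual_\<kappa> m \<phi> j)"
          by (rule sum.cong) (auto simp: \<kappa>_D[OF b(1)] b(2) Tu cut_def dual_\<kappa>_def)
        finally show ?thesis using True by (simp add: cut_def)
      qed (simp add: cut_def dual_\<kappa>_def)
    qed
    show "dual_\<kappa> (m + 1) (tact (pdual C) m \<phi>) = cut (J (- (m + 1))) (dual_\<kappa> m \<phi>)"
    proof
      fix j
      show "dual_\<kappa> (m + 1) (tact (pdual C) m \<phi>) j = cut (J (- (m + 1))) (dual_\<kappa> m \<phi>) j"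
      proof (cases "j \<in> J (- (m + 1))")
        case True
        note b = basis[OF True]
        have j: "j \<le> n" using True J_bound by blast
        have "dual_\<kappa> (m + 1) (tact (pdual C) m \<phi>) j = \<phi> (tact C (- (m + 1)) (basis (- (m + 1)) j))"
          using True b unfolding dual_\<kappa>_def tact on_carrier_def by (simp only: if_True)
        also have "\<dots> = (\<Sum>i\<le>n. dual_\<kappa> m \<phi> i * \<kappa> (- m) (tact C (- (m + 1)) (basis (- (m + 1)) j)) i)"
          by (rule functional_eq[OF \<phi>' tc(1)[OF b(1)]])
        also have "\<dots> = (\<Sum>i\<le>n. if i = j then dual_\<kappa> m \<phi> j else 0)"
          unfolding tc(2)[OF b(1)] b(2)
          by (rule sum.cong) (auto simp: cut_def unit_def dual_\<kappa>_def)
        also have "\<dots> = dual_\<kappa> m \<phi> j" using j by simp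
        finally show ?thesis using True by (simp add: cut_def)
      next
        case False
        then show ?thesis unfolding cut_def dual_\<kappa>_def by (simp only: if_False)
      qed
    qed
    fix \<psi> assume \<psi>: "\<psi> \<in> carrier (part (pdual C) m)"
    note \<psi>' = \<psi>[unfolded part]
    show "dual_\<kappa> m (\<phi> \<oplus>\<^bsub>part (pdual C) m\<^esub> \<psi>) = (\<lambda>i. dual_\<kappa> m \<phi> i + dual_\<kappa> m \<psi> i)"
      by (simp add: part dual_\<kappa>_def fun_eq_iff)
    assume eq: "dual_\<kappa> m \<phi> = dual_\<kappa> m \<psi>"
    show "\<phi> = \<psi>"
    proof
      fix x show "\<phi> x = \<psi> x"
        using functional_eq[OF \<phi>', of x] functional_eq[OF \<psi>', of x] eq \<phi>' \<psi>'
        by (cases "x \<in> carrier (part C (- m))") (auto simp: dual_space_carrier)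
    qed
  next
    fix m c assume c: "supported (J (- m)) c"
    define \<phi> where "\<phi> = on_carrier (part C (- m)) (\<lambda>x. \<Sum>j\<le>n. c j * \<kappa> (- m) x j)"
    have "\<phi> \<in> carrier (part (pdual C) m)"
      unfolding part by (auto simp: \<phi>_def dual_space_carrier on_carrier_def \<kappa>_add \<kappa>_smult algebra_simps sum.distrib sum_distrib_left)
    moreover have "dual_\<kappa> m \<phi> = c"
    proof
      fix j show "dual_\<kappa> m \<phi> j = c j"
      proof (cases "j \<in> J (- m)")
        case True
        have j: "j \<le> n" using True J_bound by blast
        have "(\<Sum>i\<le>n. c i * unit j i) = c j"
          using j by (simp add: unit_def if_distrib cong: if_cong)
        then show ?thesis using True basis[OF True] by (simp add: dual_\<kappa>_def \<phi>_def on_carrier_def)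
      next
        case False
        then show ?thesis using c by (auto simp: dual_\<kappa>_def supported_def)
      qed
    qed
    ultimately show "\<exists>x\<in>carrier (part (pdual C) m). dual_\<kappa> m x = c" by blast
  qed
qed

end


section \<open>Coordinates on the cellular complex and its global dual\<close>

context cw_complex
begin

definition first_cells :: "int \<Rightarrow> nat set" where
  "first_cells m = {j. j \<le> n \<and> int j \<le> m}"

abbreviation CC :: "('f, nat \<Rightarrow> 'f) gmod" where "CC \<equiv> cell_complex K"

lemma part_cell_complex:
  "carrier (part CC m) = {c. supported (first_cells m) c}"
  "\<zero>\<^bsub>part CC m\<^esub> = (\<lambda>j. 0)"
  "c \<oplus>\<^bsub>part CC m\<^esub> c' = (\<lambda>j. c j + c' j)"
  "a \<odot>\<^bsub>part CC m\<^esub> c = (\<lambda>j. a * c j)"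
  by (simp_all add: cell_complex_def supported_def first_cells_def)

lemma supported_scale: "supported J c \<Longrightarrow> supported J (\<lambda>j. a * c j)"
  by (auto simp: supported_def)

lemma supported_zero: "supported J (\<lambda>j. 0)"
  by (simp add: supported_def)

lemma supported_mono: "supported J c \<Longrightarrow> J \<subseteq> J' \<Longrightarrow> supported J' c"
  by (auto simp: supported_def)

lemma cut_supported: "supported J c \<Longrightarrow> cut J c = c"
  by (auto simp: supported_def cut_def fun_eq_iff)

lemma lower_first_cells: "lower (first_cells m)"
  by (auto simp: lower_def first_cells_def)

lemma first_cells_mono: "m \<le> m' \<Longrightarrow> first_cells m \<subseteq> first_cells m'"
  by (auto simp: first_cells_def)

lemma first_cells_le: "first_cells m \<subseteq> {..n}"
  by (auto simp: first_cells_def)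

lemma stage_set_cells: "stage_set K m = cells (first_cells m)"
  by (simp add: stage_set_def cells_def first_cells_def)

lemma stage_Y: "stage K m = Y (first_cells m)"
  by (simp add: stage_def stage_set_cells)

lemma cell_boundary_bd: "cell_boundary K \<iota> m = bd"
  by (simp add: cell_boundary_def bd_def fun_eq_iff)

lemma tact_cell_complex: "tact CC m c = c"
  by (simp add: cell_complex_def)

end

locale adapted_cw_complex = cw_complex K \<iota>
  for K :: "'a cw_data" and \<iota> :: "nat \<Rightarrow> (nat \<Rightarrow> real, 'f::field) fchain" +
  fixes s :: "nat \<Rightarrow> ('a, 'f) fchain"
  assumes adapted_s: "j \<le> n \<Longrightarrow> adapted s j"
begin

lemma coeff_nonzero: "coeff i j \<noteq> 0 \<Longrightarrow> j \<le> n \<Longrightarrow> i < j \<and> Suc (d i) = d j"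
  using adapted_coeff[OF adapted_s] by blast

lemma lower_adapted: "lower L \<Longrightarrow> j \<in> L \<Longrightarrow> adapted s j"
  using adapted_s lower_le by blast

lemma supported_bd_lower:
  assumes "lower L" "supported L c" shows "supported L (bd c)"
  using bd_outside_lower[OF assms(1) lower_adapted[OF assms(1)] assms(2)] by (auto simp: supported_def)

lemma field_module_cell_complex: "field_module (part CC m)"
  by (rule field_moduleI) (auto simp: part_cell_complex supported_add supported_scale supported_zero algebra_simps)

lemma cell_complex_coordinates:
  "cellular_coordinates K \<iota> CC (cell_boundary K \<iota>) first_cells bd (\<lambda>m c. c)"
proof unfold_locales
  show "graded_module CC"
    unfolding graded_module_iff
    by (auto simp: field_module_cell_complex linear_on_def part_cell_complex tact_cell_complex
        intro: supported_mono[OF _ first_cells_mono])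
  fix m
  show "linear_on (part CC m) (part CC m) (cell_boundary K \<iota> m)"
    by (auto simp: linear_on_def part_cell_complex cell_boundary_bd supported_bd_lower[OF lower_first_cells]
        bd_add bd_scale fun_eq_iff)
  show "first_cells m \<subseteq> {..n}" by (auto simp: first_cells_def)
  show "cell_boundary K \<iota> m x = cut (first_cells m) (bd x)" if "x \<in> carrier (part CC m)" for x
    using that cut_supported[OF supported_bd_lower[OF lower_first_cells]] by (simp add: part_cell_complex cell_boundary_bd)
  show "tact CC m x = cut (first_cells (m + 1)) x" if "x \<in> carrier (part CC m)" for x
    using that cut_supported[OF supported_mono[OF _ first_cells_mono[of m "m + 1"]]]
    by (simp add: part_cell_complex tact_cell_complex)
qed (auto simp: part_cell_complex)

definition last_cells :: "int \<Rightarrow> nat set" where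
  "last_cells m = {j. j \<le> n \<and> m \<le> int j}"

text \<open>A homomorphism \<open>\<psi>\<close> of degree \<open>m\<close> sends the generator \<open>\<sigma> j\<close> of degree \<open>j\<close> to a multiple of
  \<open>t\<^sup>j\<^sup>+\<^sup>m\<close>, and its coordinate at \<open>j\<close> is the coefficient. For \<open>j + m < 0\<close> the polynomial is 0
  and the cell \<open>j\<close> has no coordinate; there \<open>nat\<close> would wrongly read off the constant
  coefficient.\<close>

definition gdual_\<kappa> :: "int \<Rightarrow> (int \<Rightarrow> (nat \<Rightarrow> 'f) \<Rightarrow> 'f poly) \<Rightarrow> nat \<Rightarrow> 'f" where
  "gdual_\<kappa> m \<psi> j = (if j \<in> last_cells (- m) then Polynomial.coeff (\<psi> (int j) (unit j)) (nat (int j + m)) else 0)"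

lemma part_poly_gmod:
  "carrier (part poly_gmod i) = {p. \<forall>l. Polynomial.coeff p l \<noteq> 0 \<longrightarrow> int l = i}"
  "\<zero>\<^bsub>part poly_gmod i\<^esub> = (0 :: 'f poly)"
  "p \<oplus>\<^bsub>part poly_gmod i\<^esub> q = (p + q :: 'f poly)"
  "a \<odot>\<^bsub>part poly_gmod i\<^esub> p = Polynomial.smult (a :: 'f) p"
  by (simp_all add: poly_gmod_def)

lemma gdual_carrier:
  "\<psi> \<in> carrier (part (gdual CC) m) \<longleftrightarrow>
    (\<forall>k x. supported (first_cells k) x \<longrightarrow> (\<forall>l. Polynomial.coeff (\<psi> k x) l \<noteq> 0 \<longrightarrow> int l = k + m))
    \<and> (\<forall>k x y. supported (first_cells k) x \<longrightarrow> supported (first_cells k) y \<longrightarrow> \<psi> k (\<lambda>j. x j + y j) = \<psi> k x + \<psi> k y)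
    \<and> (\<forall>k a x. supported (first_cells k) x \<longrightarrow> \<psi> k (\<lambda>j. a * x j) = Polynomial.smult a (\<psi> k x))
    \<and> (\<forall>k x. supported (first_cells k) x \<longrightarrow> \<psi> (k + 1) x = pCons 0 (\<psi> k x))
    \<and> (\<forall>k x. \<not> supported (first_cells k) x \<longrightarrow> \<psi> k x = 0)"
proof -
  have t: "tact poly_gmod i p = pCons 0 p" for i and p :: "'f poly" by (simp add: poly_gmod_def)
  show ?thesis
    unfolding gdual_def gmod.simps vspace_simps mem_Collect_eq linear_on_def part_cell_complex part_poly_gmod tact_cell_complex t
    by (auto simp: Pi_iff)
qed

lemma gdual_degree: "\<psi> \<in> carrier (part (gdual CC) m) \<Longrightarrow> supported (first_cells k) x
    \<Longrightarrow> Polynomial.coeff (\<psi> k x) l \<noteq> 0 \<Longrightarrow> int l = k + m"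
  and gdual_add: "\<psi> \<in> carrier (part (gdual CC) m) \<Longrightarrow> supported (first_cells k) x
    \<Longrightarrow> supported (first_cells k) y \<Longrightarrow> \<psi> k (\<lambda>j. x j + y j) = \<psi> k x + \<psi> k y"
  and gdual_smult: "\<psi> \<in> carrier (part (gdual CC) m) \<Longrightarrow> supported (first_cells k) x
    \<Longrightarrow> \<psi> k (\<lambda>j. a * x j) = Polynomial.smult a (\<psi> k x)"
  and gdual_shift: "\<psi> \<in> carrier (part (gdual CC) m) \<Longrightarrow> supported (first_cells k) x
    \<Longrightarrow> \<psi> (k + 1) x = pCons 0 (\<psi> k x)"
  and gdual_outside: "\<psi> \<in> carrier (part (gdual CC) m) \<Longrightarrow> \<not> supported (first_cells k) x
    \<Longrightarrow> \<psi> k x = 0"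
  unfolding gdual_carrier by blast+

lemma gdual_simps:
  "\<zero>\<^bsub>part (gdual CC) m\<^esub> = (\<lambda>k x. 0)"
  "\<psi> \<oplus>\<^bsub>part (gdual CC) m\<^esub> \<psi>' = (\<lambda>k x. \<psi> k x + \<psi>' k x)"
  "a \<odot>\<^bsub>part (gdual CC) m\<^esub> \<psi> = (\<lambda>k x. Polynomial.smult a (\<psi> k x))"
  "tact (gdual CC) m \<psi> = (\<lambda>k x. pCons 0 (\<psi> k x))"
  by (simp_all add: gdual_def)

lemma gdual_unit:
  assumes \<psi>: "\<psi> \<in> carrier (part (gdual CC) m)" and j: "j \<in> first_cells k"
  shows "\<psi> k (unit j) = Polynomial.monom (gdual_\<kappa> m \<psi> j) (nat (k + m))"
proof -
  have jn: "j \<le> n" and jk: "int j \<le> k" using j by (auto simp: first_cells_def)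
  have supp: "supported (first_cells k) (unit j)" if "int j \<le> k" for k
    using jn that by (auto simp: supported_def first_cells_def unit_def)
  have shift: "\<psi> (k + 1) (unit j) = pCons 0 (\<psi> k (unit j))" if "int j \<le> k" for k
    by (rule gdual_shift[OF \<psi> supp[OF that]])
  show ?thesis
    using jk
  proof (induction k rule: int_ge_induct)
    case base
    \<comment> \<open>In the degree \<open>j\<close>, where the generator is born, the formula is the definition of the
      coordinate.\<close>
    have deg: "int l = int j + m" if "Polynomial.coeff (\<psi> (int j) (unit j)) l \<noteq> 0" for l
      by (rule gdual_degree[OF \<psi> supp that]) simp
    show ?case
    proof (rule poly_eqI)
      fix l
      show "Polynomial.coeff (\<psi> (int j) (unit j)) l = Polynomial.coeff (Polynomial.monom (gdual_\<kappa> m \<psi> j) (nat (int j + m))) l"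
        using deg[of l] jn
        by (cases "Polynomial.coeff (\<psi> (int j) (unit j)) l = 0") (auto simp: gdual_\<kappa>_def last_cells_def)
    qed
  next
    case (step k)
    have "\<psi> (k + 1) (unit j) = pCons 0 (Polynomial.monom (gdual_\<kappa> m \<psi> j) (nat (k + m)))"
      using shift[OF step(1)] step(2) by simp
    also have "\<dots> = Polynomial.monom (gdual_\<kappa> m \<psi> j) (nat (k + 1 + m))"
    proof (cases "0 \<le> k + m")
      case True
      then have "nat (k + 1 + m) = Suc (nat (k + m))" by simp
      then show ?thesis by (simp add: monom_Suc)
    next
      case False
      \<comment> \<open>As \<open>j \<le> k\<close>, the cell \<open>j\<close> then has negative \<open>j + m\<close>.\<close>
      then have "gdual_\<kappa> m \<psi> j = 0" using step(1) by (auto simp: gdual_\<kappa>_def last_cells_def)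
      then show ?thesis by simp
    qed
    finally show ?case .
  qed
qed

lemma gdual_eq:
  assumes \<psi>: "\<psi> \<in> carrier (part (gdual CC) m)" and x: "supported (first_cells k) x"
  shows "\<psi> k x = Polynomial.monom (\<Sum>j\<le>n. gdual_\<kappa> m \<psi> j * x j) (nat (k + m))"
proof -
  have add: "\<psi> k (\<lambda>j. u j + v j) = \<psi> k u + \<psi> k v" and smult: "\<psi> k (\<lambda>j. a * u j) = Polynomial.smult a (\<psi> k u)"
    if "supported (first_cells k) u" "supported (first_cells k) v" for u v a
    by (rule gdual_add[OF \<psi> that], rule gdual_smult[OF \<psi> that(1)])
  have "\<psi> k (cut F x) = Polynomial.monom (\<Sum>j\<in>F. gdual_\<kappa> m \<psi> j * x j) (nat (k + m))"
    if "finite F" "F \<subseteq> first_cells k" for F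
    using that
  proof (induction F rule: finite_induct)
    case empty
    have "cut {} x = (\<lambda>j. 0 * x j)" by (simp add: cut_def)
    then show ?case using smult[OF x x, of 0] by simp
  next
    case (insert j F)
    have "cut (insert j F) x = (\<lambda>i. cut F x i + x j * unit j i)"
      using insert.hyps by (auto simp: cut_def unit_def fun_eq_iff)
    moreover have "supported (first_cells k) (cut F x)"
      by (rule supported_mono[OF supported_cut]) (use insert.prems in blast)
    moreover have u: "supported (first_cells k) (unit j)"
      using insert.prems by (simp add: supported_def unit_def)
    ultimately have "\<psi> k (cut (insert j F) x) = \<psi> k (cut F x) + Polynomial.smult (x j) (\<psi> k (unit j))"
      using add[OF _ supported_scale[OF u]] smult[OF u u] by simp
    then show ?case
      using insert gdual_unit[OF \<psi>, of j k] by (simp add: add_monom smult_monom algebra_simps)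
  qed
  from this[of "first_cells k"] have "\<psi> k x = Polynomial.monom (\<Sum>j\<in>first_cells k. gdual_\<kappa> m \<psi> j * x j) (nat (k + m))"
    using lower_finite[OF lower_first_cells] by (simp add: cut_supported[OF x])
  also have "(\<Sum>j\<in>first_cells k. gdual_\<kappa> m \<psi> j * x j) = (\<Sum>j\<le>n. gdual_\<kappa> m \<psi> j * x j)"
    by (rule sum.mono_neutral_left) (use x in \<open>auto simp: supported_def first_cells_def\<close>)
  finally show ?thesis .
qed

lemma field_module_gdual: "field_module (part (gdual CC) m)"
proof (rule field_moduleI)
  fix \<psi> \<psi>' and a :: 'f
  show "\<zero>\<^bsub>part (gdual CC) m\<^esub> \<in> carrier (part (gdual CC) m)"
    by (simp add: gdual_simps gdual_carrier)
  assume \<psi>: "\<psi> \<in> carrier (part (gdual CC) m)"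
  show "a \<odot>\<^bsub>part (gdual CC) m\<^esub> \<psi> \<in> carrier (part (gdual CC) m)"
    unfolding gdual_simps gdual_carrier
  proof (intro conjI allI impI)
    show "int l = k + m" if "supported (first_cells k) x" "Polynomial.coeff (Polynomial.smult a (\<psi> k x)) l \<noteq> 0" for k x l
      by (rule gdual_degree[OF \<psi> that(1), of l]) (use that(2) in auto)
  qed (simp_all add: gdual_add[OF \<psi>] gdual_smult[OF \<psi>] gdual_shift[OF \<psi>] gdual_outside[OF \<psi>] smult_add_right mult.commute)
  assume \<psi>': "\<psi>' \<in> carrier (part (gdual CC) m)"
  have deg: "int l = k + m" if "supported (first_cells k) x" "Polynomial.coeff (\<psi> k x + \<psi>' k x) l \<noteq> 0" for k x l
  proof -
    have "Polynomial.coeff (\<psi> k x) l \<noteq> 0 \<or> Polynomial.coeff (\<psi>' k x) l \<noteq> 0" using that(2) by auto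
    then show ?thesis using gdual_degree[OF \<psi> that(1)] gdual_degree[OF \<psi>' that(1)] by blast
  qed
  show "\<psi> \<oplus>\<^bsub>part (gdual CC) m\<^esub> \<psi>' \<in> carrier (part (gdual CC) m)"
    unfolding gdual_simps gdual_carrier
  proof (intro conjI allI impI)
    show "int l = k + m" if "supported (first_cells k) x" "Polynomial.coeff (\<psi> k x + \<psi>' k x) l \<noteq> 0" for k x l
      by (rule deg[OF that])
  qed (simp_all add: gdual_add[OF \<psi>] gdual_add[OF \<psi>'] gdual_smult[OF \<psi>] gdual_smult[OF \<psi>'] gdual_shift[OF \<psi>]
      gdual_shift[OF \<psi>'] gdual_outside[OF \<psi>] gdual_outside[OF \<psi>'] smult_add_right)
qed (simp_all add: gdual_simps fun_eq_iff smult_add_left smult_add_right algebra_simps)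

text \<open>A homomorphism out of the free module is determined by its values on the generators, which
  are arbitrary monomials of the right degree. Multiplication by \<open>t\<close> does not change their
  coefficients, and the cell \<open>- m - 1\<close>, which is new in degree \<open>m + 1\<close>, gets the coordinate 0.\<close>

lemma gdual_coordinates:
  "cellular_coordinates K \<iota> (gdual CC) (gdual_map CC (cell_boundary K \<iota>))
     (\<lambda>m. last_cells (- m)) cobd gdual_\<kappa>"
proof unfold_locales
  let ?G = "gdual CC :: ('f, int \<Rightarrow> (nat \<Rightarrow> 'f) \<Rightarrow> 'f poly) gmod"
  have tact_closed: "(\<lambda>k x. pCons 0 (\<psi> k x)) \<in> carrier (part ?G (m + 1))" if \<psi>: "\<psi> \<in> carrier (part ?G m)" for m \<psi>
    unfolding gdual_carrier
  proof (intro conjI allI impI)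
    show "int l = k + (m + 1)" if "supported (first_cells k) x" "Polynomial.coeff (pCons 0 (\<psi> k x)) l \<noteq> 0" for k x l
      using that gdual_degree[OF \<psi> that(1), of "l - 1"] by (cases l) auto
  qed (simp_all add: gdual_add[OF \<psi>] gdual_smult[OF \<psi>] gdual_shift[OF \<psi>] gdual_outside[OF \<psi>])
  show "graded_module ?G"
    unfolding graded_module_iff
    by (auto simp: field_module_gdual linear_on_def gdual_simps fun_eq_iff intro: tact_closed)
  fix m
  have D: "gdual_map CC (cell_boundary K \<iota>) m \<psi> = (\<lambda>k x. if supported (first_cells k) x then \<psi> k (bd x) else 0)" for \<psi>
    by (simp add: gdual_map_def on_carrier_def part_cell_complex cell_boundary_bd fun_eq_iff)
  have bdk: "supported (first_cells k) x \<Longrightarrow> supported (first_cells k) (bd x)" for k x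
    by (rule supported_bd_lower[OF lower_first_cells])
  have sk: "supported (first_cells k) x \<Longrightarrow> supported (first_cells (k + 1)) x" for k x
    by (rule supported_mono[OF _ first_cells_mono[of k "k + 1"]]) simp_all
  have bda: "bd (\<lambda>j. x j + y j) = (\<lambda>j. bd x j + bd y j)" and bds: "bd (\<lambda>j. a * x j) = (\<lambda>j. a * bd x j)" for x y a
    by (simp_all add: bd_add bd_scale fun_eq_iff)
  have D_closed: "gdual_map CC (cell_boundary K \<iota>) m \<psi> \<in> carrier (part ?G m)" if \<psi>: "\<psi> \<in> carrier (part ?G m)" for \<psi>
    unfolding D gdual_carrier
  proof (intro conjI allI impI)
    show "int l = k + m" if x: "supported (first_cells k) x"
      and l: "Polynomial.coeff (if supported (first_cells k) x then \<psi> k (bd x) else 0) l \<noteq> 0" for k x l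
      using gdual_degree[OF \<psi> bdk[OF x], of l] l x by simp
  qed (simp_all add: supported_add supported_scale bda bds sk bdk gdual_add[OF \<psi>] gdual_smult[OF \<psi>] gdual_shift[OF \<psi>])
  show "linear_on (part ?G m) (part ?G m) (gdual_map CC (cell_boundary K \<iota>) m)"
    by (rule linear_onI) (auto simp: D_closed, auto simp: D gdual_simps fun_eq_iff)
  show "last_cells (- m) \<subseteq> {..n}" by (auto simp: last_cells_def)
  show "supported (last_cells (- m)) (gdual_\<kappa> m \<psi>)" for \<psi>
    by (simp add: supported_def gdual_\<kappa>_def)
  show "gdual_\<kappa> m (\<psi> \<oplus>\<^bsub>part ?G m\<^esub> \<psi>') = (\<lambda>i. gdual_\<kappa> m \<psi> i + gdual_\<kappa> m \<psi>' i)" for \<psi> \<psi>'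
    by (simp add: gdual_\<kappa>_def gdual_simps fun_eq_iff)
  show "gdual_\<kappa> m (a \<odot>\<^bsub>part ?G m\<^esub> \<psi>) = (\<lambda>i. a * gdual_\<kappa> m \<psi> i)" for \<psi> a
    by (simp add: gdual_\<kappa>_def gdual_simps fun_eq_iff)
  show "\<psi> = \<psi>'" if \<psi>: "\<psi> \<in> carrier (part ?G m)" and \<psi>': "\<psi>' \<in> carrier (part ?G m)" and eq: "gdual_\<kappa> m \<psi> = gdual_\<kappa> m \<psi>'" for \<psi> \<psi>'
  proof (intro ext)
    fix k x
    show "\<psi> k x = \<psi>' k x"
    proof (cases "supported (first_cells k) x")
      case True
      then show ?thesis using gdual_eq[OF \<psi> True] gdual_eq[OF \<psi>' True] eq by simp
    next
      case False
      then show ?thesis using gdual_outside[OF \<psi>] gdual_outside[OF \<psi>'] by simp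
    qed
  qed
  have unit_first: "supported (first_cells (int j)) (unit j)" if "j \<in> last_cells i" for i j
    using that by (auto simp: supported_def first_cells_def last_cells_def unit_def)
  show "\<exists>\<psi>\<in>carrier (part ?G m). gdual_\<kappa> m \<psi> = c" if c: "supported (last_cells (- m)) c" for c
  proof -
    define \<psi> where "\<psi> = (\<lambda>k x. if supported (first_cells k) x then Polynomial.monom (\<Sum>j\<le>n. c j * x j) (nat (k + m)) else 0)"
    have zero: "(\<Sum>j\<le>n. c j * x j) = 0" if "supported (first_cells k) x" "k + m < 0" for k x
    proof (rule sum.neutral, intro ballI)
      fix j show "c j * x j = 0"
        using that c by (force simp: supported_def first_cells_def last_cells_def)
    qed
    have deg: "int l = k + m" if x: "supported (first_cells k) x" and l: "Polynomial.coeff (\<psi> k x) l \<noteq> 0" for k x l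
      using l x zero[OF x] by (cases "k + m < 0") (auto simp: \<psi>_def split: if_splits)
    have shift: "\<psi> (k + 1) x = pCons 0 (\<psi> k x)" if x: "supported (first_cells k) x" for k x
    proof (cases "k + m < 0")
      case True
      then show ?thesis using zero[OF x] x sk[OF x] by (simp add: \<psi>_def)
    next
      case False
      then have "nat (k + 1 + m) = Suc (nat (k + m))" by simp
      then show ?thesis using x sk[OF x] by (simp add: \<psi>_def monom_Suc)
    qed
    have "\<psi> \<in> carrier (part ?G m)"
      unfolding gdual_carrier
    proof (intro conjI allI impI)
      show "int l = k + m" if "supported (first_cells k) x" "Polynomial.coeff (\<psi> k x) l \<noteq> 0" for k x l
        by (rule deg[OF that])
      show "\<psi> (k + 1) x = pCons 0 (\<psi> k x)" if "supported (first_cells k) x" for k x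
        by (rule shift[OF that])
    qed (auto simp: \<psi>_def supported_add supported_scale add_monom smult_monom sum.distrib sum_distrib_left algebra_simps)
    moreover have "gdual_\<kappa> m \<psi> = c"
    proof
      fix j
      show "gdual_\<kappa> m \<psi> j = c j"
      proof (cases "j \<in> last_cells (- m)")
        case True
        then have "j \<le> n" by (simp add: last_cells_def)
        then have "(\<Sum>i\<le>n. c i * unit j i) = c j" by (simp add: unit_def if_distrib cong: if_cong)
        then show ?thesis using True unit_first[OF True] by (simp add: gdual_\<kappa>_def \<psi>_def)
      next
        case False
        then show ?thesis using c by (auto simp: gdual_\<kappa>_def supported_def)
      qed
    qed
    ultimately show ?thesis by blast
  qed
  fix \<psi> assume \<psi>: "\<psi> \<in> carrier (part ?G m)"
  show "gdual_\<kappa> m (gdual_map CC (cell_boundary K \<iota>) m \<psi>) = cut (last_cells (- m)) (cobd (gdual_\<kappa> m \<psi>))"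
  proof
    fix j
    show "gdual_\<kappa> m (gdual_map CC (cell_boundary K \<iota>) m \<psi>) j = cut (last_cells (- m)) (cobd (gdual_\<kappa> m \<psi>)) j"
    proof (cases "j \<in> last_cells (- m)")
      case True
      then have jn: "j \<le> n" by (simp add: last_cells_def)
      note u = unit_first[OF True]
      have "\<psi> (int j) (bd (unit j)) = Polynomial.monom (\<Sum>i\<le>n. gdual_\<kappa> m \<psi> i * bd (unit j) i) (nat (int j + m))"
        by (rule gdual_eq[OF \<psi> bdk[OF u]])
      then have "gdual_\<kappa> m (gdual_map CC (cell_boundary K \<iota>) m \<psi>) j = (\<Sum>i\<le>n. gdual_\<kappa> m \<psi> i * bd (unit j) i)"
        using True u by (simp add: D gdual_\<kappa>_def[of m "\<lambda>k x. if supported (first_cells k) x then \<psi> k (bd x) else 0"])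
      then show ?thesis using True by (simp add: bd_unit[OF jn] cobd_def cut_def mult.commute)
    next
      case False
      then show ?thesis by (simp add: gdual_\<kappa>_def cut_def)
    qed
  qed
  show "gdual_\<kappa> (m + 1) (tact ?G m \<psi>) = cut (last_cells (- (m + 1))) (gdual_\<kappa> m \<psi>)"
  proof
    fix j
    show "gdual_\<kappa> (m + 1) (tact ?G m \<psi>) j = cut (last_cells (- (m + 1))) (gdual_\<kappa> m \<psi>) j"
    proof (cases "j \<in> last_cells (- (m + 1))")
      case True
      then have jn: "j \<le> n" and jm: "- (m + 1) \<le> int j" by (simp_all add: last_cells_def)
      have "j \<in> first_cells (int j)" using jn by (simp add: first_cells_def)
      note u = gdual_unit[OF \<psi> this]
      have "gdual_\<kappa> (m + 1) (tact ?G m \<psi>) j = Polynomial.coeff (pCons 0 (\<psi> (int j) (unit j))) (nat (int j + (m + 1)))"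
        unfolding gdual_simps using True by (simp add: gdual_\<kappa>_def del: minus_add_distrib)
      also have "\<dots> = gdual_\<kappa> m \<psi> j"
      proof (cases "0 \<le> int j + m")
        case True
        then have "nat (int j + (m + 1)) = Suc (nat (int j + m))" by simp
        then show ?thesis unfolding u by simp
      next
        case False
        then have "nat (int j + (m + 1)) = 0" "gdual_\<kappa> m \<psi> j = 0"
          using jm by (auto simp: gdual_\<kappa>_def last_cells_def)
        then show ?thesis by simp
      qed
      finally show ?thesis using True by (simp add: cut_def)
    next
      case False
      then show ?thesis by (simp add: gdual_\<kappa>_def cut_def del: minus_add_distrib)
    qed
  qed
qed

section \<open>The isomorphisms\<close>

lemma bd_cut_dim: "bd (cut {j. d j = p} c) i = (if Suc (d i) = p then bd c i else 0)"
proof -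
  have "bd (cut {j. d j = p} c) i = (\<Sum>j\<le>n. if Suc (d i) = p then coeff i j * c j else 0)"
    unfolding bd_def
  proof (rule sum.cong[OF refl])
    fix j assume "j \<in> {..n}"
    then show "coeff i j * cut {j. d j = p} c j = (if Suc (d i) = p then coeff i j * c j else 0)"
      using coeff_nonzero[of i j] by (cases "coeff i j = 0") (auto simp: cut_def)
  qed
  then show ?thesis by (simp add: bd_def)
qed

lemma supported_cut_dim: "supported J c \<Longrightarrow> supported (J \<inter> {j. d j = p}) (cut {j. d j = p} c)"
  by (auto simp: supported_def cut_def)

text \<open>The cellular boundary of a relative cellular cycle is supported in \<open>A\<close>, so the singular
  boundary is a chain of \<open>A\<close>.\<close>

lemma comb_relcycle:
  assumes L: "lower L" and A: "lower A" "A \<subseteq> L" and c: "supported ((L - A) \<inter> {j. d j = p}) c"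
    and bc: "\<And>i. i \<in> L - A \<Longrightarrow> bd c i = 0"
  shows "comb s c \<in> relcycles p (Y L) (cells A)"
proof -
  have cL: "supported (L \<inter> {j. d j = p}) c" using c by (auto simp: supported_def)
  have "supported (L \<inter> {j. Suc (d j) = p}) (bd c)"
    by (rule supported_bd[OF L cL lower_adapted[OF L]])
  then have "supported (A \<inter> {j. d j = p - 1}) (bd c)"
    using bc by (auto simp: supported_def)
  from comb_chains[OF A(1) this lower_adapted[OF A(1)]]
  have "fboundary p (comb s c) \<in> chains (p - 1) (Y A)"
    by (simp only: fboundary_comb[OF cL lower_adapted[OF L]])
  moreover have "comb s c \<in> chains p (Y L)" by (rule comb_chains[OF L cL lower_adapted[OF L]])
  ultimately show ?thesis using A(2) by (simp add: relcycles_iff)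
qed

lemma relboundaries_cells_mono:
  assumes "x \<in> relboundaries p (Y L) (cells A)" "L \<subseteq> L'" "A \<subseteq> A'"
  shows "x \<in> relboundaries p (Y L') (cells A')"
  using relboundaries_mono[OF assms(1) cells_mono[OF assms(2)] cells_mono[OF assms(3)]] .

lemma relcycles_cells_mono:
  assumes "x \<in> relcycles p (Y L) (cells A)" "L \<subseteq> L'" "A \<subseteq> A'"
  shows "x \<in> relcycles p (Y L') (cells A')"
  using relcycles_mono[OF assms(1) cells_mono[OF assms(2)] cells_mono[OF assms(3)]] .

text \<open>A cellular chain \<open>c\<close> is related to a family \<open>y\<close> of singular relative cycles if in each
  dimension \<open>p\<close> the part of \<open>c\<close> of dimension \<open>p\<close> maps to the class of \<open>y p\<close> under \<open>\<sigma> j \<mapsto> s j\<close>.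
  That this has the properties of an isomorphism is \<open>cellular_homology\<close> for the pairs
  \<open>(L m, A m)\<close>; compatibility with \<open>t\<close> holds because cells that drop out from one degree to the
  next lie in the next \<open>A\<close>, where their chains are relative boundaries.\<close>

theorem persistent_homology_iso:
  fixes C :: "('f, 'v) gmod" and N :: "('f, nat \<Rightarrow> ('a, 'f) fchain set) gmod"
  assumes coords: "cellular_coordinates K \<iota> C D (\<lambda>m. L m - A m) bd \<kappa>"
    and L: "\<And>m. lower (L m)" "\<And>m. L m \<subseteq> L (m + 1)" and A: "\<And>m. lower (A m)" "\<And>m. A m \<subseteq> A (m + 1)" "\<And>m. A m \<subseteq> L m"
    and N: "\<And>m. part N m = total_homology (Y (L m)) (cells (A m))"
      "\<And>m x. tact N m x = homology_inclusion (Y (L (m + 1))) (cells (A (m + 1))) x"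
  shows "complex_homology C D \<cong>\<^sub>g\<^sub>r N"
proof -
  interpret cellular_coordinates K \<iota> C D "\<lambda>m. L m - A m" bd \<kappa> by (rule coords)
  let ?W = "\<lambda>m p. fchains p (Y (L m)) :: ('f, ('a, 'f) fchain) module"
  let ?Z = "\<lambda>m p. relcycles p (Y (L m)) (cells (A m)) :: ('a, 'f) fchain set"
  let ?B = "\<lambda>m p. relboundaries p (Y (L m)) (cells (A m)) :: ('a, 'f) fchain set"
  let ?P = "\<lambda>m c y. \<forall>p. y p - comb s (cut {j. d j = p} c) \<in> ?B m p"
  have cut_add: "cut J' (\<lambda>i. c i + c' i) = (\<lambda>i. cut J' c i + cut J' c' i)" for J' c c' by (auto simp: cut_def)
  have cut_scale: "cut J' (\<lambda>i. a * c i) = (\<lambda>i. a * cut J' c i)" for J' c a by (auto simp: cut_def)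
  have BA: "x \<in> ?B m p" if "x \<in> chains p (Y (A m))" for x m p
    by (rule chains_imp_relboundaries) (use that A(3) in simp)
  show ?thesis
  proof (rule coordinate_iso[where W = ?W and Z' = ?Z and B' = ?B and \<sigma> = "\<lambda>m p c. c" and P = ?P,
        OF _ _ _ field_module_fchains submodule_relcycles submodule_relboundaries])
    fix m c i assume c: "supported (L m - A m) c" and i: "i \<in> L (m + 1) - A (m + 1)"
    have "c = (\<lambda>i. cut (L (m + 1) - A (m + 1)) c i + cut (A (m + 1)) c i)"
      using c L(2)[of m] by (fastforce simp: supported_def cut_def fun_eq_iff)
    then have "bd c i = bd (cut (L (m + 1) - A (m + 1)) c) i + bd (cut (A (m + 1)) c) i"
      using bd_add by metis
    moreover have "bd (cut (A (m + 1)) c) i = 0"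
      by (rule bd_outside_lower[OF A(1) lower_adapted[OF A(1)] supported_cut]) (use i in auto)
    moreover have "bd c i = 0" if "i \<notin> L m"
      by (rule bd_outside_lower[OF L(1) lower_adapted[OF L(1)] supported_mono[OF c] that]) auto
    moreover have "i \<notin> A m" using i A(2)[of m] by blast
    ultimately show "bd (cut (L (m + 1) - A (m + 1)) c) i = cut (L m - A m) (bd c) i"
      by (cases "i \<in> L m") (auto simp: cut_def)
  next
    show "part N m = direct_sum (\<lambda>p. quotient_space (?W m p) (?Z m p) (?B m p))" for m
      by (simp add: N total_homology_def singular_homology_def)
    show "tact N m x = (\<lambda>p. induced (?W (m + 1) p) (?B (m + 1) p) (\<lambda>c. c) (x p))" for m x
      by (simp add: N homology_inclusion_def)
    show "linear_on (?W m p) (?W (m + 1) p) (\<lambda>c. c)" for m p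
      using chains_mono[OF _ cells_mono[OF L(2)[of m]]] by (auto simp: linear_on_def)
    show "x \<in> ?Z (m + 1) p" if "x \<in> ?Z m p" for m p x
      by (rule relcycles_cells_mono[OF that L(2) A(2)])
    show "x \<in> ?B (m + 1) p" if "x \<in> ?B m p" for m p x
      by (rule relboundaries_cells_mono[OF that L(2) A(2)])
  next
    fix m c y c' y' assume y: "?P m c y" "?P m c' y'"
    show "?P m (\<lambda>i. c i + c' i) (\<lambda>p. y p \<oplus>\<^bsub>?W m p\<^esub> y' p)"
    proof
      fix p
      have "y p \<oplus>\<^bsub>?W m p\<^esub> y' p - comb s (cut {j. d j = p} (\<lambda>i. c i + c' i))
         = (y p - comb s (cut {j. d j = p} c)) + (y' p - comb s (cut {j. d j = p} c'))"
        by (simp add: cut_add comb_add)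
      then show "y p \<oplus>\<^bsub>?W m p\<^esub> y' p - comb s (cut {j. d j = p} (\<lambda>i. c i + c' i)) \<in> ?B m p"
        using relboundaries_add[OF y(1)[rule_format] y(2)[rule_format]] by (simp only:)
    qed
  next
    fix m c y a assume y: "?P m c y"
    show "?P m (\<lambda>i. a * c i) (\<lambda>p. a \<odot>\<^bsub>?W m p\<^esub> y p)"
    proof
      fix p
      have "a \<odot>\<^bsub>?W m p\<^esub> y p - comb s (cut {j. d j = p} (\<lambda>i. a * c i))
         = scale_chain a (y p - comb s (cut {j. d j = p} c))"
        by (simp add: cut_scale comb_scale fch.scale_right_diff_distrib)
      then show "a \<odot>\<^bsub>?W m p\<^esub> y p - comb s (cut {j. d j = p} (\<lambda>i. a * c i)) \<in> ?B m p"
        using relboundaries_scale[OF y[rule_format]] by (simp only:)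
    qed
  next
    fix m c assume c: "supported (L m - A m) c" and bc: "\<And>i. i \<in> L m - A m \<Longrightarrow> bd c i = 0"
    show "\<exists>y. (\<forall>p. y p \<in> ?Z m p) \<and> finite {p. y p \<notin> ?B m p} \<and> ?P m c y"
    proof (intro exI conjI allI)
      fix p
      show "comb s (cut {j. d j = p} c) \<in> ?Z m p"
        by (rule comb_relcycle[OF L(1) A(1,3) supported_cut_dim[OF c]]) (simp add: bd_cut_dim bc)
      have "{p. comb s (cut {j. d j = p} c) \<notin> ?B m p} \<subseteq> d ` {..n}"
      proof
        fix p assume p: "p \<in> {p. comb s (cut {j. d j = p} c) \<notin> ?B m p}"
        show "p \<in> d ` {..n}"
        proof (rule ccontr)
          assume "p \<notin> d ` {..n}"
          then have "comb s (cut {j. d j = p} c) = 0"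
            unfolding comb_def by (intro sum.neutral) (auto simp: cut_def)
          then show False using p by simp
        qed
      qed
      then show "finite {p. comb s (cut {j. d j = p} c) \<notin> ?B m p}" by (rule finite_subset) simp
      show "comb s (cut {j. d j = p} c) - comb s (cut {j. d j = p} c) \<in> ?B m p" by simp
    qed
  next
    fix m and y :: "nat \<Rightarrow> ('a, 'f) fchain" assume y: "\<And>p. y p \<in> ?Z m p"
    have "\<forall>p. \<exists>c. supported ((L m - A m) \<inter> {j. d j = p}) c \<and> (\<forall>i\<in>L m - A m. bd c i = 0) \<and> y p - comb s c \<in> ?B m p"
      using cellular_homology(1)[OF L(1) A(1) A(3) lower_adapted[OF L(1)[of m]] y] by blast
    then obtain g where g: "\<And>p. supported ((L m - A m) \<inter> {j. d j = p}) (g p)" "\<And>p i. i \<in> L m - A m \<Longrightarrow> bd (g p) i = 0"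
      "\<And>p. y p - comb s (g p) \<in> ?B m p" by metis
    define c where "c = (\<lambda>j. g (d j) j)"
    have cg: "cut {j. d j = p} c = g p" for p
      using g(1)[of p] by (auto simp: c_def cut_def supported_def fun_eq_iff)
    have "supported (L m - A m) c" using g(1) by (auto simp: c_def supported_def)
    moreover have "bd c i = 0" if "i \<in> L m - A m" for i
      using bd_cut_dim[of "Suc (d i)" c i] g(2)[OF that] by (simp add: cg)
    moreover have "?P m c y" using g(3) by (simp add: cg)
    ultimately show "\<exists>c. supported (L m - A m) c \<and> (\<forall>i\<in>L m - A m. bd c i = 0) \<and> ?P m c y" by blast
  next
    fix m c and y :: "nat \<Rightarrow> ('a, 'f) fchain"
    assume c: "supported (L m - A m) c" and bc: "\<And>i. i \<in> L m - A m \<Longrightarrow> bd c i = 0" and P: "?P m c y"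
    have yB: "y p \<in> ?B m p \<longleftrightarrow> comb s (cut {j. d j = p} c) \<in> ?B m p" for p
      using relboundaries_add[OF P[rule_format, of p], of "comb s (cut {j. d j = p} c)"]
        relboundaries_diff[OF _ P[rule_format, of p], of "y p"] by auto
    show "(\<exists>c'. supported (L m - A m) c' \<and> c = cut (L m - A m) (bd c')) \<longleftrightarrow> (\<forall>p. y p \<in> ?B m p)"
      unfolding yB
    proof
      assume "\<exists>c'. supported (L m - A m) c' \<and> c = cut (L m - A m) (bd c')"
      then obtain c' where c': "supported (L m - A m) c'" "c = cut (L m - A m) (bd c')" by blast
      show "\<forall>p. comb s (cut {j. d j = p} c) \<in> ?B m p"
      proof
        fix p
        let ?u = "cut {j. d j = Suc p} c'"
        have u: "supported (L m \<inter> {j. d j = Suc p}) ?u"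
          using c'(1) by (auto simp: supported_def cut_def)
        have bu: "supported (L m \<inter> {j. Suc (d j) = Suc p}) (bd ?u)"
          by (rule supported_bd[OF L(1) u lower_adapted[OF L(1)]])
        have split: "bd ?u = (\<lambda>i. cut {j. d j = p} c i + cut (A m) (bd ?u) i)"
        proof
          fix i
          show "bd ?u i = cut {j. d j = p} c i + cut (A m) (bd ?u) i"
          proof (cases "i \<in> A m")
            case True
            then have "c i = 0" using c by (auto simp: supported_def)
            with True show ?thesis by (simp add: cut_def[of _ c] cut_def[of "A m"])
          next
            case False
            show ?thesis
            proof (cases "i \<in> L m \<and> d i = p")
              case True
              then have "c i = bd c' i" using c'(2) False by (simp add: cut_def[of "L m - A m"])
              then show ?thesis using True False
                by (simp add: bd_cut_dim) (simp add: cut_def)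
            next
              case no: False
              then have "bd ?u i = 0" using bu by (auto simp: supported_def)
              moreover have "cut {j. d j = p} c i = 0" using no c by (auto simp: supported_def cut_def)
              ultimately show ?thesis using False by (simp add: cut_def[of "A m"])
            qed
          qed
        qed
        have "supported (A m \<inter> {j. d j = p}) (cut (A m) (bd ?u))"
          using bu by (auto simp: supported_def cut_def)
        from BA[OF comb_chains[OF A(1) this lower_adapted[OF A(1)]]]
        have 1: "comb s (cut (A m) (bd ?u)) \<in> ?B m p" .
        have "fboundary (Suc p) (comb s ?u) \<in> ?B m p"
          by (rule fboundary_imp_relboundaries[OF comb_chains[OF L(1) u lower_adapted[OF L(1)]]])
        then have 2: "comb s (bd ?u) \<in> ?B m p"
          by (simp only: fboundary_comb[OF u lower_adapted[OF L(1)]])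
        have "comb s (bd ?u) = comb s (cut {j. d j = p} c) + comb s (cut (A m) (bd ?u))"
          by (subst split) (rule comb_add)
        then have "comb s (cut {j. d j = p} c) = comb s (bd ?u) - comb s (cut (A m) (bd ?u))" by simp
        then show "comb s (cut {j. d j = p} c) \<in> ?B m p"
          using relboundaries_diff[OF 2 1] by (simp only:)
      qed
    next
      assume cB: "\<forall>p. comb s (cut {j. d j = p} c) \<in> ?B m p"
      have "\<forall>p. \<exists>c'. supported ((L m - A m) \<inter> {j. d j = Suc p}) c' \<and> (\<forall>i\<in>L m - A m. cut {j. d j = p} c i = bd c' i)"
      proof
        fix p
        show "\<exists>c'. supported ((L m - A m) \<inter> {j. d j = Suc p}) c' \<and> (\<forall>i\<in>L m - A m. cut {j. d j = p} c i = bd c' i)"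
          by (rule cellular_homology(2)[OF L(1) A(1,3) lower_adapted[OF L(1)] supported_cut_dim[OF c] _ cB[rule_format]])
             (simp_all add: bd_cut_dim bc)
      qed
      then obtain g where g: "\<And>p. supported ((L m - A m) \<inter> {j. d j = Suc p}) (g p)"
        "\<And>p i. i \<in> L m - A m \<Longrightarrow> cut {j. d j = p} c i = bd (g p) i" by metis
      \<comment> \<open>The chains that bound in the single dimensions are put together; vertices bound
        nothing.\<close>
      define c' where "c' = (\<lambda>j. if d j = 0 then 0 else g (d j - 1) j)"
      have cg: "cut {j. d j = Suc p} c' = g p" for p
        using g(1)[of p] by (auto simp: c'_def cut_def supported_def fun_eq_iff)
      have "supported (L m - A m) c'"
        using g(1) by (fastforce simp: c'_def supported_def split: if_splits)
      moreover have "c i = cut (L m - A m) (bd c') i" for i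
      proof (cases "i \<in> L m - A m")
        case True
        then show ?thesis
          using bd_cut_dim[of "Suc (d i)" c' i, unfolded cg] g(2)[OF True, of "d i"] by (simp add: cut_def)
      next
        case False
        then show ?thesis using c by (auto simp: supported_def cut_def)
      qed
      ultimately show "\<exists>c'. supported (L m - A m) c' \<and> c = cut (L m - A m) (bd c')" by blast
    qed
  next
    fix m c and y :: "nat \<Rightarrow> ('a, 'f) fchain"
    assume c: "supported (L m - A m) c" and P: "?P m c y"
    show "?P (m + 1) (cut (L (m + 1) - A (m + 1)) c) y"
    proof
      fix p
      let ?c = "cut {j. d j = p} c" and ?c' = "cut {j. d j = p} (cut (L (m + 1) - A (m + 1)) c)"
      have split: "?c = (\<lambda>i. ?c' i + cut (A (m + 1)) ?c i)"
        using c L(2)[of m] by (fastforce simp: cut_def supported_def fun_eq_iff)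
      have "supported (A (m + 1) \<inter> {j. d j = p}) (cut (A (m + 1)) ?c)"
        by (auto simp: supported_def cut_def)
      from BA[OF comb_chains[OF A(1) this lower_adapted[OF A(1)]]]
      have 1: "comb s (cut (A (m + 1)) ?c) \<in> ?B (m + 1) p" .
      have 2: "y p - comb s ?c \<in> ?B (m + 1) p"
        by (rule relboundaries_cells_mono[OF P[rule_format] L(2) A(2)])
      have "comb s ?c = comb s ?c' + comb s (cut (A (m + 1)) ?c)"
        by (subst split) (rule comb_add)
      then have "y p - comb s ?c' = (y p - comb s ?c) + comb s (cut (A (m + 1)) ?c)" by simp
      then show "y p - comb s ?c' \<in> ?B (m + 1) p"
        using relboundaries_add[OF 2 1] by (simp only:)
    qed
  qed
qed

lemma cobd_cochain:
  assumes L: "lower L" and A: "lower A" and \<psi>: "\<psi> \<in> relcochains q (Y L) (cells A)" and AL: "A \<subseteq> L"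
    and c: "supported (L - A) c" "\<And>j. j \<in> L - A \<Longrightarrow> d j = q \<Longrightarrow> c j = \<psi> (s j)" and i: "i \<in> L" "d i = Suc q"
  shows "cobd c i = \<psi> (fboundary (d i) (s i))"
proof -
  have \<psi>D: "\<psi> \<in> carrier (dual_space (fchains q (Y L)))" and \<psi>A: "\<And>x. x \<in> chains q (Y A) \<Longrightarrow> \<psi> x = 0"
    using \<psi> AL by (auto simp: relcochains_iff)
  have jL: "j \<in> L \<and> d j = q" if "coeff j i \<noteq> 0" for j
    using coeff_nonzero[OF that lower_le[OF L i(1)]] lowerD[OF L i(1)] i(2) by auto
  have "\<psi> (fboundary (d i) (s i)) = \<psi> (\<Sum>j\<le>n. scale_chain (coeff j i) (s j))"
    using lower_adapted[OF L i(1)] by (simp add: adapted_def comb_def)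
  also have "\<dots> = (\<Sum>j\<le>n. coeff j i * \<psi> (s j))"
  proof (rule cochain_sum[OF \<psi>D])
    fix j assume "coeff j i \<noteq> 0"
    then show "s j \<in> chains q (Y L)" using jL[of j] adapted_chains[OF L _ lower_adapted[OF L]] by blast
  qed
  also have "\<dots> = cobd c i"
    unfolding cobd_def
  proof (rule sum.cong[OF refl])
    fix j
    show "coeff j i * \<psi> (s j) = coeff j i * c j"
    proof (cases "coeff j i = 0")
      case False
      note j = jL[OF False]
      show ?thesis
      proof (cases "j \<in> A")
        case True
        then have "\<psi> (s j) = 0" using \<psi>A adapted_chains[OF A True lower_adapted[OF A True]] j by blast
        moreover have "c j = 0" using c(1) True by (auto simp: supported_def)
        ultimately show ?thesis by simp
      qed (use c(2) j in simp)
    qed simp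
  qed
  finally show ?thesis by simp
qed

lemma cobd_vertex: "d i = 0 \<Longrightarrow> i \<le> n \<Longrightarrow> cobd c i = 0"
  unfolding cobd_def by (rule sum.neutral) (use coeff_nonzero in force)

text \<open>Here a cellular cochain is related to a family of singular relative cocycles if it records
  their values on the chains \<open>s j\<close>. The pairs \<open>(L m, A m)\<close> now shrink with the degree, and \<open>t\<close>
  restricts cochains to the smaller pair.\<close>

theorem persistent_cohomology_iso:
  fixes C :: "('f, 'v) gmod" and N :: "('f, nat \<Rightarrow> ('a, 'f) fcochain set) gmod"
  assumes coords: "cellular_coordinates K \<iota> C D (\<lambda>m. L m - A m) cobd \<kappa>"
    and L: "\<And>m. lower (L m)" "\<And>m. L (m + 1) \<subseteq> L m" and A: "\<And>m. lower (A m)" "\<And>m. A (m + 1) \<subseteq> A m" "\<And>m. A m \<subseteq> L m"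
    and N: "\<And>m. part N m = total_cohomology (Y (L m)) (cells (A m))"
      "\<And>m x. tact N m x = cohomology_restriction (Y (L (m + 1))) (cells (A (m + 1))) x"
  shows "complex_homology C D \<cong>\<^sub>g\<^sub>r N"
proof -
  interpret cellular_coordinates K \<iota> C D "\<lambda>m. L m - A m" cobd \<kappa> by (rule coords)
  let ?W = "\<lambda>m p. dual_space (fchains p (Y (L m))) :: ('f, ('a, 'f) fcochain) module"
  let ?Z = "\<lambda>m p. relcocycles p (Y (L m)) (cells (A m)) :: ('a, 'f) fcochain set"
  let ?B = "\<lambda>m p. relcoboundaries p (Y (L m)) (cells (A m)) :: ('a, 'f) fcochain set"
  let ?\<sigma> = "\<lambda>m p. on_carrier (fchains p (Y (L (m + 1)))) :: ('a, 'f) fcochain \<Rightarrow> ('a, 'f) fcochain"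
  let ?P = "\<lambda>m c y. \<forall>j\<in>L m - A m. y (d j) (s j) = c j"
  have down: "x \<in> chains p (Y (L m))" if "x \<in> chains p (Y (L (m + 1)))" for x :: "('a, 'f) fchain" and m p
    using chains_mono[OF that cells_mono[OF L(2)]] .
  have sL: "s j \<in> chains (d j) (Y (L m))" if "j \<in> L m" for j m
    by (rule adapted_chains[OF L(1) that lower_adapted[OF L(1) that]])
  have sA: "s j \<in> chains (d j) (Y (A m))" if "j \<in> A m" for j m
    by (rule adapted_chains[OF A(1) that lower_adapted[OF A(1) that]])
  have \<sigma>_dual: "?\<sigma> m p \<phi> \<in> carrier (?W (m + 1) p)" if "\<phi> \<in> carrier (?W m p)" for m p \<phi>
    using that down by (auto simp: dual_space_carrier on_carrier_def chains_add chains_scale)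
  have \<sigma>_cochain: "?\<sigma> m p \<phi> \<in> relcochains p (Y (L (m + 1))) (cells (A (m + 1)))"
    if \<phi>: "\<phi> \<in> relcochains p (Y (L m)) (cells (A m))" for m p \<phi>
  proof -
    have "\<phi> x = 0" if "x \<in> chains p (Y (A (m + 1)))" for x
      using \<phi> chains_mono[OF that cells_mono[OF A(2)]] A(3)[of m] by (simp add: relcochains_iff)
    then show ?thesis using \<phi> \<sigma>_dual A(3)[of "m + 1"] by (auto simp: relcochains_iff on_carrier_def)
  qed
  have \<sigma>_coboundary: "?\<sigma> m (Suc q) (coboundary q (Y (L m)) \<phi>) = coboundary q (Y (L (m + 1))) (?\<sigma> m q \<phi>)" for m q \<phi>
  proof
    fix x
    show "?\<sigma> m (Suc q) (coboundary q (Y (L m)) \<phi>) x = coboundary q (Y (L (m + 1))) (?\<sigma> m q \<phi>) x"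
      using down[of x "Suc q" m] fboundary_chains[of x "Suc q" "Y (L (m + 1))"]
      by (simp add: coboundary_def on_carrier_def)
  qed
  have ZA: "\<phi> (s j) = 0" if "\<phi> \<in> ?Z m (d j)" "j \<in> A m" for \<phi> m j
    using that sA[OF that(2)] chains_imp_relboundaries[of "s j" "d j" "Y (L m)" "cells (A m)"] A(3)[of m]
    by (auto simp: relcocycles_iff)
  show ?thesis
  proof (rule coordinate_iso[where W = ?W and Z' = ?Z and B' = ?B and \<sigma> = ?\<sigma> and P = ?P,
        OF _ _ _ field_module_dual_space submodule_relcocycles submodule_relcoboundaries])
    fix m c i assume c: "supported (L m - A m) c" and i: "i \<in> L (m + 1) - A (m + 1)"
    have iL: "i \<in> L m" using i L(2)[of m] by blast
    have lowers: "j \<in> L (m + 1)" "i \<in> A m \<Longrightarrow> j \<in> A m" if "coeff j i \<noteq> 0" for j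
      using coeff_nonzero[OF that lower_le[OF L(1) iL]] lowerD[OF L(1)[of "m + 1"], of i j] lowerD[OF A(1)[of m], of i j] i by auto
    have "cobd (cut (L (m + 1) - A (m + 1)) c) i = cobd c i"
      unfolding cobd_def
    proof (rule sum.cong[OF refl])
      fix j
      show "coeff j i * cut (L (m + 1) - A (m + 1)) c j = coeff j i * c j"
        using lowers(1)[of j] c A(2)[of m] by (cases "coeff j i = 0"; cases "c j = 0") (auto simp: cut_def supported_def)
    qed
    moreover have "cobd c i = 0" if "i \<in> A m"
      unfolding cobd_def
    proof (rule sum.neutral, intro ballI)
      fix j
      show "coeff j i * c j = 0"
        using lowers(2)[of j] that c by (cases "coeff j i = 0"; cases "c j = 0") (auto simp: supported_def)
    qed
    ultimately show "cobd (cut (L (m + 1) - A (m + 1)) c) i = cut (L m - A m) (cobd c) i"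
      using iL by (auto simp: cut_def)
  next
    show "part N m = direct_sum (\<lambda>p. quotient_space (?W m p) (?Z m p) (?B m p))" for m
      by (simp add: N total_cohomology_def singular_cohomology_def)
    show "tact N m x = (\<lambda>p. induced (?W (m + 1) p) (?B (m + 1) p) (?\<sigma> m p) (x p))" for m x
      by (simp add: N cohomology_restriction_def)
    show "linear_on (?W m p) (?W (m + 1) p) (?\<sigma> m p)" for m p
      by (rule linear_onI) (auto simp: \<sigma>_dual, auto simp: on_carrier_def fun_eq_iff)
    show "?\<sigma> m p x \<in> ?Z (m + 1) p" if x: "x \<in> ?Z m p" for m p x
    proof -
      have "x \<in> relcochains p (Y (L m)) (cells (A m))" and co: "coboundary p (Y (L m)) x = (\<lambda>c. 0)"
        using x by (auto simp: relcocycles_def)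
      moreover have "?\<sigma> m (Suc p) (\<lambda>c. 0) = (\<lambda>c. 0)" by (simp add: on_carrier_def)
      ultimately show ?thesis using \<sigma>_cochain \<sigma>_coboundary[symmetric] by (simp add: relcocycles_def)
    qed
    show "?\<sigma> m p x \<in> ?B (m + 1) p" if x: "x \<in> ?B m p" for m p x
    proof (cases p)
      case 0
      then show ?thesis using x by (simp add: relcoboundaries_def on_carrier_def)
    next
      case (Suc q)
      then obtain \<phi> where "\<phi> \<in> relcochains q (Y (L m)) (cells (A m))" "x = coboundary q (Y (L m)) \<phi>"
        using x by (auto simp: relcoboundaries_def)
      then show ?thesis using Suc \<sigma>_coboundary \<sigma>_cochain by (simp add: relcoboundaries_def)
    qed
  next
    fix m c assume c: "supported (L m - A m) c" and cc: "\<And>i. i \<in> L m - A m \<Longrightarrow> cobd c i = 0"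
    have "\<forall>p. \<exists>\<phi>. \<phi> \<in> ?Z m p \<and> (\<forall>j\<in>L m - A m. d j = p \<longrightarrow> \<phi> (s j) = c j)"
      using cellular_cocycle[OF L(1) A(1) A(3) lower_adapted[OF L(1)[of m]] c cc] by blast
    then obtain y where y: "\<And>p. y p \<in> ?Z m p" "\<And>p j. j \<in> L m - A m \<Longrightarrow> d j = p \<Longrightarrow> y p (s j) = c j" by metis
    have "{p. y p \<notin> ?B m p} \<subseteq> d ` {..n}"
    proof
      fix p assume p: "p \<in> {p. y p \<notin> ?B m p}"
      show "p \<in> d ` {..n}"
      proof (rule ccontr)
        assume "p \<notin> d ` {..n}"
        then have "y p \<in> ?B m p"
          by (intro cellular_coboundary[OF L(1) A(1,3) lower_adapted[OF L(1)] y(1) supported_zero])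
             (use lower_le[OF L(1)] in auto)
        then show False using p by simp
      qed
    qed
    then have "finite {p. y p \<notin> ?B m p}" by (rule finite_subset) simp
    then show "\<exists>y. (\<forall>p. y p \<in> ?Z m p) \<and> finite {p. y p \<notin> ?B m p} \<and> ?P m c y" using y by blast
  next
    fix m and y :: "nat \<Rightarrow> ('a, 'f) fcochain" assume y: "\<And>p. y p \<in> ?Z m p"
    define c where "c = (\<lambda>j. if j \<in> L m - A m then y (d j) (s j) else 0)"
    have c: "supported (L m - A m) c" by (simp add: supported_def c_def)
    have "cobd c i = 0" if i: "i \<in> L m - A m" for i
    proof (cases "d i")
      case 0
      then show ?thesis using cobd_vertex lower_le[OF L(1)] i by blast
    next
      case (Suc q)
      have "cobd c i = y q (fboundary (d i) (s i))"
        by (rule cobd_cochain[OF L(1) A(1) _ A(3) c]) (use y[of q] i Suc in \<open>auto simp: relcocycles_def c_def\<close>)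
      also have "\<dots> = 0"
      proof -
        have "s i \<in> chains (Suc q) (Y (L m))" using sL[of i m] i Suc by simp
        from fboundary_imp_relboundaries[OF this] show ?thesis
          using y[of q] Suc by (simp add: relcocycles_iff)
      qed
      finally show ?thesis .
    qed
    moreover have "?P m c y" by (simp add: c_def)
    ultimately show "\<exists>c. supported (L m - A m) c \<and> (\<forall>i\<in>L m - A m. cobd c i = 0) \<and> ?P m c y" using c by blast
  next
    fix m c and y :: "nat \<Rightarrow> ('a, 'f) fcochain"
    assume c: "supported (L m - A m) c" and y: "\<And>p. y p \<in> ?Z m p" and P: "?P m c y"
    show "(\<exists>c'. supported (L m - A m) c' \<and> c = cut (L m - A m) (cobd c')) \<longleftrightarrow> (\<forall>p. y p \<in> ?B m p)"
    proof
      assume "\<exists>c'. supported (L m - A m) c' \<and> c = cut (L m - A m) (cobd c')"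
      then obtain c' where c': "supported (L m - A m) c'" "c = cut (L m - A m) (cobd c')" by blast
      show "\<forall>p. y p \<in> ?B m p"
      proof
        fix p show "y p \<in> ?B m p"
          by (rule cellular_coboundary[OF L(1) A(1,3) lower_adapted[OF L(1)] y c'(1)])
             (use P c'(2) in \<open>auto simp: cut_def\<close>)
      qed
    next
      assume yB: "\<forall>p. y p \<in> ?B m p"
      have "\<forall>q. \<exists>\<psi>. \<psi> \<in> relcochains q (Y (L m)) (cells (A m)) \<and> y (Suc q) = coboundary q (Y (L m)) \<psi>"
        using yB[rule_format, of "Suc _"] by (auto simp: relcoboundaries_def)
      then obtain \<psi> where \<psi>: "\<And>q. \<psi> q \<in> relcochains q (Y (L m)) (cells (A m))"
        "\<And>q. y (Suc q) = coboundary q (Y (L m)) (\<psi> q)" by metis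
      have y0: "y 0 = (\<lambda>x. 0)" using yB[rule_format, of 0] by (simp add: relcoboundaries_def)
      define c' where "c' = (\<lambda>j. if j \<in> L m - A m then \<psi> (d j) (s j) else 0)"
      have c': "supported (L m - A m) c'" by (simp add: supported_def c'_def)
      have "c i = cut (L m - A m) (cobd c') i" for i
      proof (cases "i \<in> L m - A m")
        case True
        have "cobd c' i = y (d i) (s i)"
        proof (cases "d i")
          case 0
          moreover have "i \<le> n" using True lower_le[OF L(1)] by blast
          ultimately show ?thesis using cobd_vertex[of i c'] y0 by simp
        next
          case (Suc q)
          have "cobd c' i = \<psi> q (fboundary (d i) (s i))"
            by (rule cobd_cochain[OF L(1) A(1) \<psi>(1) A(3) c']) (use True Suc in \<open>auto simp: c'_def\<close>)
          then show ?thesis using sL[of i m] True Suc by (simp add: \<psi>(2) coboundary_def on_carrier_def)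
        qed
        then show ?thesis using P True by (simp add: cut_def)
      next
        case False
        then show ?thesis using c by (auto simp: supported_def cut_def)
      qed
      then show "\<exists>c'. supported (L m - A m) c' \<and> c = cut (L m - A m) (cobd c')" using c' by blast
    qed
  next
    fix m c and y :: "nat \<Rightarrow> ('a, 'f) fcochain"
    assume c: "supported (L m - A m) c" and y: "\<And>p. y p \<in> ?Z m p" and P: "?P m c y"
    show "?P (m + 1) (cut (L (m + 1) - A (m + 1)) c) (\<lambda>p. ?\<sigma> m p (y p))"
    proof
      fix j assume j: "j \<in> L (m + 1) - A (m + 1)"
      then have "?\<sigma> m (d j) (y (d j)) (s j) = y (d j) (s j)"
        using sL[of j "m + 1"] by (simp add: on_carrier_def)
      also have "\<dots> = c j"
      proof (cases "j \<in> A m")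
        case True
        then show ?thesis using ZA[OF y] c by (auto simp: supported_def)
      next
        case False
        then show ?thesis using P j L(2)[of m] by auto
      qed
      finally show "?\<sigma> m (d j) (y (d j)) (s j) = cut (L (m + 1) - A (m + 1)) c j"
        using j by (simp add: cut_def)
    qed
  qed auto
qed

end

theorem theorem3p3p9:
  fixes K :: "'a cw_data" and \<iota> :: "nat \<Rightarrow> (nat \<Rightarrow> real, 'f::field) fchain"
  assumes "filtered_cw_complex K" and "disc_generators \<iota>"
  shows "let C = (cell_complex K :: ('f, nat \<Rightarrow> 'f) gmod); D = cell_boundary K \<iota> in
       complex_homology C D \<cong>\<^sub>g\<^sub>r persistent_homology K
     \<and> complex_homology (pdual C) (pdual_map C D) \<cong>\<^sub>g\<^sub>r persistent_cohomology K
     \<and> complex_homology (gdual C) (gdual_map C D) \<cong>\<^sub>g\<^sub>r persistent_rel_cohomology K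
     \<and> complex_homology (pdual (gdual C)) (pdual_map (gdual C) (gdual_map C D))
           \<cong>\<^sub>g\<^sub>r persistent_rel_homology K"
proof -
  interpret cw_complex K \<iota> by unfold_locales (rule assms)+
  obtain s where s: "\<forall>j\<le>n. adapted s j" using adapted_exists by blast
  interpret adapted_cw_complex K \<iota> s by unfold_locales (use s in blast)
  let ?C = "cell_complex K :: ('f, nat \<Rightarrow> 'f) gmod" and ?D = "cell_boundary K \<iota>"
  let ?G = "gdual ?C" and ?E = "gdual_map ?C ?D"
  \<comment> \<open>The cells of the four complexes in degree \<open>m\<close> are \<open>j \<le> m\<close>, \<open>j \<le> - m\<close>, \<open>j \<ge> - m\<close> and
    \<open>j \<ge> m\<close>, and each duality transposes the matrix of the boundary.\<close>
  note c1 = cell_complex_coordinates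
  note c2 = cellular_coordinates.dual_coordinates[OF c1, of coeff, OF bd_def]
  note c3 = gdual_coordinates
  note c4 = cellular_coordinates.dual_coordinates[OF c3, of "\<lambda>i j. coeff j i", OF cobd_def]
  have last_eq: "last_cells m = {..n} - first_cells (m - 1)" for m
    by (auto simp: last_cells_def first_cells_def)
  have bd_eq: "(\<lambda>c i. \<Sum>j\<le>n. coeff i j * c j) = bd" by (simp add: bd_def fun_eq_iff)
  have cobd_eq: "(\<lambda>c i. \<Sum>j\<le>n. coeff j i * c j) = cobd" by (simp add: cobd_def fun_eq_iff)
  have top: "lower {..n}" by (auto simp: lower_def)
  have 1: "complex_homology ?C ?D \<cong>\<^sub>g\<^sub>r persistent_homology K"
  proof (rule persistent_homology_iso[where L = first_cells and A = "\<lambda>m. {}"])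
    show "cellular_coordinates K \<iota> ?C ?D (\<lambda>m. first_cells m - {}) bd (\<lambda>m c. c)"
      using c1 by simp
  qed (auto simp: lower_first_cells persistent_homology_def stage_Y intro: first_cells_mono[THEN subsetD, rotated])
  have 2: "complex_homology (pdual ?C) (pdual_map ?C ?D) \<cong>\<^sub>g\<^sub>r persistent_cohomology K"
  proof (rule persistent_cohomology_iso[where L = "\<lambda>m. first_cells (- m)" and A = "\<lambda>m. {}"])
    show "cellular_coordinates K \<iota> (pdual ?C) (pdual_map ?C ?D) (\<lambda>m. first_cells (- m) - {}) cobd
        (cellular_coordinates.dual_\<kappa> ?C first_cells (\<lambda>m c. c))"
      using c2 by (simp add: cobd_eq)
  qed (auto simp: lower_first_cells persistent_cohomology_def stage_Y intro: first_cells_mono[THEN subsetD, rotated])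
  have 3: "complex_homology ?G ?E \<cong>\<^sub>g\<^sub>r persistent_rel_cohomology K"
  proof (rule persistent_cohomology_iso[where L = "\<lambda>m. {..n}" and A = "\<lambda>m. first_cells (- m - 1)"])
    show "cellular_coordinates K \<iota> ?G ?E (\<lambda>m. {..n} - first_cells (- m - 1)) cobd gdual_\<kappa>"
      using c3 by (simp add: last_eq)
  qed (auto simp: top lower_first_cells persistent_rel_cohomology_def stage_set_cells Y_top
      intro: first_cells_mono[THEN subsetD, rotated] dest: first_cells_le[THEN subsetD])
  have 4: "complex_homology (pdual ?G) (pdual_map ?G ?E) \<cong>\<^sub>g\<^sub>r persistent_rel_homology K"
  proof (rule persistent_homology_iso[where L = "\<lambda>m. {..n}" and A = "\<lambda>m. first_cells (m - 1)"])
    show "cellular_coordinates K \<iota> (pdual ?G) (pdual_map ?G ?E) (\<lambda>m. {..n} - first_cells (m - 1)) bd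
        (cellular_coordinates.dual_\<kappa> ?G (\<lambda>m. last_cells (- m)) gdual_\<kappa>)"
      using c4 by (simp add: bd_eq last_eq)
  qed (auto simp: top lower_first_cells persistent_rel_homology_def stage_set_cells Y_top
      intro: first_cells_mono[THEN subsetD, rotated] dest: first_cells_le[THEN subsetD])
  show ?thesis using 1 2 3 4 by (simp add: Let_def)
qed

end
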